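(* Let $\mu\ge 0$, let $n\ge 0$ be an integer, and let $\xi_\nu=\frac{\nu\pi}{n+1}$ for $0\le\nu\le 2n+1$. Then for every $f\in L^2(W_\mu;B^3)$ and $\mathbf x\in B^3$, the partial sum $S_{n,3}^\mu f(\mathbf x)=\sum_{l=0}^n\operatorname{proj}_{l,3}^\mu f(\mathbf x)$ satisfies $$S_{n,3}^\mu f(\mathbf x)=\frac{1}{n+1}\sum_{\nu=0}^{n}\int_{-1}^1\int_{-1}^1\mathcal R_{\xi_\nu}^\mu(f;t,w)\,\Phi_n^\mu(\xi_\nu,t,w;\mathbf x)\,dt\,\sqrt{1-w^2}\,dw$$ $$\phantom{S_{n,3}^\mu f(\mathbf x)}=\frac{1}{2n+2}\sum_{\nu=0}^{2n+1}\int_{-1}^1\int_{-1}^1\mathcal R_{\xi_\nu}^\mu(f;t,w)\,\Phi_n^\mu(\xi_\nu,t,w;\mathbf x)\,dt\,\sqrt{1-w^2}\,dw,$$ where $\Phi_n^\mu(\xi,t,w;\mathbf x)=\sum_{l=0}^nG_l(\xi,t,w;\mathbf x)$ and $$G_l(\xi,t,w;\mathbf x)=a_{\mu,3}\sum_{k=0}^l h_k^2\,D_k^{\mu+1/2}\Bigl(\xi,t;\tfrac{x_1}{\sqrt{1-x_3^2}},\tfrac{x_2}{\sqrt{1-x_3^2}}\Bigr)(1-w^2)^{k/2}(1-x_3^2)^{k/2}\,\widetilde C_{l-k}^{k+\mu+1}(w)\,\widetilde C_{l-k}^{k+\mu+1}(x_3).$$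
   Context: Ball: $B^3$ is the closed unit ball in $\mathbb R^3$; $W_\mu(\mathbf x)=(1-\|\mathbf x\|^2)^{\mu-1/2}$ on $B^3$; $a_{\mu,3}=\frac{\Gamma(\mu+2)}{\pi^{3/2}\Gamma(\mu+1/2)}=1/\int_{B^3}W_\mu$. $\mathcal V_l^3(W_\mu)$ is the space of polynomials in three variables of degree $l$ (together with $0$) orthogonal to all polynomials of degree $<l$ under $\langle P,Q\rangle=a_{\mu,3}\int_{B^3}PQW_\mu\,d\mathbf x$, and $\operatorname{proj}_{l,3}^\mu$ is the orthogonal projection of $L^2(W_\mu;B^3)$ onto $\mathcal V_l^3(W_\mu)$ (polynomial representative). For $t,w\in(-1,1)$, $\mathcal R_\theta^\mu(f;t,w)$ is the integral of $fW_\mu$ with respect to arc length over the segment $\{\mathbf x\in B^3: x_3=w,\ x_1\cos\theta+x_2\sin\theta=t\sqrt{1-w^2}\}$ (defined for a.e. $(t,w)$ when $f\in L^2(W_\mu;B^3)$). $h_k^2=(\mu+2)_k/(\mu+3/2)_k$ with $(a)_k=a(a+1)\cdots(a+k-1)$. $C_k^\lambda$ is the Gegenbauer polynomial of degree $k$, orthogonal for $(1-s^2)^{\lambda-1/2}$ on $[-1,1]$, with $C_k^\lambda(1)=(2\lambda)_k/k!$; $\widetilde C_k^\lambda=C_k^\lambda\big/\sqrt{\lambda(2\lambda)_k/((k+\lambda)k!)}$ is orthonormal for that weight normalized to integral $1$. Disk: on the closed unit disk $B^2$, $W_\mu(x,y)=(1-x^2-y^2)^{\mu-1/2}$, $a_\mu=(\mu+1/2)/\pi=1/\int_{B^2}W_\mu$,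 and $\mathcal V_k^2(W_\mu)$ is the space of polynomials in two variables of degree $k$ (with $0$) orthogonal to all polynomials of degree $<k$ under $a_\mu\int_{B^2}PQW_\mu$. $p_l^{(\alpha,\beta)}$ is the Jacobi polynomial of degree $l$ with positive leading coefficient, orthonormal for $(1-t)^\alpha(1+t)^\beta$ normalized to integral $1$ on $[-1,1]$. Orthonormal basis of $\mathcal V_k^2(W_\mu)$: with $x=r\cos\phi$, $y=r\sin\phi$, $$P_{i,\varepsilon}^k(x,y)=h_{i,k}\,p_i^{(\mu-1/2,\,k-2i)}(2r^2-1)\,r^{k-2i}S_{k-2i,\varepsilon}(\phi),$$ $S_{j,0}(\phi)=\cos j\phi$, $S_{j,1}(\phi)=\sin j\phi$, $0\le2i\le k$ if $\varepsilon=0$, $0\le2i\le k-1$ if $\varepsilon=1$, $$h_{i,k}^2=\frac1{d_{i,k}}\frac{\Gamma(k-2i+\mu+3/2)}{\Gamma(\mu+3/2)\Gamma(k-2i+1)},\quad h_{i,k}>0,\qquad d_{i,k}=\tfrac12\ (2i<k),\ d_{i,k}=1\ (2i=k).$$ $$\lambda_{i,k}^\mu=\frac{i!\,(k-i)!\,(k-i+\mu+\frac12)}{(\mu+\frac12)_i(\mu+\frac32)_{k-i}(k+\mu+\frac12)},\qquad D_k^{\mu+1/2}(\xi;x,y)=\sum_{i,\varepsilon}\lambda_{i,k}^\mu P_{i,\varepsilon}^k(\cos\xi,\sin\xi)P_{i,\varepsilon}^k(x,y)$$ (all admissible $(i,\varepsilon)$), and $$D_k^{\mu+1/2}(\xi,t;x,y)=\frac{k+\mu+1/2}{\mu+1/2}\,C_k^{\mu+1/2}(t)\,D_k^{\mu+1/2}(\xi;x,y).$$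 The expression $(1-x_3^2)^{k/2}D_k^{\mu+1/2}(\xi,t;x_1/\sqrt{1-x_3^2},x_2/\sqrt{1-x_3^2})$ is a polynomial in $\mathbf x$ and is so interpreted when $|x_3|=1$. *)

theory Defs
  imports "HOL-Analysis.Analysis" "HOL-Computational_Algebra.Polynomial"
begin

section \<open>Weighted \<open>L\<^sup>2\<close> space and orthogonal projections on the unit ball\<close>

text \<open>Since \<open>0 powr a = 0\<close>, the weight is \<open>0\<close> on the sphere for every \<open>\<mu>\<close>; this only concerns null sets
  (likewise for the weights on \<open>[-1, 1]\<close> below).\<close>

definition ball_weight :: "real \<Rightarrow> real^3 \<Rightarrow> real" where
  "ball_weight \<mu> x = (1 - (norm x)\<^sup>2) powr (\<mu> - 1/2)"

definition ball_const :: "real \<Rightarrow> real" where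
  "ball_const \<mu> = Gamma (\<mu> + 2) / (pi powr (3/2) * Gamma (\<mu> + 1/2))"

definition ball_L2 :: "real \<Rightarrow> (real^3 \<Rightarrow> real) set" where
  "ball_L2 \<mu> = {f. set_borel_measurable lebesgue (cball 0 1) f \<and>
                  set_integrable lebesgue (cball 0 1) (\<lambda>x. (f x)\<^sup>2 * ball_weight \<mu> x)}"

definition ball_inner :: "real \<Rightarrow> (real^3 \<Rightarrow> real) \<Rightarrow> (real^3 \<Rightarrow> real) \<Rightarrow> real" where
  "ball_inner \<mu> f g =
     ball_const \<mu> * (LINT x:cball 0 1|lebesgue. f x * g x * ball_weight \<mu> x)"

text \<open>Polynomial functions in three variables of total degree at most \<open>d\<close>.\<close>

definition polys3_le :: "nat \<Rightarrow> (real^3 \<Rightarrow> real) set" where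
  "polys3_le d = {P. \<exists>c :: nat \<Rightarrow> nat \<Rightarrow> nat \<Rightarrow> real. \<forall>x.
     P x = (\<Sum>(i, j, k) \<in> {(i, j, k). i + j + k \<le> d}. c i j k * (x$1)^i * (x$2)^j * (x$3)^k)}"

definition has_degree3 :: "(real^3 \<Rightarrow> real) \<Rightarrow> nat \<Rightarrow> bool" where
  "has_degree3 P l \<longleftrightarrow> P \<in> polys3_le l \<and> (\<forall>d<l. P \<notin> polys3_le d)"

definition ball_V :: "real \<Rightarrow> nat \<Rightarrow> (real^3 \<Rightarrow> real) set" where
  "ball_V \<mu> l = {P. (P = (\<lambda>x. 0) \<or> has_degree3 P l) \<and>
                    (\<forall>d<l. \<forall>Q \<in> polys3_le d. ball_inner \<mu> P Q = 0)}"

definition ball_proj :: "real \<Rightarrow> nat \<Rightarrow> (real^3 \<Rightarrow> real) \<Rightarrow> real^3 \<Rightarrow> real" where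
  "ball_proj \<mu> l f =
     (THE P. P \<in> ball_V \<mu> l \<and> (\<forall>Q \<in> ball_V \<mu> l. ball_inner \<mu> (\<lambda>x. f x - P x) Q = 0))"

definition ball_partial_sum :: "real \<Rightarrow> nat \<Rightarrow> (real^3 \<Rightarrow> real) \<Rightarrow> real^3 \<Rightarrow> real" where
  "ball_partial_sum \<mu> n f x = (\<Sum>l\<le>n. ball_proj \<mu> l f x)"


section \<open>Radon projections\<close>

definition radon_segment :: "real \<Rightarrow> real \<Rightarrow> real \<Rightarrow> (real^3) set" where
  "radon_segment \<theta> t w =
     {x \<in> cball 0 1. x$3 = w \<and> x$1 * cos \<theta> + x$2 * sin \<theta> = t * sqrt (1 - w\<^sup>2)}"

definition radon_line :: "real \<Rightarrow> real \<Rightarrow> real \<Rightarrow> real \<Rightarrow> real^3" where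
  "radon_line \<theta> t w s =
     vector [t * sqrt (1 - w\<^sup>2) * cos \<theta> - s * sin \<theta>,
             t * sqrt (1 - w\<^sup>2) * sin \<theta> + s * cos \<theta>, w]"

text \<open>Integration with respect to arc length over the segment is integration in the parameter
  of \<^const>\<open>radon_line\<close>, which by the next two lemmas is an isometric parametrization of
  the line that carries the segment.\<close>

lemma dist_radon_line: "dist (radon_line \<theta> t w s) (radon_line \<theta> t w s') = \<bar>s - s'\<bar>"
proof -
  have "(s' * sin \<theta> - s * sin \<theta>)\<^sup>2 + (s * cos \<theta> - s' * cos \<theta>)\<^sup>2
          = (s - s')\<^sup>2 * ((sin \<theta>)\<^sup>2 + (cos \<theta>)\<^sup>2)"
    by algebra
  then show ?thesis
    by (simp add: radon_line_def dist_norm norm_vec_def L2_set_def sum_3 real_sqrt_abs)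
qed

lemma radon_segment_subset_line: "radon_segment \<theta> t w \<subseteq> range (radon_line \<theta> t w)"
proof
  fix x assume "x \<in> radon_segment \<theta> t w"
  then have w: "x$3 = w" and t: "t * sqrt (1 - w\<^sup>2) = x$1 * cos \<theta> + x$2 * sin \<theta>"
    by (auto simp: radon_segment_def)
  have cs: "c * (cos \<theta> * cos \<theta>) + c * (sin \<theta> * sin \<theta>) = c" for c :: real
    by (metis distrib_left mult.right_neutral power2_eq_square sin_cos_squared_add2)
  have "x = radon_line \<theta> t w (x$2 * cos \<theta> - x$1 * sin \<theta>)"
    unfolding vec_eq_iff forall_3 radon_line_def t
    using cs[of "x$1"] cs[of "x$2"] by (simp add: w algebra_simps)
  then show "x \<in> range (radon_line \<theta> t w)" by blast
qed

definition radon :: "real \<Rightarrow> real \<Rightarrow> (real^3 \<Rightarrow> real) \<Rightarrow> real \<Rightarrow> real \<Rightarrow> real" where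
  "radon \<mu> \<theta> f t w =
     (LINT s:{s. radon_line \<theta> t w s \<in> radon_segment \<theta> t w}|lebesgue.
        f (radon_line \<theta> t w s) * ball_weight \<mu> (radon_line \<theta> t w s))"


section \<open>Gegenbauer and Jacobi polynomials\<close>

definition gegenbauer :: "nat \<Rightarrow> real \<Rightarrow> real poly" where
  "gegenbauer k \<kappa> = (THE p. degree p = k \<and>
     (\<forall>q. degree q < k \<longrightarrow>
        (LINT s:{-1..1}|lebesgue. poly p s * poly q s * (1 - s\<^sup>2) powr (\<kappa> - 1/2)) = 0) \<and>
     poly p 1 = pochhammer (2 * \<kappa>) k / fact k)"

definition gegenbauer_normalized :: "nat \<Rightarrow> real \<Rightarrow> real \<Rightarrow> real" where
  "gegenbauer_normalized k \<kappa> s =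
     poly (gegenbauer k \<kappa>) s / sqrt (\<kappa> * pochhammer (2 * \<kappa>) k / ((real k + \<kappa>) * fact k))"

definition jacobi_inner :: "real \<Rightarrow> real \<Rightarrow> real poly \<Rightarrow> real poly \<Rightarrow> real" where
  "jacobi_inner \<alpha> \<beta> p q =
     (LINT t:{-1..1}|lebesgue. poly p t * poly q t * ((1 - t) powr \<alpha> * (1 + t) powr \<beta>)) /
     (LINT t:{-1..1}|lebesgue. (1 - t) powr \<alpha> * (1 + t) powr \<beta>)"

definition jacobi_orthonormal :: "nat \<Rightarrow> real \<Rightarrow> real \<Rightarrow> real poly" where
  "jacobi_orthonormal l \<alpha> \<beta> = (THE p. degree p = l \<and> lead_coeff p > 0 \<and>
     (\<forall>q. degree q < l \<longrightarrow> jacobi_inner \<alpha> \<beta> p q = 0) \<and> jacobi_inner \<alpha> \<beta> p p = 1)"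


section \<open>The orthonormal basis on the unit disk and the kernels\<close>

definition disk_d :: "nat \<Rightarrow> nat \<Rightarrow> real" where
  "disk_d i k = (if 2 * i = k then 1 else 1/2)"

definition disk_h :: "real \<Rightarrow> nat \<Rightarrow> nat \<Rightarrow> real" where
  "disk_h \<mu> i k = sqrt (1 / disk_d i k *
     (Gamma (real (k - 2*i) + \<mu> + 3/2) / (Gamma (\<mu> + 3/2) * Gamma (real (k - 2*i) + 1))))"

definition trig_S :: "nat \<Rightarrow> nat \<Rightarrow> real \<Rightarrow> real" where
  "trig_S j \<epsilon> \<phi> = (if \<epsilon> = 0 then cos (real j * \<phi>) else sin (real j * \<phi>))"

text \<open>Polar coordinates are taken from the complex number \<open>x + i y\<close>; the choice of argument is
  immaterial, also at the origin, where \<open>r ^ (k - 2 * i) = 0\<close> unless \<open>k = 2 * i\<close>.\<close>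

definition disk_P :: "real \<Rightarrow> nat \<Rightarrow> nat \<Rightarrow> nat \<Rightarrow> real \<Rightarrow> real \<Rightarrow> real" where
  "disk_P \<mu> k i \<epsilon> x y =
     (let r = cmod (Complex x y); \<phi> = Arg (Complex x y) in
        disk_h \<mu> i k * poly (jacobi_orthonormal i (\<mu> - 1/2) (real (k - 2*i))) (2 * r\<^sup>2 - 1) *
        r ^ (k - 2*i) * trig_S (k - 2*i) \<epsilon> \<phi>)"

text \<open>The condition \<open>2 * i + \<epsilon> \<le> k\<close> reads \<open>2 * i \<le> k\<close> for \<open>\<epsilon> = 0\<close> and \<open>2 * i \<le> k - 1\<close> (never
  satisfied if \<open>k = 0\<close>) for \<open>\<epsilon> = 1\<close>.\<close>

definition disk_indices :: "nat \<Rightarrow> (nat \<times> nat) set" where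
  "disk_indices k = {(i, \<epsilon>). \<epsilon> \<in> {0, 1} \<and> 2 * i + \<epsilon> \<le> k}"

definition disk_lambda :: "real \<Rightarrow> nat \<Rightarrow> nat \<Rightarrow> real" where
  "disk_lambda \<mu> i k =
     fact i * fact (k - i) * (real (k - i) + \<mu> + 1/2) /
     (pochhammer (\<mu> + 1/2) i * pochhammer (\<mu> + 3/2) (k - i) * (real k + \<mu> + 1/2))"

definition disk_D :: "real \<Rightarrow> nat \<Rightarrow> real \<Rightarrow> real \<Rightarrow> real \<Rightarrow> real" where
  "disk_D \<mu> k \<xi> x y =
     (\<Sum>(i, \<epsilon>) \<in> disk_indices k.
        disk_lambda \<mu> i k * disk_P \<mu> k i \<epsilon> (cos \<xi>) (sin \<xi>) * disk_P \<mu> k i \<epsilon> x y)"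

definition disk_D_t :: "real \<Rightarrow> nat \<Rightarrow> real \<Rightarrow> real \<Rightarrow> real \<Rightarrow> real \<Rightarrow> real" where
  "disk_D_t \<mu> k \<xi> t x y =
     (real k + \<mu> + 1/2) / (\<mu> + 1/2) * poly (gegenbauer k (\<mu> + 1/2)) t * disk_D \<mu> k \<xi> x y"

definition ball_D_expr :: "real \<Rightarrow> nat \<Rightarrow> real \<Rightarrow> real \<Rightarrow> real^3 \<Rightarrow> real" where
  "ball_D_expr \<mu> k \<xi> t x =
     (1 - (x$3)\<^sup>2) powr (real k / 2) *
     disk_D_t \<mu> k \<xi> t (x$1 / sqrt (1 - (x$3)\<^sup>2)) (x$2 / sqrt (1 - (x$3)\<^sup>2))"

text \<open>At the poles of the sphere \<^const>\<open>ball_D_expr\<close> is interpreted as the value of the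
  polynomial with which it agrees on the rest of the ball.\<close>

definition ball_D :: "real \<Rightarrow> nat \<Rightarrow> real \<Rightarrow> real \<Rightarrow> real^3 \<Rightarrow> real" where
  "ball_D \<mu> k \<xi> t x =
     (if \<bar>x$3\<bar> < 1 then ball_D_expr \<mu> k \<xi> t x
      else (THE Q. (\<exists>d. Q \<in> polys3_le d) \<and>
                   (\<forall>y \<in> cball 0 1. \<bar>y$3\<bar> < 1 \<longrightarrow> Q y = ball_D_expr \<mu> k \<xi> t y)) x)"

definition ball_h_sq :: "real \<Rightarrow> nat \<Rightarrow> real" where
  "ball_h_sq \<mu> k = pochhammer (\<mu> + 2) k / pochhammer (\<mu> + 3/2) k"

definition kernel_G :: "real \<Rightarrow> nat \<Rightarrow> real \<Rightarrow> real \<Rightarrow> real \<Rightarrow> real^3 \<Rightarrow> real" where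
  "kernel_G \<mu> l \<xi> t w x =
     ball_const \<mu> * (\<Sum>k\<le>l. ball_h_sq \<mu> k * ball_D \<mu> k \<xi> t x * (1 - w\<^sup>2) powr (real k / 2) *
        gegenbauer_normalized (l - k) (real k + \<mu> + 1) w *
        gegenbauer_normalized (l - k) (real k + \<mu> + 1) (x$3))"

definition kernel_Phi :: "real \<Rightarrow> nat \<Rightarrow> real \<Rightarrow> real \<Rightarrow> real \<Rightarrow> real^3 \<Rightarrow> real" where
  "kernel_Phi \<mu> n \<xi> t w x = (\<Sum>l\<le>n. kernel_G \<mu> l \<xi> t w x)"

end

theory Submission
  imports Defs
begin

text \<open>The disk polynomials \<open>P\<^sub>i\<^sub>,\<^sub>\<epsilon>\<^sup>k\<close>, homogenized by \<open>1 - x\<^sub>3\<^sup>2\<close> and multiplied by Gegenbauer polynomials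
  in \<open>x\<^sub>3\<close>, form an orthonormal basis of the polynomials on the ball, so the projection onto the
  polynomials of degree \<open>l\<close> has the kernel \<open>\<Sum> E(x) E(y)\<close> over the basis elements \<open>E\<close> of degree \<open>l\<close>.
  The ridge function \<open>(1 - y\<^sub>3\<^sup>2)\<^bsup>k/2\<^esup> C\<^sub>k(t)\<close> with \<open>t (1 - y\<^sub>3\<^sup>2)\<^bsup>1/2\<^esup> = y\<^sub>1 cos \<xi> + y\<^sub>2 sin \<xi>\<close> is orthogonal to every
  polynomial of degree less than \<open>k\<close> in \<open>(y\<^sub>1, y\<^sub>2)\<close>, hence a combination of homogenized disk polynomials of
  degree \<open>k\<close>; on the circle \<open>y\<^sub>3 = 0\<close>, \<open>\<bar>y\<bar> = 1\<close> its coefficients are seen to be the Fourier coefficients of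
  \<open>C\<^sub>k(cos \<phi>)\<close>. In the average over the nodes of its product with \<open>D\<^sub>k(\<xi>; x)\<close> only frequencies \<open>j\<close>, \<open>j'\<close> of
  the same parity meet, so the discrete orthogonality of \<open>cos 2m\<xi>\<close>, \<open>sin 2m\<xi>\<close> for \<open>m \<le> n\<close> leaves exactly
  the kernel of the projection, the factors \<open>\<lambda>\<^sub>i\<^sub>,\<^sub>k\<close> cancelling the Fourier coefficients. Integration in the
  coordinates along and across the segments turns the ball integral into Radon projections.\<close>

section \<open>Orthogonal polynomials on \<open>[-1, 1]\<close>\<close>

text \<open>Projections, Gegenbauer and Jacobi polynomials are all given by descriptions, so each
  has to be identified before it can be used. For the Gegenbauer polynomials this goes through the
  Fourier expansion of \<open>C_k(cos \<phi>)\<close> that the generating function suggests: it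
  supplies the coefficients that the quadrature meets, and the differential equation verified on it
  yields degree, orthogonality and norm. The Jacobi polynomials enter through orthonormality and
  nonvanishing at 1; their values at 1 appear as a factor in \<open>D_k\<close> and as a divisor in
  the ridge function, and cancel. Completeness of the basis comes from rewriting monomials. Division
  by \<open>sqrt (1 - x$3^2)\<close> breaks down at the poles, so every function of the disk
  variables is homogenized first; this also makes the kernel a polynomial in the integration
  variable, hence bounded on the ball and continuous. A further obstacle is that f is merely
  Lebesgue measurable: its restriction to a particular segment can be arbitrary, so the change to
  segment coordinates is carried out for a Borel representative, off a null set that almost every
  line meets in a null set.\<close>

lemma poly_degree_induct:
  fixes B :: "nat \<Rightarrow> 'a::field poly"
  assumes "\<And>j. j \<le> k \<Longrightarrow> degree (B j) = j \<and> B j \<noteq> 0"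
    and "P 0" and "\<And>p q. P p \<Longrightarrow> P q \<Longrightarrow> P (p + q)" and "\<And>c j. j \<le> k \<Longrightarrow> P (smult c (B j))"
    and "degree q \<le> k"
  shows "P q"
  using assms(5)
proof (induction "degree q" arbitrary: q rule: less_induct)
  case less
  show ?case
  proof (cases "q = 0")
    case False
    let ?d = "degree q"
    \<comment> \<open>Removing this multiple of \<open>B ?d\<close> cancels the leading term. Stated
      as an induction rule, the argument serves both to test orthogonality and to prove membership
      in a span.\<close>
    define c where "c = lead_coeff q / lead_coeff (B ?d)"
    have d: "degree (B ?d) = ?d" "B ?d \<noteq> 0" using assms(1) less.prems by auto
    define r where "r = q - smult c (B ?d)"
    have "coeff (B ?d) ?d \<noteq> 0" using d by (metis leading_coeff_0_iff)
    then have cf: "coeff r ?d = 0" using d by (simp add: r_def c_def)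
    have dr: "degree r \<le> ?d" unfolding r_def using d by (intro degree_diff_le) auto
    have "P r"
    proof (cases "r = 0")
      case False
      then have "degree r \<noteq> ?d" using cf by (metis leading_coeff_0_iff)
      then show ?thesis using less dr by (metis le_neq_implies_less le_trans)
    qed (simp add: assms(2))
    moreover have "q = r + smult c (B ?d)" by (simp add: r_def)
    ultimately show ?thesis using assms(3,4) less.prems by metis
  qed (simp add: assms(2))
qed

text \<open>Positivity is restricted to the open interval because \<open>0 powr a = 0\<close> makes
  the Jacobi and Gegenbauer weights vanish at the ends.\<close>

locale poly_weight =
  fixes v :: "real \<Rightarrow> real"
  assumes weight_pos: "\<And>s. s \<in> {-1<..<1} \<Longrightarrow> v s > 0"
    and weight_integrable: "set_integrable lebesgue {-1..1} v"
begin

lemma integrable_continuous_weight: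
  assumes "continuous_on {-1..1} g"
  shows "set_integrable lebesgue {-1..1} (\<lambda>s. g s * v s)"
proof -
  have "bounded (g ` {-1..1})"
    using assms by (intro compact_imp_bounded compact_continuous_image) auto
  moreover have "set_borel_measurable lebesgue {-1..1} g"
    using borel_measurable_continuous_on_indicator[of "{-1..1}" g] assms
    unfolding set_borel_measurable_def by (intro measurable_completion) simp
  ultimately have "set_integrable lebesgue {-1..1} (\<lambda>s. v s *\<^sub>R g s)"
    using weight_integrable unfolding set_integrable_def set_borel_measurable_def bounded_iff
  proof (elim exE, goal_cases)
    case (1 C)
    show ?case
    proof (rule Bochner_Integration.integrable_bound)
      show "integrable lebesgue (\<lambda>s. C * (indicator {-1..1} s *\<^sub>R v s))" using 1 by simp
      have "(\<lambda>x. (indicator {-1..1} x *\<^sub>R v x) * (indicator {-1..1} x *\<^sub>R g x)) \<in> borel_measurable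
          lebesgue"
        using 1 by (intro borel_measurable_times) auto
      moreover have "(\<lambda>x. (indicator {-1..1} x *\<^sub>R v x) * (indicator {-1..1} x *\<^sub>R g x)) =
        (\<lambda>x. indicator {-1..1} x *\<^sub>R v x *\<^sub>R g x)" by (auto simp: indicator_def fun_eq_iff)
      ultimately show "(\<lambda>x. indicator {-1..1} x *\<^sub>R v x *\<^sub>R g x) \<in> borel_measurable lebesgue" by simp
      show "AE x in lebesgue. norm (indicator {-1..1} x *\<^sub>R v x *\<^sub>R g x)
              \<le> norm (C * (indicator {-1..1} x *\<^sub>R v x))"
      proof (intro AE_I2)
        fix x :: real
        have "\<bar>g x\<bar> \<le> \<bar>C\<bar>" if "x \<in> {-1..1}" using 1(3) that
          by (metis abs_ge_self dual_order.trans imageI real_norm_def)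
        then show "norm (indicator {-1..1} x *\<^sub>R v x *\<^sub>R g x)
              \<le> norm (C * (indicator {-1..1} x *\<^sub>R v x))"
          by (auto simp: indicator_def abs_mult mult.commute[of "\<bar>v x\<bar>"] intro!: mult_right_mono)
      qed
    qed
  qed
  then show ?thesis by (simp add: mult.commute)
qed

definition wint :: "real poly \<Rightarrow> real" where
  "wint p = (LINT s:{-1..1}|lebesgue. poly p s * v s)"

lemma integrable_poly: "set_integrable lebesgue {-1..1} (\<lambda>s. poly p s * v s)"
  by (intro integrable_continuous_weight continuous_intros)

lemma wint_0 [simp]: "wint 0 = 0"
  by (simp add: wint_def)

lemma wint_add: "wint (p + q) = wint p + wint q"
  unfolding wint_def by (simp add: distrib_right set_integral_add(2)[OF integrable_poly
      integrable_poly])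

lemma wint_smult: "wint (smult c p) = c * wint p"
  unfolding wint_def by (simp add: mult.assoc)

lemma wint_diff: "wint (p - q) = wint p - wint q"
  using wint_add[of p "smult (-1) q"] wint_smult[of "-1" q] by simp

lemma wint_sum: "wint (sum f A) = (\<Sum>a\<in>A. wint (f a))"
  by (induction A rule: infinite_finite_induct) (auto simp: wint_add)

text \<open>The integrand vanishes almost everywhere, while a nonzero polynomial has finitely many
  roots, so the interval would be a union of two null sets. The sign is asked for on the open
  interval alone because the lemma is applied to \<open>(1 - s) q^2\<close> as well as to
  squares.\<close>

lemma wint_nonneg_eq_0D:
  assumes nn: "\<And>s. s \<in> {-1<..<1} \<Longrightarrow> poly q s \<ge> 0" and "wint q = 0"
  shows "q = 0"
proof -
  let ?g = "\<lambda>s. indicator {-1<..<1} s *\<^sub>R (poly q s * v s)"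
  have si: "set_integrable lebesgue {-1<..<1} (\<lambda>s. poly q s * v s)"
    by (rule set_integrable_subset[OF integrable_poly]) auto
  have ae: "AE s in lebesgue. s \<noteq> (c::real)" for c by (simp add: AE_lborel_singleton AE_completion)
  have "(LINT s:{-1<..<1}|lebesgue. poly q s * v s) = wint q"
    unfolding wint_def set_lebesgue_integral_def
  proof (rule integral_cong_AE)
    show "AE x in lebesgue. indicat_real {- 1<..<1} x *\<^sub>R (poly q x * v x) =
                  indicat_real {- 1..1} x *\<^sub>R (poly q x * v x)"
      using ae[of 1] ae[of "-1"] by eventually_elim (auto simp: indicator_def)
  qed (use si integrable_poly in \<open>auto simp: set_integrable_def\<close>)
  then have "integral\<^sup>L lebesgue ?g = 0"
    using assms(2) by (simp add: set_lebesgue_integral_def)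
  moreover have "AE s in lebesgue. ?g s \<ge> 0"
    using nn weight_pos by (intro AE_I2) (auto simp: indicator_def less_imp_le)
  ultimately have "AE s in lebesgue. ?g s = 0"
    using si integral_nonneg_eq_0_iff_AE unfolding set_integrable_def by blast
  then have "AE s in lebesgue. s \<in> {-1<..<1} \<longrightarrow> poly q s = 0"
    by eventually_elim (use weight_pos in \<open>fastforce simp: indicator_def\<close>)
  then have "AE s in lborel. s \<in> {-1<..<1} \<longrightarrow> poly q s = 0" by (simp add: AE_completion_iff)
  moreover have cl: "closed {s. poly q s = 0}"
    by (intro closed_Collect_eq continuous_intros)
  then have m: "{-1<..<1} \<inter> {s. poly q s \<noteq> 0} \<in> sets borel"
    by (metis borel_closed borel_open open_greaterThanLessThan sets.Diff Diff_eq Collect_neg_eq)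
  ultimately have *: "emeasure lborel ({-1<..<1} \<inter> {s. poly q s \<noteq> 0}) = 0"
    by (subst (asm) AE_iff_measurable[OF _ refl]) (auto simp: Int_def conj_ac)
  show ?thesis
  proof (rule ccontr)
    assume "q \<noteq> 0"
    then have "finite {s. poly q s = 0}" by (rule poly_roots_finite)
    then have "emeasure lborel {s. poly q s = 0} = 0" by (rule emeasure_lborel_countable[OF
        countable_finite])
    moreover have "emeasure lborel ({-1<..<1::real}) \<le>
        emeasure lborel (({-1<..<1} \<inter> {s. poly q s \<noteq> 0}) \<union> {s. poly q s = 0})"
      by (rule emeasure_mono) (use cl m in \<open>auto intro: borel_closed\<close>)
    moreover have "\<dots> \<le> emeasure lborel ({-1<..<1} \<inter> {s. poly q s \<noteq> 0}) + emeasure lborel {s. poly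
        q s = 0}"
      by (rule emeasure_subadditive) (use cl m in \<open>auto intro: borel_closed\<close>)
    ultimately show False using * by simp
  qed
qed

lemma wint_square_pos:
  assumes "p \<noteq> 0" shows "wint (p * p) > 0"
proof -
  have "wint (p * p) \<ge> 0"
    unfolding wint_def set_lebesgue_integral_def
  proof (rule integral_nonneg_AE)
    have ae: "AE s in lebesgue. s \<noteq> (c::real)" for c by (simp add: AE_lborel_singleton AE_completion)
    show "AE s in lebesgue. 0 \<le> indicat_real {- 1..1} s *\<^sub>R (poly (p * p) s * v s)"
      using ae[of 1] ae[of "-1"]
    proof eventually_elim
      case (elim s)
      then show ?case using weight_pos[of s] by (auto simp: indicator_def)
    qed
  qed
  moreover have "wint (p * p) \<noteq> 0" using wint_nonneg_eq_0D[of "p * p"] assms by auto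
  ultimately show ?thesis by simp
qed

definition orth :: "nat \<Rightarrow> real poly \<Rightarrow> bool" where
  "orth k p \<longleftrightarrow> (\<forall>q. degree q < k \<longrightarrow> wint (p * q) = 0)"

text \<open>A polynomial of degree at most \<open>k\<close> vanishing at \<open>1\<close> is \<open>(1 - s) q\<close>, and testing it against
  \<open>q\<close> gives the integral of \<open>(1 - s) q\<^sup>2\<close>.\<close>

lemma orth_eq_0:
  assumes "orth k p" "degree p \<le> k" "poly p 1 = 0"
  shows "p = 0"
proof (rule ccontr)
  assume p: "p \<noteq> 0"
  obtain q where q: "p = [:-1, 1:] * q" using assms(3) poly_eq_0_iff_dvd by blast
  have q0: "q \<noteq> 0" using p q by auto
  have "degree p = Suc (degree q)" unfolding q using q0 by (subst degree_mult_eq) auto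
  then have "degree (smult (-1) q) < k" using assms(2) by auto
  then have "wint (p * smult (-1) q) = 0" using assms(1) unfolding orth_def by blast
  then have w: "wint ([:1, -1:] * (q * q)) = 0" by (simp add: q algebra_simps wint_smult)
  have "[:1, -1:] * (q * q) = 0"
  proof (rule wint_nonneg_eq_0D[OF _ w])
    fix s :: real assume "s \<in> {-1<..<1}"
    then show "poly ([:1, -1:] * (q * q)) s \<ge> 0"
      by (simp add: algebra_simps mult_right_mono[of s 1 "poly q s * poly q s", simplified])
  qed
  moreover have "[:1, -1:] \<noteq> (0 :: real poly)" by simp
  ultimately show False using q0 by (metis mult_eq_0_iff)
qed

text \<open>This is the uniqueness behind \<open>gegenbauer\<close>, whose normalization is by the
  value at 1; \<open>orth_eq_0\<close> applied to the difference says that this value determines the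
  polynomial.\<close>

lemma orth_unique:
  assumes "orth k p" "degree p \<le> k" "orth k q" "degree q \<le> k" "poly p 1 = poly q 1"
  shows "p = q"
proof -
  have "orth k (p - q)" using assms by (auto simp: orth_def left_diff_distrib wint_diff)
  moreover have "degree (p - q) \<le> k" using assms by (intro degree_diff_le)
  ultimately show ?thesis using orth_eq_0[of k "p - q"] assms by simp
qed

lemma orth_smult: "orth k p \<Longrightarrow> orth k (smult c p)"
  by (auto simp: orth_def wint_smult)

text \<open>Gram-Schmidt: \<open>r\<close> is the projection of the monomial of degree k onto the
  span of the orthogonal polynomials of lower degree supplied by the induction.\<close>

lemma orth_exists: "\<exists>p. degree p = k \<and> lead_coeff p = 1 \<and> orth k p"
proof (induction k rule: less_induct)
  case (less k)
  then obtain B where B: "\<And>j. j < k \<Longrightarrow> degree (B j) = j \<and> lead_coeff (B j) = 1 \<and> orth j (B j)"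
    by metis
  have B0: "j < k \<Longrightarrow> B j \<noteq> 0" for j using B[of j] by auto
  have BB: "i < k \<Longrightarrow> j < k \<Longrightarrow> i \<noteq> j \<Longrightarrow> wint (B i * B j) = 0" for i j
    using B[of i] B[of j] unfolding orth_def by (metis linorder_neqE_nat mult.commute)
  define r where "r = (\<Sum>i<k. smult (wint (monom 1 k * B i) / wint (B i * B i)) (B i))"
  define p where "p = monom 1 k - r"
  have dr: "k > 0 \<Longrightarrow> degree r < k"
    unfolding r_def using B by (intro degree_sum_less) (auto intro: le_less_trans[OF degree_smult_le])
  have r0: "k = 0 \<Longrightarrow> r = 0" by (simp add: r_def)
  have cr: "coeff r k = 0" using dr r0 coeff_eq_0 by (cases "k = 0") auto
  then have ck: "coeff p k = 1" by (simp add: p_def)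
  have "degree p \<le> k" unfolding p_def using dr r0
    by (intro degree_diff_le) (auto simp: degree_monom_eq less_imp_le le_less_linear intro:
        Nat.gr0I, fastforce)
  then have dp: "degree p = k" using ck by (metis le_antisym le_degree zero_neq_one)
  have pB: "wint (p * B j) = 0" if "j < k" for j
  proof -
    have "wint (r * B j) = (\<Sum>i<k. wint (monom 1 k * B i) / wint (B i * B i) * wint (B i * B j))"
      by (simp add: r_def sum_distrib_right wint_sum wint_smult)
    also have "\<dots> = (\<Sum>i<k. if i = j then wint (monom 1 k * B j) else 0)"
      by (intro sum.cong refl) (use BB that wint_square_pos[OF B0] in \<open>auto simp:
          order_less_imp_not_eq2\<close>)
    also have "\<dots> = wint (monom 1 k * B j)" using that by simp
    finally show ?thesis by (simp add: p_def left_diff_distrib wint_diff)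
  qed
  have "orth k p" unfolding orth_def
  proof (intro allI impI)
    fix q :: "real poly" assume q: "degree q < k"
    show "wint (p * q) = 0"
      by (rule poly_degree_induct[where P = "\<lambda>q. wint (p * q) = 0" and B = B and k = "k - 1"])
        (use q B B0 pB in \<open>auto simp: distrib_left wint_add wint_smult\<close>)
  qed
  then show ?case using dp ck by metis
qed

end

section \<open>Jacobi and Gegenbauer polynomials\<close>

lemma jacobi_weight_has_integral:
  fixes \<alpha> \<beta> :: real
  assumes "\<alpha> > -1" "\<beta> > -1"
  shows "((\<lambda>t. (1 - t) powr \<alpha> * (1 + t) powr \<beta>) has_integral 2 powr (\<alpha> + \<beta> + 1) * Beta (\<beta> + 1) (\<alpha>
      + 1)) {-1..1}"
proof -
  have "((\<lambda>t. t powr \<beta> * (1 - t) powr \<alpha>) has_integral Beta (\<beta> + 1) (\<alpha> + 1)) (cbox 0 1)"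
    using has_integral_Beta_real[of "\<beta> + 1" "\<alpha> + 1"] assms by simp
  from has_integral_affinity[OF this, of "1/2" "1/2"]
  have "((\<lambda>x. (1/2 * x + 1/2) powr \<beta> * (1 - (1/2 * x + 1/2)) powr \<alpha>) has_integral 2 * Beta (\<beta> + 1)
      (\<alpha> + 1))
      ((\<lambda>x. 2 * x - 1) ` {0..1})" by simp
  also have "(\<lambda>x::real. 2 * x - 1) ` {0..1} = {-1..1}"
    using image_affinity_cbox[of 2 "-1" 0 "1::real"] by simp
  finally have "((\<lambda>x. 2 powr (\<alpha> + \<beta>) * ((1/2 * x + 1/2) powr \<beta> * (1 - (1/2 * x + 1/2)) powr \<alpha>))
      has_integral
       2 powr (\<alpha> + \<beta>) * (2 * Beta (\<beta> + 1) (\<alpha> + 1))) {-1..1}"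
    by (rule has_integral_mult_right)
  moreover have "2 powr (\<alpha> + \<beta>) * (2 * Beta (\<beta> + 1) (\<alpha> + 1)) = 2 powr (\<alpha> + \<beta> + 1) * Beta (\<beta> + 1)
      (\<alpha> + 1)"
    by (simp add: powr_add)
  moreover have "2 powr (\<alpha> + \<beta>) * ((1/2 * x + 1/2) powr \<beta> * (1 - (1/2 * x + 1/2)) powr \<alpha>) =
      (1 - x) powr \<alpha> * (1 + x) powr \<beta>" if "x \<in> {-1..1}" for x
  proof -
    have a: "1/2 * x + 1/2 = (1 + x) / 2" "1 - (1 + x) / 2 = (1 - x) / 2" by (auto simp: field_simps)
    have "((1 + x) / 2) powr \<beta> = (1 + x) powr \<beta> / 2 powr \<beta>" "((1 - x) / 2) powr \<alpha> = (1 - x) powr \<alpha>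
        / 2 powr \<alpha>"
      using that by (auto intro: powr_divide)
    then show ?thesis by (simp only: a powr_add) simp
  qed
  ultimately show ?thesis using has_integral_cong[of "{-1..1}"] by (metis (no_types, lifting))
qed

lemma jacobi_weight_integrable:
  fixes \<alpha> \<beta> :: real
  assumes "\<alpha> > -1" "\<beta> > -1"
  shows "set_integrable lebesgue {-1..1} (\<lambda>t. (1 - t) powr \<alpha> * (1 + t) powr \<beta>)"
  using jacobi_weight_has_integral[OF assms]
  by (intro nonnegative_absolutely_integrable_1) (auto simp: has_integral_iff)

lemma jacobi_weight_mass:
  fixes \<alpha> \<beta> :: real
  assumes "\<alpha> > -1" "\<beta> > -1"
  shows "(LINT t:{-1..1}|lebesgue. (1 - t) powr \<alpha> * (1 + t) powr \<beta>) = 2 powr (\<alpha> + \<beta> + 1) * Beta (\<beta>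
      + 1) (\<alpha> + 1)"
  using jacobi_weight_has_integral[OF assms] jacobi_weight_integrable[OF assms]
  by (metis has_integral_iff set_lebesgue_integral_eq_integral(2))

lemma poly_weight_jacobi:
  assumes "\<alpha> > -1" "\<beta> > -1"
  shows "poly_weight (\<lambda>t. (1 - t) powr \<alpha> * (1 + t) powr \<beta>)"
  by unfold_locales (use jacobi_weight_integrable[OF assms] in auto)

lemma jacobi_inner_wint:
  assumes "\<alpha> > -1" "\<beta> > -1"
  shows "jacobi_inner \<alpha> \<beta> p q = poly_weight.wint (\<lambda>t. (1 - t) powr \<alpha> * (1 + t) powr \<beta>) (p * q)
    / (2 powr (\<alpha> + \<beta> + 1) * Beta (\<beta> + 1) (\<alpha> + 1))"
  by (simp add: jacobi_inner_def poly_weight.wint_def[OF poly_weight_jacobi[OF assms]]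
      jacobi_weight_mass[OF assms])

lemma Beta_real_pos: "a > 0 \<Longrightarrow> b > 0 \<Longrightarrow> Beta a b > (0::real)"
  by (simp add: Beta_def)

text \<open>Existence is a rescaling of the monic orthogonal polynomial. For uniqueness, the
  difference of one candidate and the multiple of the other with the same leading coefficient has
  lower degree, hence is orthogonal to itself. The value at 1 is nonzero by
  \<open>orth_eq_0\<close>; it is later a divisor.\<close>

lemma jacobi_orthonormal:
  fixes \<alpha> \<beta> :: real and l :: nat
  assumes ab: "\<alpha> > -1" "\<beta> > -1"
  defines "p \<equiv> jacobi_orthonormal l \<alpha> \<beta>"
  shows jacobi_degree: "degree p = l"
    and jacobi_orthogonal: "degree q < l \<Longrightarrow> jacobi_inner \<alpha> \<beta> p q = 0"
    and jacobi_norm: "jacobi_inner \<alpha> \<beta> p p = 1"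
    and jacobi_at_1: "poly p 1 \<noteq> 0"
proof -
  interpret poly_weight "\<lambda>t. (1 - t) powr \<alpha> * (1 + t) powr \<beta>" by (rule poly_weight_jacobi[OF ab])
  note ji = jacobi_inner_wint[OF ab]
  define M where "M = 2 powr (\<alpha> + \<beta> + 1) * Beta (\<beta> + 1) (\<alpha> + 1)"
  have M: "M > 0" using ab by (simp add: M_def Beta_real_pos)
  let ?P = "\<lambda>p. degree p = l \<and> lead_coeff p > 0 \<and>
     (\<forall>q. degree q < l \<longrightarrow> jacobi_inner \<alpha> \<beta> p q = 0) \<and> jacobi_inner \<alpha> \<beta> p p = 1"
  have P: "?P p \<longleftrightarrow> degree p = l \<and> lead_coeff p > 0 \<and> orth l p \<and> wint (p * p) = M" for p
    unfolding ji M_def[symmetric] orth_def using M by auto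
  obtain r where r: "degree r = l" "lead_coeff r = 1" "orth l r" using orth_exists by blast
  then have r0: "wint (r * r) > 0" by (intro wint_square_pos) auto
  define c where "c = sqrt (M / wint (r * r))"
  have c: "c > 0" "c * c * wint (r * r) = M" using r0 M by (auto simp: c_def)
  have ex: "?P (smult c r)"
    unfolding P using c r by (auto simp: orth_smult wint_smult)
  have "p = q" if p: "?P p" and q: "?P q" for p q
  proof -
    define s where "s = p - smult (lead_coeff p / lead_coeff q) q"
    have cf: "coeff s l = 0" using p q by (auto simp: s_def)
    have ds: "degree s \<le> l" using p q by (auto simp: s_def intro!: degree_diff_le)
    have os: "orth l s" using p q unfolding P by (auto simp: s_def orth_def left_diff_distrib
        wint_diff wint_smult)
    have "s = 0"
    proof (rule ccontr)
      assume "s \<noteq> 0"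
      then have "degree s < l" using cf ds by (metis leading_coeff_0_iff le_neq_implies_less)
      then have "wint (s * s) = 0" using os orth_def by blast
      then show False using wint_square_pos[OF \<open>s \<noteq> 0\<close>] by simp
    qed
    then have e: "p = smult (lead_coeff p / lead_coeff q) q" by (simp add: s_def)
    define d where "d = lead_coeff p / lead_coeff q"
    have d: "d > 0" unfolding d_def using p q by (intro divide_pos_pos) auto
    have e: "p = smult d q" using e by (simp add: d_def)
    have "wint (p * p) = M" "wint (q * q) = M" using p q unfolding P by auto
    then have "d * d = 1" unfolding e using M by (simp add: wint_smult)
    then have "d = 1" using d by (metis abs_of_pos abs_square_eq_1 power2_eq_square)
    then show ?thesis using e by simp
  qed
  then have "?P p" unfolding p_def jacobi_orthonormal_def
    by (intro theI[of ?P, OF ex]) (use ex in blast)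
  then show "degree p = l" "degree q < l \<Longrightarrow> jacobi_inner \<alpha> \<beta> p q = 0" "jacobi_inner \<alpha> \<beta> p p = 1"
    by auto
  have "orth l p" "lead_coeff p > 0" using \<open>?P p\<close> unfolding P by auto
  then show "poly p 1 \<noteq> 0" using orth_eq_0[of l p] \<open>degree p = l\<close> by auto
qed

section \<open>The Gegenbauer weight: total mass and integration by parts\<close>

definition gegw :: "real \<Rightarrow> real \<Rightarrow> real" where
  "gegw \<kappa> s = (1 - s\<^sup>2) powr (\<kappa> - 1/2)"

lemma gegw_jacobi: "s \<in> {-1..1} \<Longrightarrow> gegw \<kappa> s = (1 - s) powr (\<kappa> - 1/2) * (1 + s) powr (\<kappa> - 1/2)"
proof -
  have "1 - s\<^sup>2 = (1 - s) * (1 + s)" by algebra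
  then show "s \<in> {-1..1} \<Longrightarrow> ?thesis" by (simp add: gegw_def powr_mult)
qed

lemma poly_weight_gegw: "\<kappa> > -1/2 \<Longrightarrow> poly_weight (gegw \<kappa>)"
proof unfold_locales
  show "gegw \<kappa> s > 0" if "s \<in> {-1<..<1}" for s
  proof -
    have "s\<^sup>2 < 1" using that by (simp add: abs_square_less_1 abs_less_iff)
    then show ?thesis by (simp add: gegw_def)
  qed
  assume k: "\<kappa> > -1/2"
  show "set_integrable lebesgue {-1..1} (gegw \<kappa>)"
  proof -
    have "set_integrable lebesgue {-1..1} (gegw \<kappa>) \<longleftrightarrow>
        set_integrable lebesgue {-1..1} (\<lambda>s. (1 - s) powr (\<kappa> - 1/2) * (1 + s) powr (\<kappa> - 1/2))"
      by (intro set_integrable_cong refl gegw_jacobi)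
    then show ?thesis using jacobi_weight_integrable[of "\<kappa> - 1/2" "\<kappa> - 1/2"] k by simp
  qed
qed

definition gegint :: "real \<Rightarrow> real poly \<Rightarrow> real" where
  "gegint \<kappa> p = (LINT s:{-1..1}|lebesgue. poly p s * gegw \<kappa> s)"

lemma gegint_wint: "\<kappa> > -1/2 \<Longrightarrow> gegint \<kappa> = poly_weight.wint (gegw \<kappa>)"
  by (simp add: gegint_def fun_eq_iff poly_weight.wint_def[OF poly_weight_gegw])

definition gegmass :: "real \<Rightarrow> real" where
  "gegmass \<kappa> = sqrt pi * Gamma (\<kappa> + 1/2) / Gamma (\<kappa> + 1)"

text \<open>The Beta value is \<open>Gamma (\<kappa> + 1/2)^2 / Gamma (2 * \<kappa> + 1)\<close>;
  Legendre duplication, a formula for complex arguments, trades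
  \<open>Gamma (\<kappa> + 1/2) / Gamma (2 * \<kappa> + 1)\<close> for
  \<open>1 / Gamma (\<kappa> + 1)\<close> up to a power of 2 and \<open>sqrt pi\<close>.\<close>

lemma gegint_1:
  assumes "\<kappa> > -1/2"
  shows "gegint \<kappa> 1 = gegmass \<kappa>"
proof -
  have "gegint \<kappa> 1 = (LINT s:{-1..1}|lebesgue. (1 - s) powr (\<kappa> - 1/2) * (1 + s) powr (\<kappa> - 1/2))"
    unfolding gegint_def by (intro set_lebesgue_integral_cong) (auto simp: gegw_jacobi)
  also have "\<dots> = 2 powr (2 * \<kappa>) * Beta (\<kappa> + 1/2) (\<kappa> + 1/2)"
    using assms by (subst jacobi_weight_mass) (auto simp: algebra_simps)
  also have "\<dots> = gegmass \<kappa>"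
  proof -
    define z where "z = complex_of_real (\<kappa> + 1/2)"
    have np: "complex_of_real x \<notin> \<int>\<^sub>\<le>\<^sub>0" if "x > 0" for x
      using that by (auto elim!: nonpos_Ints_cases simp: complex_eq_iff)
    have z1: "z + 1/2 = complex_of_real (\<kappa> + 1)" "2 * z = complex_of_real (2 * \<kappa> + 1)"
      by (simp_all add: z_def)
    have z2: "(1 - 2 * z) * complex_of_real (ln 2) = complex_of_real (- (2 * \<kappa>) * ln 2)"
      by (simp add: z_def algebra_simps)
    have "Gamma z * Gamma (z + 1/2) = exp ((1 - 2*z) * of_real (ln 2)) * of_real (sqrt pi) * Gamma
        (2*z)"
      by (intro Gamma_legendre_duplication) (unfold z1, unfold z_def, (rule np, use assms in simp)+)
    then have "complex_of_real (Gamma (\<kappa> + 1/2) * Gamma (\<kappa> + 1)) =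
      complex_of_real (exp (- (2 * \<kappa>) * ln 2) * sqrt pi * Gamma (2 * \<kappa> + 1))"
      unfolding z2 unfolding z1 by (simp only: z_def Gamma_complex_of_real exp_of_real[symmetric]
          of_real_mult)
    then have *: "Gamma (\<kappa> + 1/2) * Gamma (\<kappa> + 1) = 2 powr (- (2 * \<kappa>)) * sqrt pi * Gamma (2 * \<kappa> + 1)"
      by (simp only: of_real_eq_iff) (simp add: powr_def)
    have "Gamma (\<kappa> + 1) \<noteq> 0" "Gamma (2 * \<kappa> + 1) \<noteq> 0" using assms
      by (auto intro!: less_imp_neq[symmetric] Gamma_real_pos)
    moreover have "\<kappa> + 1/2 + (\<kappa> + 1/2) = 2 * \<kappa> + 1" by simp
    moreover have "2 powr (2 * \<kappa>) * 2 powr (- (2 * \<kappa>)) = (1::real)" by (simp add: powr_minus)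
    moreover have "P * (A * A / C) = s * A / B" if "B \<noteq> 0" "C \<noteq> 0" "P * Q = 1" "A * B = Q * s * C"
        for A B C P Q s :: real
    proof -
      have "P * (A * A) * B = s * A * C" using that by algebra
      then show ?thesis using that by (simp add: field_simps)
    qed
    ultimately show ?thesis using * unfolding Beta_def gegmass_def by metis
  qed
  finally show ?thesis .
qed

text \<open>The adjoint of the derivative: \<open>\<integral> p (gegL \<kappa> q) (1 - s\<^sup>2)\<^bsup>\<kappa> - 1/2\<^esup> = \<integral> p' q (1 - s\<^sup>2)\<^bsup>\<kappa> + 1/2\<^esup>\<close>.\<close>

definition gegL :: "real \<Rightarrow> real poly \<Rightarrow> real poly" where
  "gegL \<kappa> q = [:0, 2 * \<kappa> + 1:] * q - [:1, 0, -1:] * pderiv q"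

text \<open>The integrand is the derivative of \<open>?F\<close> in the open interval, and
  \<open>?F\<close> is continuous on the closed one and vanishes at both ends because \<kappa> + 1/2
  > 0.\<close>

lemma gegint_gegL:
  assumes k: "\<kappa> > -1/2"
  shows "gegint \<kappa> (gegL \<kappa> u) = 0"
proof -
  interpret poly_weight "gegw \<kappa>" by (rule poly_weight_gegw[OF k])
  let ?F = "\<lambda>s. - (poly u s * (1 - s\<^sup>2) powr (\<kappa> + 1/2))"
  have c: "continuous_on {-1..1} ?F" using k
    by (intro continuous_intros continuous_on_powr') (auto simp: power_le_one abs_square_le_1
        abs_le_iff)
  have d: "(?F has_vector_derivative poly (gegL \<kappa> u) s * gegw \<kappa> s) (at s)" if s: "s \<in> {-1<..<1}" for s
  proof -
    have p: "1 - s\<^sup>2 > 0" using s by (simp add: abs_square_less_1 abs_less_iff)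
    have e: "(1 - s\<^sup>2) powr (\<kappa> + 1/2) = (1 - s\<^sup>2) * (1 - s\<^sup>2) powr (\<kappa> - 1/2)"
      using p powr_add[of "1 - s\<^sup>2" 1 "\<kappa> - 1/2"] by (simp add: algebra_simps)
    have "(?F has_real_derivative - (poly (pderiv u) s * (1 - s\<^sup>2) powr (\<kappa> + 1/2)
        + (\<kappa> + 1/2) * (1 - s\<^sup>2) powr (\<kappa> - 1/2) * (- 2 * s) * poly u s)) (at s)"
      by (rule derivative_eq_intros refl has_real_derivative_powr | use p in force)+
    then show ?thesis unfolding has_real_derivative_iff_has_vector_derivative
    proof (rule has_vector_derivative_eq_rhs)
      have "poly (gegL \<kappa> u) s = (2 * \<kappa> + 1) * s * poly u s - (1 - s\<^sup>2) * poly (pderiv u) s"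
        by (simp add: gegL_def algebra_simps power2_eq_square)
      then show "- (poly (pderiv u) s * (1 - s\<^sup>2) powr (\<kappa> + 1/2)
        + (\<kappa> + 1/2) * (1 - s\<^sup>2) powr (\<kappa> - 1/2) * (- 2 * s) * poly u s) = poly (gegL \<kappa> u) s * gegw \<kappa> s"
        unfolding e gegw_def by algebra
    qed
  qed
  have "((\<lambda>s. poly (gegL \<kappa> u) s * gegw \<kappa> s) has_integral (?F 1 - ?F (-1))) {-1..1}"
    by (rule fundamental_theorem_of_calculus_interior[OF _ c d]) auto
  then have "integral {-1..1} (\<lambda>s. poly (gegL \<kappa> u) s * gegw \<kappa> s) = 0"
    by (simp add: has_integral_iff)
  then show ?thesis unfolding gegint_def
    by (simp add: set_lebesgue_integral_eq_integral(2)[OF integrable_poly])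
qed

lemma gegint_shift: "gegint (\<kappa> + 1) p = gegint \<kappa> ([:1, 0, -1:] * p)"
  unfolding gegint_def
proof (intro set_lebesgue_integral_cong allI impI)
  fix s :: real assume s: "s \<in> {-1..1}"
  have "1 - s\<^sup>2 \<ge> 0" using s by (simp add: abs_square_le_1 abs_le_iff)
  then have "(1 - s\<^sup>2) powr (\<kappa> + 1 - 1/2) = (1 - s\<^sup>2) * (1 - s\<^sup>2) powr (\<kappa> - 1/2)"
    using powr_add[of "1 - s\<^sup>2" 1 "\<kappa> - 1/2"] by (cases "1 - s\<^sup>2 = 0") (auto simp: algebra_simps)
  moreover have "poly ([:1, 0, -1:] * p) s = (1 - s\<^sup>2) * poly p s"
    by (simp add: algebra_simps power2_eq_square)
  ultimately show "poly p s * gegw (\<kappa> + 1) s = poly ([:1, 0, -1:] * p) s * gegw \<kappa> s"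
    by (simp only: gegw_def) simp
qed simp

lemma gegint_adjoint:
  assumes "\<kappa> > -1/2"
  shows "gegint \<kappa> (p * gegL \<kappa> q) = gegint (\<kappa> + 1) (pderiv p * q)"
proof -
  interpret poly_weight "gegw \<kappa>" by (rule poly_weight_gegw[OF assms])
  have "gegL \<kappa> (p * q) = p * gegL \<kappa> q - [:1, 0, -1:] * (pderiv p * q)"
    unfolding gegL_def pderiv_mult by algebra
  then have "gegint \<kappa> (p * gegL \<kappa> q) - gegint \<kappa> ([:1, 0, -1:] * (pderiv p * q)) = 0"
    using gegint_gegL[OF assms, of "p * q"] by (simp only: gegint_wint[OF assms] wint_diff)
  then show ?thesis unfolding gegint_shift by simp
qed

section \<open>Explicit Gegenbauer polynomials and their differential equation\<close>

fun cheb :: "nat \<Rightarrow> real poly" where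
  "cheb 0 = 1"
| "cheb (Suc 0) = [:0, 1:]"
| "cheb (Suc (Suc n)) = [:0, 2:] * cheb (Suc n) - cheb n"

lemma poly_cheb_cos: "poly (cheb n) (cos \<phi>) = cos (real n * \<phi>)"
proof (induction n rule: cheb.induct)
  case (3 n)
  have "cos (real (Suc (Suc n)) * \<phi>) + cos (real n * \<phi>) = 2 * cos \<phi> * cos (real (Suc n) * \<phi>)"
    using cos_add[of "real (Suc n) * \<phi>" \<phi>] cos_diff[of "real (Suc n) * \<phi>" \<phi>]
    by (simp add: algebra_simps)
  then show ?case using 3 by simp
qed auto

text \<open>These come from the generating function:
  \<open>(1 - 2 z cos \<phi> + z^2)^(-\<kappa>)\<close> is the product of
  \<open>(1 - z e^(i \<phi>))^(-\<kappa>)\<close> and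
  \<open>(1 - z e^(-i \<phi>))^(-\<kappa>)\<close>, and multiplying the two binomial series gives
  this factor for the frequency k - 2 i in the coefficient of \<open>z^k\<close>.\<close>

definition gegcoef :: "real \<Rightarrow> nat \<Rightarrow> nat \<Rightarrow> real" where
  "gegcoef \<kappa> k i = pochhammer \<kappa> i * pochhammer \<kappa> (k - i) / (fact i * fact (k - i))"

text \<open>The candidate for \<open>gegenbauer k \<kappa>\<close>, as a combination of Chebyshev
  polynomials of the first kind. In this form its Fourier coefficients are visible, and those are
  what the quadrature needs.\<close>

definition gegR :: "real \<Rightarrow> nat \<Rightarrow> real poly" where
  "gegR \<kappa> k = (\<Sum>i\<le>k. smult (gegcoef \<kappa> k i) (cheb (nat \<bar>int k - 2 * int i\<bar>)))"

lemma poly_gegR_cos: "poly (gegR \<kappa> k) (cos \<phi>) = (\<Sum>i\<le>k. gegcoef \<kappa> k i * cos ((real k - 2 * real i) * \<phi>))"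
  unfolding gegR_def poly_sum poly_smult poly_cheb_cos
proof (intro sum.cong refl)
  fix i
  have "real (nat \<bar>int k - 2 * int i\<bar>) = \<bar>real k - 2 * real i\<bar>" by simp
  then show "gegcoef \<kappa> k i * cos (real (nat \<bar>int k - 2 * int i\<bar>) * \<phi>) = gegcoef \<kappa> k i * cos ((real
      k - 2 * real i) * \<phi>)"
    using cos_minus[of "(real k - 2 * real i) * \<phi>"] by (cases "real k - 2 * real i < 0") (simp_all
        add: left_diff_distrib)
qed

text \<open>At \<phi> = 0 every cosine is 1, and the sum of the coefficients is the Vandermonde
  convolution for rising factorials.\<close>

lemma poly_gegR_1: "poly (gegR \<kappa> k) 1 = pochhammer (2 * \<kappa>) k / fact k"
proof -
  have "poly (gegR \<kappa> k) 1 = (\<Sum>i\<le>k. gegcoef \<kappa> k i)" using poly_gegR_cos[of \<kappa> k 0] by simp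
  also have "\<dots> = (\<Sum>i\<le>k. of_nat (k choose i) * pochhammer \<kappa> i * pochhammer \<kappa> (k - i)) / fact k"
    unfolding sum_divide_distrib
  proof (intro sum.cong refl)
    fix i assume "i \<in> {..k}"
    then have "real (k choose i) = fact k / (fact i * fact (k - i))" by (simp add: binomial_fact)
    then show "gegcoef \<kappa> k i = real (k choose i) * pochhammer \<kappa> i * pochhammer \<kappa> (k - i) / fact k"
      by (simp add: gegcoef_def)
  qed
  also have "\<dots> = pochhammer (2 * \<kappa>) k / fact k"
    using pochhammer_binomial_sum[of \<kappa> \<kappa> k] by (simp only: mult_2)
  finally show ?thesis .
qed

lemma gegcoef_Suc:
  assumes "i < k"
  shows "real (Suc i) * (real k - real (Suc i) + \<kappa>) * gegcoef \<kappa> k (Suc i) = (real k - real i) *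
      (real i + \<kappa>) * gegcoef \<kappa> k i"
proof -
  obtain j where j: "k = Suc i + j" using assms less_iff_Suc_add by auto
  have "k - i = Suc j" "k - Suc i = j" using j by auto
  then show ?thesis using j
    by (simp add: gegcoef_def pochhammer_Suc divide_simps) (simp add: algebra_simps)
qed

text \<open>Multiplying out, the \<open>i\<close>-th summand is a difference of multiples of
  \<open>sin ((k - 2 i \<plusminus> 1) \<phi>)\<close>, and by \<open>gegcoef_Suc\<close> the sum telescopes.\<close>

lemma gegR_trig_ode:
  fixes \<kappa> \<phi> :: real and k :: nat
  defines "m \<equiv> \<lambda>i. real k - 2 * real i"
  shows "(\<Sum>i\<le>k. gegcoef \<kappa> k i * ((real k * (real k + 2 * \<kappa>) - (m i)\<^sup>2) * cos (m i * \<phi>) * sin \<phi>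
    - 2 * \<kappa> * m i * sin (m i * \<phi>) * cos \<phi>)) = 0"
proof -
  define b where "b i = 2 * real i * (real k - real i + \<kappa>) * gegcoef \<kappa> k i * sin ((m i + 1) * \<phi>)" for i
  define c where "c i = 2 * (real k - real i) * (real i + \<kappa>) * gegcoef \<kappa> k i * sin ((m i - 1) *
      \<phi>)" for i
  have "gegcoef \<kappa> k i * ((real k * (real k + 2 * \<kappa>) - (m i)\<^sup>2) * cos (m i * \<phi>) * sin \<phi>
    - 2 * \<kappa> * m i * sin (m i * \<phi>) * cos \<phi>) = b i - c i" for i
  proof -
    have s: "sin ((m i + 1) * \<phi>) = sin (m i * \<phi>) * cos \<phi> + cos (m i * \<phi>) * sin \<phi>"
      "sin ((m i - 1) * \<phi>) = sin (m i * \<phi>) * cos \<phi> - cos (m i * \<phi>) * sin \<phi>"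
      by (simp_all add: distrib_right left_diff_distrib sin_add sin_diff)
    show ?thesis unfolding b_def c_def s unfolding m_def by algebra
  qed
  then have "?thesis \<longleftrightarrow> (\<Sum>i\<le>k. b i) = (\<Sum>i\<le>k. c i)" by (simp add: sum_subtractf)
  moreover have "(\<Sum>i\<le>k. b i) = (\<Sum>i<k. b (Suc i))"
    by (simp add: lessThan_Suc_atMost[symmetric] sum.lessThan_Suc_shift b_def del: sum.lessThan_Suc)
  moreover have "(\<Sum>i\<le>k. c i) = (\<Sum>i<k. c i)"
    by (simp add: lessThan_Suc_atMost[symmetric] c_def)
  moreover have "b (Suc i) = c i" if "i < k" for i
  proof -
    have "m (Suc i) + 1 = m i - 1" by (simp add: m_def)
    then show ?thesis using gegcoef_Suc[OF that, of \<kappa>] unfolding b_def c_def by algebra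
  qed
  ultimately show ?thesis by simp
qed

text \<open>Written out, this is the Gegenbauer equation \<open>(1 - s^2) R'' - (2 \<kappa> + 1) s
  R' + k (k + 2 \<kappa>) R = 0\<close>. Differentiating \<open>poly_gegR_cos\<close> twice in
  \<phi> expresses R' and R'' at cos \<phi> by trigonometric sums, and \<open>gegR_trig_ode\<close>
  then gives the equation times sin \<phi>. Dividing by it is possible on the open interval, which
  is enough for a polynomial identity.\<close>

lemma gegR_ode: "gegL \<kappa> (pderiv (gegR \<kappa> k)) = smult (real k * (real k + 2 * \<kappa>)) (gegR \<kappa> k)"
proof -
  let ?R = "gegR \<kappa> k" and ?a = "gegcoef \<kappa> k" and ?m = "\<lambda>i. real k - 2 * real i"
  let ?K = "real k * (real k + 2 * \<kappa>)"
  have d1: "sin \<phi> * poly (pderiv ?R) (cos \<phi>) = (\<Sum>i\<le>k. ?a i * ?m i * sin (?m i * \<phi>))" for \<phi>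
  proof -
    have "((\<lambda>\<phi>. poly ?R (cos \<phi>)) has_real_derivative poly (pderiv ?R) (cos \<phi>) * - sin \<phi>) (at \<phi>)"
      by (rule DERIV_chain2[OF poly_DERIV]) (auto intro!: derivative_eq_intros)
    moreover have "((\<lambda>\<phi>. \<Sum>i\<le>k. ?a i * cos (?m i * \<phi>)) has_real_derivative
        (\<Sum>i\<le>k. ?a i * (- sin (?m i * \<phi>) * ?m i))) (at \<phi>)"
      by (intro DERIV_sum DERIV_cmult) (auto intro!: derivative_eq_intros)
    ultimately have "poly (pderiv ?R) (cos \<phi>) * - sin \<phi> = (\<Sum>i\<le>k. ?a i * (- sin (?m i * \<phi>) * ?m i))"
      unfolding poly_gegR_cos by (rule DERIV_unique)
    moreover have "\<dots> = - (\<Sum>i\<le>k. ?a i * ?m i * sin (?m i * \<phi>))"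
      unfolding sum_negf[symmetric] by (intro sum.cong refl) simp
    ultimately have "poly (pderiv ?R) (cos \<phi>) * - sin \<phi> = - (\<Sum>i\<le>k. ?a i * ?m i * sin (?m i * \<phi>))"
      by (rule trans)
    then show ?thesis by (simp only: mult_minus_right neg_equal_iff_equal mult.commute[of "sin \<phi>"])
  qed
  have d2: "cos \<phi> * poly (pderiv ?R) (cos \<phi>) - (sin \<phi>)\<^sup>2 * poly (pderiv (pderiv ?R)) (cos \<phi>)
      = (\<Sum>i\<le>k. ?a i * (?m i)\<^sup>2 * cos (?m i * \<phi>))" for \<phi>
  proof -
    have "((\<lambda>\<phi>. poly (pderiv ?R) (cos \<phi>)) has_real_derivative poly (pderiv (pderiv ?R)) (cos \<phi>) *
        - sin \<phi>) (at \<phi>)"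
      by (rule DERIV_chain2[OF poly_DERIV]) (auto intro!: derivative_eq_intros)
    from DERIV_mult[OF DERIV_sin this]
    have "((\<lambda>\<phi>. sin \<phi> * poly (pderiv ?R) (cos \<phi>)) has_real_derivative
      cos \<phi> * poly (pderiv ?R) (cos \<phi>) - (sin \<phi>)\<^sup>2 * poly (pderiv (pderiv ?R)) (cos \<phi>)) (at \<phi>)"
      by (rule DERIV_cong) (simp add: power2_eq_square algebra_simps)
    moreover have "((\<lambda>\<phi>. \<Sum>i\<le>k. ?a i * ?m i * sin (?m i * \<phi>)) has_real_derivative
        (\<Sum>i\<le>k. ?a i * ?m i * (cos (?m i * \<phi>) * ?m i))) (at \<phi>)"
      by (intro DERIV_sum DERIV_cmult) (auto intro!: derivative_eq_intros)
    ultimately have "cos \<phi> * poly (pderiv ?R) (cos \<phi>) - (sin \<phi>)\<^sup>2 * poly (pderiv (pderiv ?R)) (cos \<phi>)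
        = (\<Sum>i\<le>k. ?a i * ?m i * (cos (?m i * \<phi>) * ?m i))"
      unfolding d1 by (rule DERIV_unique)
    also have "\<dots> = (\<Sum>i\<le>k. ?a i * (?m i)\<^sup>2 * cos (?m i * \<phi>))"
      by (intro sum.cong refl) (simp add: power2_eq_square)
    finally show ?thesis .
  qed
  define D where "D = smult ?K ?R - gegL \<kappa> (pderiv ?R)"
  have "poly D s = 0" if s: "s \<in> {-1<..<1}" for s
  proof -
    define \<phi> where "\<phi> = arccos s"
    have c: "cos \<phi> = s" using s by (simp add: \<phi>_def)
    have "sin \<phi> \<noteq> 0" using s by (simp add: \<phi>_def sin_arccos_nonzero)
    have "?K * (\<Sum>i\<le>k. ?a i * cos (?m i * \<phi>)) * sin \<phi> - (\<Sum>i\<le>k. ?a i * (?m i)\<^sup>2 * cos (?m i * \<phi>)) * sin \<phi>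
       - 2 * \<kappa> * cos \<phi> * (\<Sum>i\<le>k. ?a i * ?m i * sin (?m i * \<phi>)) = 0"
      unfolding sum_distrib_left sum_distrib_right sum_subtractf[symmetric]
      using gegR_trig_ode[of \<kappa> k \<phi>] by (simp add: algebra_simps)
    then have *: "?K * poly ?R (cos \<phi>) * sin \<phi> - (cos \<phi> * poly (pderiv ?R) (cos \<phi>) - (sin \<phi>)\<^sup>2 *
        poly (pderiv (pderiv ?R)) (cos \<phi>)) * sin \<phi>
       - 2 * \<kappa> * cos \<phi> * (sin \<phi> * poly (pderiv ?R) (cos \<phi>)) = 0"
      unfolding poly_gegR_cos[symmetric] d1[symmetric] d2[symmetric] .
    then have "sin \<phi> * poly D (cos \<phi>) = 0"
    proof -
      have "poly D (cos \<phi>) = ?K * poly ?R (cos \<phi>) - ((2 * \<kappa> + 1) * cos \<phi> * poly (pderiv ?R) (cos \<phi>)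
          - (1 - (cos \<phi>)\<^sup>2) * poly (pderiv (pderiv ?R)) (cos \<phi>))"
        unfolding D_def gegL_def by (simp add: power2_eq_square algebra_simps)
      then show ?thesis using * sin_cos_squared_add[of \<phi>] by algebra
    qed
    then show ?thesis using c \<open>sin \<phi> \<noteq> 0\<close> by simp
  qed
  then have "{-1<..<1} \<subseteq> {s. poly D s = 0}" by blast
  moreover have "infinite {-1<..<1::real}" by simp
  ultimately have "D = 0" using poly_roots_finite finite_subset by metis
  then show ?thesis by (simp add: D_def)
qed

section \<open>Degree, orthogonality and norm from the differential equation\<close>

lemma coeff_gegL_pderiv:
  "coeff (gegL \<kappa> (pderiv p)) n = real n * (real n + 2 * \<kappa>) * coeff p n - (real n + 1) * (real n +
      2) * coeff p (n + 2)"
proof -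
  have x: "[:0, c:] * q = smult c (pCons 0 q)" for c :: real and q by simp
  have y: "[:1, 0, -1:] * q = q - pCons 0 (pCons 0 q)" for q :: "real poly" by (simp add: algebra_simps)
  show ?thesis unfolding gegL_def x y
    by (auto simp: coeff_pCons coeff_pderiv algebra_simps split: nat.splits)
qed

lemma geg_eigen_less:
  assumes "\<kappa> > 0" "m < k"
  shows "real m * (real m + 2 * \<kappa>) < real k * (real k + 2 * \<kappa>)"
  using assms by (intro mult_strict_mono) auto

text \<open>On monomials the operator is triangular with diagonal entries n (n + 2 \<kappa>).
  Comparing leading coefficients makes the eigenvalue of an eigenfunction the entry for its degree,
  and these entries increase strictly.\<close>

lemma geg_ode_degree:
  assumes "\<kappa> > 0" "q \<noteq> 0" and ode: "gegL \<kappa> (pderiv q) = smult (real k * (real k + 2 * \<kappa>)) q"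
  shows "degree q = k"
proof -
  let ?d = "degree q"
  have "coeff q (?d + 2) = 0" by (simp add: coeff_eq_0)
  then have "real ?d * (real ?d + 2 * \<kappa>) * lead_coeff q = real k * (real k + 2 * \<kappa>) * lead_coeff q"
    using arg_cong[OF ode, of "\<lambda>p. coeff p ?d"] unfolding coeff_gegL_pderiv by simp
  then have "real ?d * (real ?d + 2 * \<kappa>) = real k * (real k + 2 * \<kappa>)" using assms(2) by simp
  then show ?thesis using geg_eigen_less[OF assms(1)] by (metis less_irrefl linorder_neqE_nat)
qed

text \<open>The operator is symmetric by \<open>gegint_adjoint\<close>. The test polynomial p is an
  eigenfunction up to the error \<open>r\<close> of lower degree, to which the induction applies;
  since the eigenvalues for k and for the degree of p differ, the integral must vanish.\<close>

lemma geg_ode_orth: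
  assumes "\<kappa> > 0" and ode: "gegL \<kappa> (pderiv q) = smult (real k * (real k + 2 * \<kappa>)) q"
    and "degree p < k"
  shows "gegint \<kappa> (q * p) = 0"
  using assms(3)
proof (induction "degree p" arbitrary: p rule: less_induct)
  case less
  have k: "\<kappa> > -1/2" using assms(1) by simp
  interpret poly_weight "gegw \<kappa>" by (rule poly_weight_gegw[OF k])
  let ?m = "degree p" and ?K = "\<lambda>m. real m * (real m + 2 * \<kappa>)"
  define r where "r = gegL \<kappa> (pderiv p) - smult (?K ?m) p"
  have cf: "coeff r n = 0" if "n \<ge> ?m" for n
  proof -
    have "coeff p (n + 2) = 0" using that by (intro coeff_eq_0) auto
    moreover have "n = ?m \<or> coeff p n = 0" using that by (metis coeff_eq_0 le_neq_implies_less)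
    ultimately show ?thesis by (auto simp: r_def coeff_gegL_pderiv)
  qed
  have "gegint \<kappa> (q * r) = 0"
  proof (cases "?m = 0")
    case True
    then have "r = 0" using cf by (intro poly_eqI) simp
    then show ?thesis by (simp add: gegint_wint[OF k])
  next
    case False
    then have "degree r < ?m" using cf by (intro degree_lessI) auto
    then show ?thesis using less by simp
  qed
  moreover have "?K k * gegint \<kappa> (q * p) = gegint \<kappa> (p * gegL \<kappa> (pderiv q))"
    unfolding ode by (simp add: gegint_wint[OF k] wint_smult mult.commute[of p])
  moreover have "\<dots> = gegint \<kappa> (q * gegL \<kappa> (pderiv p))"
    unfolding gegint_adjoint[OF k] by (simp add: mult.commute)
  moreover have "gegint \<kappa> (q * gegL \<kappa> (pderiv p)) = gegint \<kappa> (q * r) + ?K ?m * gegint \<kappa> (q * p)"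
    by (simp add: r_def gegint_wint[OF k] wint_smult wint_diff right_diff_distrib)
  ultimately have "(?K k - ?K ?m) * gegint \<kappa> (q * p) = 0" by (simp add: algebra_simps)
  then show ?case using geg_eigen_less[OF assms(1) less.prems] by simp
qed

lemma gegR_nonzero:
  assumes "\<kappa> > 0"
  shows "gegR \<kappa> k \<noteq> 0"
proof -
  have "poly (gegR \<kappa> k) 1 > 0" unfolding poly_gegR_1 using assms by (simp add: pochhammer_pos)
  then show ?thesis by auto
qed

lemma degree_gegR: "\<kappa> > 0 \<Longrightarrow> degree (gegR \<kappa> k) = k"
  using geg_ode_degree[OF _ gegR_nonzero gegR_ode] by simp

lemma gegR_orth:
  assumes "\<kappa> > 0" shows "poly_weight.orth (gegw \<kappa>) k (gegR \<kappa> k)"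
proof -
  have k: "\<kappa> > -1/2" using assms(1) by simp
  interpret poly_weight "gegw \<kappa>" by (rule poly_weight_gegw[OF k])
  show ?thesis unfolding orth_def using geg_ode_orth[OF assms gegR_ode] by (simp add: gegint_wint[OF k])
qed

lemma gegenbauer_eq_gegR:
  assumes "\<kappa> > 0"
  shows "gegenbauer k \<kappa> = gegR \<kappa> k"
proof -
  have k: "\<kappa> > -1/2" using assms(1) by simp
  interpret poly_weight "gegw \<kappa>" by (rule poly_weight_gegw[OF k])
  have o: "(\<forall>q. degree q < k \<longrightarrow>
        (LINT s:{-1..1}|lebesgue. poly p s * poly q s * (1 - s\<^sup>2) powr (\<kappa> - 1/2)) = 0) \<longleftrightarrow> orth k p" for p
    by (simp add: orth_def wint_def gegw_def)
  show ?thesis unfolding gegenbauer_def o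
  proof (rule the_equality)
    show "degree (gegR \<kappa> k) = k \<and> orth k (gegR \<kappa> k) \<and> poly (gegR \<kappa> k) 1 = pochhammer (2 * \<kappa>) k / fact k"
      using degree_gegR[OF assms] gegR_orth[OF assms] poly_gegR_1 by blast
    show "p = gegR \<kappa> k" if "degree p = k \<and> orth k p \<and> poly p 1 = pochhammer (2 * \<kappa>) k / fact k" for p
      by (rule orth_unique[of k]) (use that degree_gegR[OF assms, of k] gegR_orth[OF assms, of k]
          poly_gegR_1[of \<kappa> k] in simp_all)
  qed
qed

text \<open>Differentiating the equation once gives the equation for \<kappa> + 1 and k, so the
  derivative is orthogonal for the next weight and agrees with \<open>gegR (\<kappa> + 1) k\<close>
  up to a factor. The factor is found at s = 1, where \<open>1 - s^2\<close> removes the second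
  derivative and the equation yields R'(1) from R(1).\<close>

lemma pderiv_gegR:
  assumes "\<kappa> > 0"
  shows "pderiv (gegR \<kappa> (Suc k)) = smult (2 * \<kappa>) (gegR (\<kappa> + 1) k)"
proof -
  have k: "\<kappa> + 1 > -1/2" "\<kappa> + 1 > 0" using assms(1) by auto
  interpret poly_weight "gegw (\<kappa> + 1)" by (rule poly_weight_gegw[OF k(1)])
  let ?R = "gegR \<kappa> (Suc k)"
  let ?q = "pderiv ?R"
  have "pderiv (gegL \<kappa> ?q) = gegL (\<kappa> + 1) (pderiv ?q) + smult (2 * \<kappa> + 1) ?q"
  proof (rule poly_ext)
    fix x
    show "poly (pderiv (gegL \<kappa> ?q)) x = poly (gegL (\<kappa> + 1) (pderiv ?q) + smult (2 * \<kappa> + 1) ?q) x"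
      unfolding gegL_def pderiv_diff pderiv_mult
      by (simp add: pderiv_pCons) (simp add: algebra_simps)
  qed
  then have "gegL (\<kappa> + 1) (pderiv ?q) = smult (real (Suc k) * (real (Suc k) + 2 * \<kappa>)) ?q - smult
      (2 * \<kappa> + 1) ?q"
    unfolding gegR_ode pderiv_smult by simp
  also have "\<dots> = smult (real k * (real k + 2 * (\<kappa> + 1))) ?q"
    by (simp add: smult_diff_left[symmetric] algebra_simps)
  finally have o: "orth k ?q" unfolding orth_def
    using geg_ode_orth[OF k(2)] by (simp add: gegint_wint[OF k(1)])
  have "poly (gegL \<kappa> ?q) 1 = (2 * \<kappa> + 1) * poly ?q 1" by (simp add: gegL_def)
  then have "(2 * \<kappa> + 1) * poly ?q 1 = real (Suc k) * (real (Suc k) + 2 * \<kappa>) * (pochhammer (2 * \<kappa>)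
      (Suc k) / fact (Suc k))"
    unfolding gegR_ode by (simp add: poly_gegR_1)
  also have "\<dots> = (2 * \<kappa> + 1) * (2 * \<kappa> * (pochhammer (2 * (\<kappa> + 1)) k / fact k))"
  proof -
    have "pochhammer (2 * \<kappa>) (Suc (Suc k)) = 2 * \<kappa> * ((2 * \<kappa> + 1) * pochhammer (2 * \<kappa> + 1 + 1) k)"
      by (simp only: pochhammer_rec)
    then have "pochhammer (2 * \<kappa>) (Suc k) * (2 * \<kappa> + real (Suc k)) = 2 * \<kappa> * ((2 * \<kappa> + 1) *
        pochhammer (2 * (\<kappa> + 1)) k)"
      by (subst (asm) pochhammer_Suc) (simp add: algebra_simps)
    then show ?thesis by (simp add: divide_simps del: pochhammer_Suc of_nat_Suc) (simp add:
        algebra_simps)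
  qed
  finally have "poly ?q 1 = 2 * \<kappa> * (pochhammer (2 * (\<kappa> + 1)) k / fact k)"
    by (rule mult_left_cancel[THEN iffD1, rotated]) (use assms in simp)
  then have v: "poly ?q 1 = poly (smult (2 * \<kappa>) (gegR (\<kappa> + 1) k)) 1"
    by (simp only: poly_smult poly_gegR_1)
  show ?thesis
    by (rule orth_unique[OF o _ orth_smult[OF gegR_orth[OF k(2)]] _ v])
      (use degree_gegR[OF assms] degree_gegR[OF k(2)] in \<open>auto simp: degree_pderiv\<close>)
qed

lemma gegmass_Suc:
  assumes "\<kappa> > 0"
  shows "gegmass (\<kappa> + 1) * (\<kappa> + 1) = gegmass \<kappa> * (\<kappa> + 1/2)"
proof -
  have "Gamma (\<kappa> + 1 + 1/2) = (\<kappa> + 1/2) * Gamma (\<kappa> + 1/2)" "Gamma (\<kappa> + 1 + 1) = (\<kappa> + 1) * Gamma (\<kappa> + 1)"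
  proof -
    have "\<kappa> + 1/2 \<notin> \<int>\<^sub>\<le>\<^sub>0" "\<kappa> + 1 \<notin> \<int>\<^sub>\<le>\<^sub>0"
      using assms nonpos_Ints_nonpos[of "\<kappa> + 1/2"] nonpos_Ints_nonpos[of "\<kappa> + 1"] by linarith+
    moreover have "\<kappa> + 1 + 1/2 = \<kappa> + 1/2 + 1" by simp
    ultimately show "Gamma (\<kappa> + 1 + 1/2) = (\<kappa> + 1/2) * Gamma (\<kappa> + 1/2)"
      "Gamma (\<kappa> + 1 + 1) = (\<kappa> + 1) * Gamma (\<kappa> + 1)"
      by (simp_all only: Gamma_plus1 not_False_eq_True)
  qed
  moreover have "Gamma (\<kappa> + 1) \<noteq> 0" using assms Gamma_real_pos[of "\<kappa> + 1"] by linarith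
  ultimately show ?thesis using assms unfolding gegmass_def by (simp only: times_divide_eq_left)
      (simp add: nonzero_eq_divide_eq mult_ac)
qed

text \<open>By the equation and \<open>gegint_adjoint\<close>, the eigenvalue times the squared norm
  is the squared norm of the derivative for the weight of \<kappa> + 1. So the induction lowers k
  while raising \<kappa>.\<close>

lemma gegR_norm:
  assumes "\<kappa> > 0"
  shows "gegint \<kappa> (gegR \<kappa> k * gegR \<kappa> k) = gegmass \<kappa> * (\<kappa> * pochhammer (2 * \<kappa>) k / ((real k + \<kappa>) *
      fact k))"
  using assms
proof (induction k arbitrary: \<kappa>)
  case 0
  have "gegR \<kappa> 0 = 1" by (simp add: gegR_def gegcoef_def)
  then show ?case using gegint_1[of \<kappa>] 0 by simp
next
  case (Suc k)
  have k: "\<kappa> > -1/2" using Suc.prems by simp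
  interpret poly_weight "gegw \<kappa>" by (rule poly_weight_gegw[OF k])
  have k1: "\<kappa> + 1 > -1/2" using Suc.prems by simp
  interpret w1: poly_weight "gegw (\<kappa> + 1)" by (rule poly_weight_gegw[OF k1])
  let ?R = "gegR \<kappa> (Suc k)"
  let ?K = "real (Suc k) * (real (Suc k) + 2 * \<kappa>)"
  have "?K * gegint \<kappa> (?R * ?R) = gegint \<kappa> (?R * gegL \<kappa> (pderiv ?R))"
    unfolding gegR_ode by (simp add: gegint_wint[OF k] wint_smult)
  also have "\<dots> = (2 * \<kappa>)\<^sup>2 * gegint (\<kappa> + 1) (gegR (\<kappa> + 1) k * gegR (\<kappa> + 1) k)"
    unfolding gegint_adjoint[OF k] pderiv_gegR[OF Suc.prems]
    by (simp add: gegint_wint[OF k1] w1.wint_smult power2_eq_square)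
  also have "\<dots> = (2 * \<kappa>)\<^sup>2 * (gegmass (\<kappa> + 1) * (\<kappa> + 1)) * (pochhammer (2 * (\<kappa> + 1)) k / ((real k
      + \<kappa> + 1) * fact k))"
  proof -
    have "gegint (\<kappa> + 1) (gegR (\<kappa> + 1) k * gegR (\<kappa> + 1) k)
        = gegmass (\<kappa> + 1) * ((\<kappa> + 1) * pochhammer (2 * (\<kappa> + 1)) k / ((real k + (\<kappa> + 1)) * fact k))"
      by (rule Suc.IH) (use Suc.prems in simp)
    then show ?thesis by (simp only: add.assoc times_divide_eq_left times_divide_eq_right mult_ac)
  qed
  also have "\<dots> = gegmass \<kappa> * \<kappa> * ((2 * \<kappa>) * ((2 * \<kappa> + 1) * pochhammer (2 * (\<kappa> + 1)) k) / ((real k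
      + \<kappa> + 1) * fact k))"
  proof -
    have "(2 * \<kappa>)\<^sup>2 * (gegmass \<kappa> * (\<kappa> + 1/2)) = gegmass \<kappa> * \<kappa> * (2 * \<kappa> * (2 * \<kappa> + 1))"
      by (simp add: power2_eq_square algebra_simps)
    then show ?thesis unfolding gegmass_Suc[OF Suc.prems] by (simp only: times_divide_eq_right
        mult.assoc)
  qed
  also have "2 * \<kappa> * ((2 * \<kappa> + 1) * pochhammer (2 * (\<kappa> + 1)) k) = pochhammer (2 * \<kappa>) (Suc k) * (2
      * \<kappa> + real (Suc k))"
  proof -
    have "pochhammer (2 * \<kappa>) (Suc (Suc k)) = 2 * \<kappa> * ((2 * \<kappa> + 1) * pochhammer (2 * \<kappa> + 1 + 1) k)"
      by (simp only: pochhammer_rec)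
    then show ?thesis by (subst (asm) pochhammer_Suc) (simp add: algebra_simps)
  qed
  also have "gegmass \<kappa> * \<kappa> * (pochhammer (2 * \<kappa>) (Suc k) * (2 * \<kappa> + real (Suc k)) / ((real k + \<kappa> +
      1) * fact k))
     = ?K * (gegmass \<kappa> * (\<kappa> * pochhammer (2 * \<kappa>) (Suc k) / ((real (Suc k) + \<kappa>) * fact (Suc k))))"
    using Suc.prems by (simp add: divide_simps del: pochhammer_Suc) (simp add: algebra_simps)
  finally show ?case by (rule mult_left_cancel[THEN iffD1, rotated]) (use Suc.prems in simp)
qed

definition gegN :: "real \<Rightarrow> nat \<Rightarrow> real poly" where
  "gegN \<kappa> k = smult (1 / sqrt (\<kappa> * pochhammer (2 * \<kappa>) k / ((real k + \<kappa>) * fact k))) (gegR \<kappa> k)"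

lemma gegenbauer_normalized_eq: "\<kappa> > 0 \<Longrightarrow> gegenbauer_normalized k \<kappa> s = poly (gegN \<kappa> k) s"
  by (simp add: gegenbauer_normalized_def gegN_def gegenbauer_eq_gegR)

lemma gegN_constant_pos:
  "\<kappa> > 0 \<Longrightarrow> \<kappa> * pochhammer (2 * \<kappa>) k / ((real k + \<kappa>) * fact k) > 0"
  by (intro divide_pos_pos mult_pos_pos pochhammer_pos) auto

lemma degree_gegN: "\<kappa> > 0 \<Longrightarrow> degree (gegN \<kappa> k) = k"
  using gegN_constant_pos[of \<kappa> k] degree_gegR[of \<kappa> k] unfolding gegN_def degree_smult_eq
  by (metis divide_eq_0_iff less_irrefl real_sqrt_eq_0_iff zero_neq_one)

lemma gegN_nonzero: "\<kappa> > 0 \<Longrightarrow> gegN \<kappa> k \<noteq> 0"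
  using gegN_constant_pos[of \<kappa> k] gegR_nonzero[of \<kappa> k] unfolding gegN_def smult_eq_0_iff
  by (metis divide_eq_0_iff less_irrefl real_sqrt_eq_0_iff zero_neq_one)

text \<open>The normalization refers to the weight with total mass 1, whereas \<open>gegint\<close>
  integrates against the bare weight; hence \<open>gegmass \<kappa>\<close> on the diagonal.\<close>

lemma gegN_orthonormal:
  assumes "\<kappa> > 0"
  shows "gegint \<kappa> (gegN \<kappa> k * gegN \<kappa> m) = (if k = m then gegmass \<kappa> else 0)"
proof -
  have k: "\<kappa> > -1/2" using assms(1) by simp
  interpret poly_weight "gegw \<kappa>" by (rule poly_weight_gegw[OF k])
  define c where "c k = \<kappa> * pochhammer (2 * \<kappa>) k / ((real k + \<kappa>) * fact k)" for k
  have c: "c k > 0" for k using gegN_constant_pos[OF assms] by (simp add: c_def)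
  have e: "gegint \<kappa> (gegN \<kappa> k * gegN \<kappa> m) = 1 / sqrt (c k) * (1 / sqrt (c m)) * gegint \<kappa> (gegR \<kappa> k
      * gegR \<kappa> m)"
    unfolding gegN_def c_def[symmetric] by (simp add: gegint_wint[OF k] wint_smult)
  consider "k = m" | "k < m" | "k > m" by linarith
  then show ?thesis
  proof cases
    case 1
    have "gegint \<kappa> (gegR \<kappa> k * gegR \<kappa> k) = gegmass \<kappa> * c k"
      using gegR_norm[OF assms, of k] by (simp only: c_def)
    then show ?thesis using 1 c[of k] unfolding e by simp
  next
    case 2
    then have "gegint \<kappa> (gegR \<kappa> m * gegR \<kappa> k) = 0"
      using gegR_orth[OF assms, of m] degree_gegR[OF assms, of k] unfolding orth_def
          gegint_wint[OF k] by metis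
    then show ?thesis using 2 unfolding e by (simp add: mult.commute[of "gegR \<kappa> m"])
  next
    case 3
    then have "gegint \<kappa> (gegR \<kappa> k * gegR \<kappa> m) = 0"
      using gegR_orth[OF assms, of k] degree_gegR[OF assms, of m] unfolding orth_def
          gegint_wint[OF k] by metis
    then show ?thesis using 3 unfolding e by simp
  qed
qed

section \<open>Integration over \<open>\<real>\<^sup>3\<close>\<close>

text \<open>The arguments are in the order of integration, outermost first: w along the axis, then t
  across the segments and s along them.\<close>

definition vec3 :: "real \<Rightarrow> real \<Rightarrow> real \<Rightarrow> real^3" where
  "vec3 w t s = vector [t, s, w]"

lemma vec3_nth [simp]: "vec3 w t s $ 1 = t" "vec3 w t s $ 2 = s" "vec3 w t s $ 3 = w"
  by (simp_all add: vec3_def)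

lemma vec3_alt: "vec3 w t s = t *\<^sub>R axis 1 1 + s *\<^sub>R axis 2 1 + w *\<^sub>R axis 3 1"
  by (simp add: vec_eq_iff forall_3 axis_def)

lemma measurable_vec3 [measurable (raw)]:
  assumes [measurable]: "f \<in> borel_measurable M" "g \<in> borel_measurable M" "h \<in> borel_measurable M"
  shows "(\<lambda>x. vec3 (f x) (g x) (h x)) \<in> borel_measurable M"
  unfolding vec3_alt by measurable

lemma measurable_vec_nth [measurable]: "(\<lambda>x::real^3. x $ i) \<in> borel_measurable borel"
  by (intro borel_measurable_continuous_onI continuous_intros)

lemma norm_vec3_sq: "(norm x)\<^sup>2 = (x$1)\<^sup>2 + (x$2)\<^sup>2 + (x$3)\<^sup>2" for x :: "real^3"
  by (simp add: norm_vec_def L2_set_def sum_3)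

lemma Basis_vec3: "(Basis :: (real^3) set) = {axis 1 1, axis 2 1, axis 3 1}"
proof -
  have "(Basis :: (real^3) set) = range (\<lambda>i. axis i 1)" by (auto simp: Basis_vec_def)
  then show ?thesis by (simp add: UNIV_3)
qed

lemma measurable_vec3_prod: "(\<lambda>(w, t, s). vec3 w t s) \<in> borel_measurable borel"
  unfolding vec3_alt split_beta by (intro borel_measurable_continuous_onI continuous_intros)

lemma lborel_vec3: "(lborel :: (real^3) measure) = distr lborel borel (\<lambda>(w, t, s). vec3 w t s)"
proof (rule lborel_eqI)
  fix l u :: "real^3" assume lu: "\<And>b. b \<in> Basis \<Longrightarrow> l \<bullet> b \<le> u \<bullet> b"
  have ne: "axis 1 1 \<noteq> (axis 2 1 :: real^3)" "axis 1 1 \<noteq> (axis 3 1 :: real^3)" "axis 2 1 \<noteq> (axis 3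
      1 :: real^3)"
    by (simp_all add: axis_eq_axis)
  have le: "l$1 \<le> u$1" "l$2 \<le> u$2" "l$3 \<le> u$3" using lu[of "axis _ 1"] by (simp_all add:
      Basis_vec3 inner_axis)
  have "(\<lambda>(w, t, s). vec3 w t s) -` box l u = {l$3<..<u$3} \<times> {l$1<..<u$1} \<times> {l$2<..<u$2}"
    by (auto simp: mem_box_cart forall_3)
  then have "emeasure (distr lborel borel (\<lambda>(w, t, s). vec3 w t s)) (box l u) =
      emeasure (lborel \<Otimes>\<^sub>M (lborel \<Otimes>\<^sub>M lborel)) ({l$3<..<u$3} \<times> {l$1<..<u$1} \<times> {l$2<..<u$2})"
    using measurable_vec3_prod by (subst emeasure_distr) (auto simp: lborel_prod simp del: box_real)
  also have "\<dots> = ennreal (u$3 - l$3) * (ennreal (u$1 - l$1) * ennreal (u$2 - l$2))"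
  proof -
    have p: "sigma_finite_measure (lborel \<Otimes>\<^sub>M lborel :: (real \<times> real) measure)"
      by (simp add: lborel_prod sigma_finite_lborel)
    show ?thesis using le
      by (simp add: lborel.emeasure_pair_measure_Times
          sigma_finite_measure.emeasure_pair_measure_Times[OF p])
  qed
  also have "\<dots> = ennreal (\<Prod>b\<in>Basis. (u - l) \<bullet> b)"
    using le ne by (simp add: Basis_vec3 inner_axis inner_diff_left ennreal_mult'[symmetric] mult_ac)
  finally show "emeasure (distr lborel borel (\<lambda>(w, t, s). vec3 w t s)) (box l u) = (\<Prod>b\<in>Basis. (u -
      l) \<bullet> b)" .
qed simp

text \<open>The first form keeps each plane orthogonal to the axis whole, for integrands that depend
  on the distance from the axis; the second cuts the plane into lines, for Radon projections and
  ridge functions.\<close>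

lemma
  fixes g :: "real^3 \<Rightarrow> real"
  assumes g: "integrable lborel g"
  shows integral_vec3_prod: "integral\<^sup>L lborel g = (\<integral>w. (\<integral>z. g (vec3 w (fst z) (snd z)) \<partial>lborel)
      \<partial>lborel)"
    and integral_vec3: "integral\<^sup>L lborel g = (\<integral>w. (\<integral>t. (\<integral>s. g (vec3 w t s) \<partial>lborel) \<partial>lborel) \<partial>lborel)"
proof -
  have [measurable]: "g \<in> borel_measurable borel" using borel_measurable_integrable[OF g] by simp
  let ?v = "\<lambda>(w, t, s). vec3 w t s"
  have vm: "?v \<in> borel_measurable lborel" using measurable_vec3_prod by simp
  have "integrable lborel (\<lambda>p. g (?v p))"
    using g by (subst (asm) lborel_vec3, subst (asm) integrable_distr_eq) (use vm in auto)
  then have i: "integrable (lborel \<Otimes>\<^sub>M lborel) (\<lambda>p. g (?v p))" by (simp add: lborel_prod)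
  have "integral\<^sup>L lborel g = integral\<^sup>L (lborel \<Otimes>\<^sub>M lborel) (\<lambda>p. g (?v p))"
    by (subst lborel_vec3, subst integral_distr) (use vm in \<open>auto simp: lborel_prod\<close>)
  also have "\<dots> = (\<integral>w. (\<integral>z. g (?v (w, z)) \<partial>lborel) \<partial>lborel)"
    using lborel_pair.integral_fst'[OF i] by simp
  finally show 1: "integral\<^sup>L lborel g = (\<integral>w. (\<integral>z. g (vec3 w (fst z) (snd z)) \<partial>lborel) \<partial>lborel)"
    by (simp add: split_beta')
  have ae: "AE w in lborel. integrable lborel (\<lambda>z. g (?v (w, z)))"
    using lborel_pair.AE_integrable_fst'[OF i] by simp
  then have ae': "AE w in lborel. integrable lborel (\<lambda>z. g (vec3 w (fst z) (snd z)))"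
    by (simp add: split_beta')
  show "integral\<^sup>L lborel g = (\<integral>w. (\<integral>t. (\<integral>s. g (vec3 w t s) \<partial>lborel) \<partial>lborel) \<partial>lborel)"
    unfolding 1
  proof (rule integral_cong_AE)
    show "AE w in lborel. (\<integral>z. g (vec3 w (fst z) (snd z)) \<partial>lborel) = (\<integral>t. (\<integral>s. g (vec3 w t s)
        \<partial>lborel) \<partial>lborel)"
      using ae'
    proof eventually_elim
      case (elim w)
      then have "integrable (lborel \<Otimes>\<^sub>M lborel) (\<lambda>z. g (vec3 w (fst z) (snd z)))" by (simp add:
          lborel_prod)
      from lborel_pair.integral_fst'[OF this] show ?case by (simp add: lborel_prod)
    qed
    show "(\<lambda>w. \<integral>z. g (vec3 w (fst z) (snd z)) \<partial>lborel) \<in> borel_measurable lborel"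
      unfolding lborel_prod[symmetric] by measurable
    show "(\<lambda>w. \<integral>t. (\<integral>s. g (vec3 w t s) \<partial>lborel) \<partial>lborel) \<in> borel_measurable lborel"
      by measurable
  qed
qed

lemma nn_integral_vec3:
  fixes g :: "real^3 \<Rightarrow> ennreal"
  assumes [measurable]: "g \<in> borel_measurable borel"
  shows "(\<integral>\<^sup>+x. g x \<partial>lborel) = (\<integral>\<^sup>+w. (\<integral>\<^sup>+t. (\<integral>\<^sup>+s. g (vec3 w t s) \<partial>lborel) \<partial>lborel) \<partial>lborel)"
proof -
  let ?v = "\<lambda>(w, t, s). vec3 w t s"
  have vm: "?v \<in> borel_measurable lborel" using measurable_vec3_prod by simp
  have [measurable]: "(\<lambda>p. g (?v p)) \<in> borel_measurable borel"
    by (rule measurable_compose[OF measurable_vec3_prod]) simp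
  have "(\<integral>\<^sup>+x. g x \<partial>lborel) = (\<integral>\<^sup>+p. g (?v p) \<partial>(lborel \<Otimes>\<^sub>M (lborel \<Otimes>\<^sub>M lborel)))"
    by (subst lborel_vec3, subst nn_integral_distr) (use vm in \<open>auto simp: lborel_prod\<close>)
  also have "\<dots> = (\<integral>\<^sup>+w. (\<integral>\<^sup>+z. g (?v (w, z)) \<partial>(lborel \<Otimes>\<^sub>M lborel)) \<partial>lborel)"
    by (subst lborel_prod[where 'b = real], subst lborel.nn_integral_fst[symmetric]) (auto simp:
        lborel_prod)
  also have "\<dots> = (\<integral>\<^sup>+w. (\<integral>\<^sup>+t. (\<integral>\<^sup>+s. g (vec3 w t s) \<partial>lborel) \<partial>lborel) \<partial>lborel)"
    by (intro nn_integral_cong, subst lborel.nn_integral_fst[symmetric]) auto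
  finally show ?thesis .
qed

section \<open>Rotations about the third axis and radial integrals\<close>

definition rot3 :: "real \<Rightarrow> real^3 \<Rightarrow> real^3" where
  "rot3 \<theta> x = vec3 (x$3) (x$1 * cos \<theta> - x$2 * sin \<theta>) (x$1 * sin \<theta> + x$2 * cos \<theta>)"

lemma rot3_nth [simp]:
  "rot3 \<theta> x $ 1 = x$1 * cos \<theta> - x$2 * sin \<theta>"
  "rot3 \<theta> x $ 2 = x$1 * sin \<theta> + x$2 * cos \<theta>"
  "rot3 \<theta> x $ 3 = x$3"
  by (simp_all add: rot3_def)

lemma rot3_rho: "(rot3 \<theta> x $ 1)\<^sup>2 + (rot3 \<theta> x $ 2)\<^sup>2 = (x$1)\<^sup>2 + (x$2)\<^sup>2"
  unfolding rot3_nth using sin_cos_squared_add[of \<theta>] by algebra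

lemma norm_rot3 [simp]: "norm (rot3 \<theta> x) = norm x"
proof -
  have "(norm (rot3 \<theta> x))\<^sup>2 = (norm x)\<^sup>2"
    unfolding norm_vec3_sq rot3_rho by simp
  then show ?thesis by simp
qed

lemma measurable_rot3 [measurable]: "rot3 \<theta> \<in> borel_measurable borel"
  unfolding rot3_def[abs_def] by measurable

lemma rot3_inverse: "rot3 \<theta> (rot3 (-\<theta>) x) = x" "rot3 (-\<theta>) (rot3 \<theta> x) = x"
  using sin_cos_squared_add[of \<theta>] by (simp_all add: vec_eq_iff forall_3; algebra)+

lemma orthogonal_rot3: "orthogonal_transformation (rot3 \<theta>)"
  unfolding orthogonal_transformation
proof
  show "linear (rot3 \<theta>)"
    by (rule linearI) (simp_all add: vec_eq_iff forall_3 algebra_simps)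
qed simp

lemma lborel_rot3: "(lborel :: (real^3) measure) = distr lborel borel (rot3 \<theta>)"
proof (rule lborel_eqI)
  fix l u :: "real^3" assume lu: "\<And>b. b \<in> Basis \<Longrightarrow> l \<bullet> b \<le> u \<bullet> b"
  have "rot3 \<theta> -` box l u = rot3 (-\<theta>) ` box l u"
  proof (intro set_eqI iffI)
    fix x assume "x \<in> rot3 \<theta> -` box l u"
    then show "x \<in> rot3 (-\<theta>) ` box l u" using rot3_inverse(2)[of \<theta> x] by (metis image_eqI vimageD)
  next
    fix x assume "x \<in> rot3 (-\<theta>) ` box l u"
    then show "x \<in> rot3 \<theta> -` box l u" using rot3_inverse(1)[of \<theta>] by auto
  qed
  moreover have "emeasure lborel (rot3 \<theta> -` box l u) = emeasure lborel (box l u)"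
  proof -
    have o: "orthogonal_transformation (rot3 (-\<theta>))" by (rule orthogonal_rot3)
    have m: "rot3 (-\<theta>) ` box l u \<in> lmeasurable" "measure lebesgue (rot3 (-\<theta>) ` box l u) = measure
        lebesgue (box l u)"
      by (rule measurable_orthogonal_image[OF o], simp) (rule measure_orthogonal_image[OF o], simp)
    have "rot3 \<theta> -` box l u \<in> sets borel"
      using measurable_sets[OF measurable_rot3, of "box l u"] by simp
    then have "emeasure lborel (rot3 \<theta> -` box l u) = emeasure lebesgue (rot3 (-\<theta>) ` box l u)"
      unfolding \<open>rot3 \<theta> -` box l u = _\<close> by (simp add: main_part_sets)
    also have "\<dots> = emeasure lebesgue (box l u)"
      using m by (simp add: emeasure_eq_measure2 lmeasurable_box)
    also have "\<dots> = emeasure lborel (box l u)" by simp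
    finally show ?thesis .
  qed
  ultimately show "emeasure (distr lborel borel (rot3 \<theta>)) (box l u) = (\<Prod>b\<in>Basis. (u - l) \<bullet> b)"
    using lu by (subst emeasure_distr) (auto simp: emeasure_lborel_box)
qed simp

text \<open>A disk of squared radius a has area pi a, so both measures give the half line up to a
  the value \<open>pi * max 0 a\<close>. This takes the place of polar coordinates, with the squared
  radius as variable.\<close>

lemma distr_norm_sq_plane:
  "distr lborel borel (\<lambda>z. (fst z)\<^sup>2 + (snd z)\<^sup>2) = density lborel (\<lambda>u::real. ennreal (pi *
      indicator {0..} u))"
    (is "?M = ?N")
proof (rule measure_eqI_generator_eq)
  let ?E = "range (\<lambda>a::real. {..a})"
  show "Int_stable ?E" by (auto simp: Int_stable_def)
  show "?E \<subseteq> Pow UNIV" by auto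
  show "sets ?M = sigma_sets UNIV ?E" "sets ?N = sigma_sets UNIV ?E"
    using arg_cong[OF borel_eq_atMost[where 'a = real], of sets] by (simp_all add: sets_measure_of)
  show "range (\<lambda>i::nat. {..real i}) \<subseteq> ?E" by auto
  show "(\<Union>i::nat. {..real i}) = UNIV" by (auto intro: real_arch_simple)
  have M: "emeasure ?M {..a} = ennreal (pi * max 0 a)" for a
  proof -
    have "(\<lambda>z::real\<times>real. (fst z)\<^sup>2 + (snd z)\<^sup>2) -` {..a} = (if a < 0 then {} else cball 0 (sqrt a))"
    proof -
      have "(t\<^sup>2 + s\<^sup>2 \<le> a) = (a \<ge> 0 \<and> norm (t, s) \<le> sqrt a)" for t s :: real
        using order_trans[OF sum_power2_ge_zero[of t s]] by (auto simp: norm_Pair)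
      then show ?thesis by auto
    qed
    then have "emeasure ?M {..a} = (if a < 0 then 0 else emeasure lborel (cball (0 :: real \<times> real)
        (sqrt a)))"
      by (subst emeasure_distr) (auto intro!: borel_measurable_continuous_onI continuous_intros)
    then show ?thesis by (auto simp: emeasure_cball unit_ball_vol_2)
  qed
  have N: "emeasure ?N {..a} = ennreal (pi * max 0 a)" for a
  proof -
    have "emeasure ?N {..a} = (\<integral>\<^sup>+u. ennreal pi * indicator {0..a} u \<partial>lborel)"
      by (subst emeasure_density) (auto intro!: nn_integral_cong simp: indicator_def)
    also have "\<dots> = ennreal pi * emeasure lborel {0..a}" by (simp add: nn_integral_cmult)
    finally show ?thesis by (auto simp: max_def ennreal_mult')
  qed
  show "emeasure ?M X = emeasure ?N X" if "X \<in> ?E" for X using that M N by auto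
  show "emeasure ?M {..real i} \<noteq> \<infinity>" for i :: nat by (simp add: M)
qed

lemma integral_radial:
  fixes A :: "real \<Rightarrow> real \<Rightarrow> real"
  assumes [measurable]: "(\<lambda>(u, w). A u w) \<in> borel_measurable borel"
    and i: "integrable lborel (\<lambda>x::real^3. A ((x$1)\<^sup>2 + (x$2)\<^sup>2) (x$3))"
  shows "integral\<^sup>L lborel (\<lambda>x::real^3. A ((x$1)\<^sup>2 + (x$2)\<^sup>2) (x$3)) =
    (\<integral>w. (\<integral>u. pi * indicator {0..} u * A u w \<partial>lborel) \<partial>lborel)"
proof -
  have m: "(\<lambda>u. A u w) \<in> borel_measurable borel" for w
  proof -
    have "(\<lambda>u. (u, w)) \<in> borel_measurable borel"
      by (intro borel_measurable_continuous_onI continuous_intros)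
    from measurable_compose[OF this assms(1)] show ?thesis by simp
  qed
  have n: "(\<lambda>z. (fst z)\<^sup>2 + (snd z)\<^sup>2) \<in> lborel \<rightarrow>\<^sub>M (borel :: real measure)" by (simp add:
      borel_prod[symmetric])
  have "(\<integral>z. A ((fst z)\<^sup>2 + (snd z)\<^sup>2) w \<partial>lborel) = (\<integral>u. pi * indicator {0..} u * A u w \<partial>lborel)" for w
  proof -
    have "(\<integral>z. A ((fst z)\<^sup>2 + (snd z)\<^sup>2) w \<partial>lborel) = (\<integral>u. A u w \<partial>(distr lborel borel (\<lambda>z. (fst
        z)\<^sup>2 + (snd z)\<^sup>2)))"
      using m by (subst integral_distr[OF n]) auto
    also have "\<dots> = (\<integral>u. pi * indicator {0..} u * A u w \<partial>lborel)"
      unfolding distr_norm_sq_plane by (subst integral_density) (use m in \<open>auto simp: indicator_def\<close>)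
    finally show ?thesis .
  qed
  then show ?thesis using integral_vec3_prod[OF i] by simp
qed


section \<open>Weighted integrals over the ball\<close>

text \<open>Extended by zero, the weight turns integrals over the ball into integrals over the whole
  space, where rotations and Fubini apply directly.\<close>

definition bw :: "real \<Rightarrow> real^3 \<Rightarrow> real" where
  "bw \<mu> x = indicator (cball 0 1) x * ball_weight \<mu> x"

lemma bw_nonneg: "bw \<mu> x \<ge> 0"
  by (simp add: bw_def ball_weight_def)

lemma measurable_bw [measurable]: "bw \<mu> \<in> borel_measurable borel"
proof -
  have "cball (0::real^3) 1 \<in> sets borel" by simp
  moreover have "(\<lambda>x::real^3. 1 - (norm x)\<^sup>2) \<in> borel_measurable borel" by measurable
  then have "(\<lambda>x::real^3. (1 - (norm x)\<^sup>2) powr (\<mu> - 1/2)) \<in> borel_measurable borel" by measurable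
  ultimately show ?thesis unfolding bw_def[abs_def] ball_weight_def by measurable
qed

lemma bw_rot3 [simp]: "bw \<mu> (rot3 \<theta> x) = bw \<mu> x"
  by (simp add: bw_def ball_weight_def indicator_def)

text \<open>The closed ball may be replaced by the open one because the weight is 0 on the sphere,
  where it is a power of 0.\<close>

lemma bw_eq: "bw \<mu> x = (if (x$1)\<^sup>2 + (x$2)\<^sup>2 + (x$3)\<^sup>2 < 1 then (1 - ((x$1)\<^sup>2 + (x$2)\<^sup>2 +
    (x$3)\<^sup>2)) powr (\<mu> - 1/2) else 0)"
proof -
  have "norm x \<le> 1 \<longleftrightarrow> (norm x)\<^sup>2 \<le> 1" by (simp add: abs_square_le_1)
  then show ?thesis by (auto simp: bw_def ball_weight_def indicator_def norm_vec3_sq)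
qed

text \<open>The measure is \<open>lebesgue\<close> because members of \<open>ball_L2 \<mu>\<close>
  are merely Lebesgue measurable; for Borel integrands \<open>bint_lborel\<close> passes to
  \<open>lborel\<close>.\<close>

definition bint :: "real \<Rightarrow> (real^3 \<Rightarrow> real) \<Rightarrow> real" where
  "bint \<mu> g = (\<integral>x. g x * bw \<mu> x \<partial>lebesgue)"

lemma ball_inner_bint: "ball_inner \<mu> f g = ball_const \<mu> * bint \<mu> (\<lambda>x. f x * g x)"
  unfolding ball_inner_def bint_def set_lebesgue_integral_def bw_def
  by (simp add: mult_ac)

lemma bint_lborel:
  assumes [measurable]: "g \<in> borel_measurable borel"
  shows "bint \<mu> g = (\<integral>x. g x * bw \<mu> x \<partial>lborel)"
  unfolding bint_def by (intro integral_completion) simp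

lemma bint_rot3:
  assumes [measurable]: "g \<in> borel_measurable borel"
  shows "bint \<mu> (\<lambda>x. g (rot3 \<theta> x)) = bint \<mu> g"
proof -
  have "bint \<mu> g = (\<integral>x. g x * bw \<mu> x \<partial>(distr lborel borel (rot3 \<theta>)))"
    by (simp add: bint_lborel lborel_rot3[of \<theta>, symmetric])
  also have "\<dots> = (\<integral>x. g (rot3 \<theta> x) * bw \<mu> x \<partial>lborel)"
    by (subst integral_distr) auto
  also have "\<dots> = bint \<mu> (\<lambda>x. g (rot3 \<theta> x))"
    by (subst bint_lborel) auto
  finally show ?thesis by simp
qed

lemma measurable_poly_gegw: "(\<lambda>s. indicator {-1..1} s *\<^sub>R (poly p s * gegw \<kappa> s)) \<in>
    borel_measurable borel"
proof -
  have "poly p \<in> borel_measurable borel" by (intro borel_measurable_continuous_onI continuous_intros)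
  moreover have "(\<lambda>x::real. 1 - x\<^sup>2) \<in> borel_measurable borel" by measurable
  then have "gegw \<kappa> \<in> borel_measurable borel" unfolding gegw_def[abs_def] by measurable
  ultimately show ?thesis by measurable
qed

lemma gegint_lborel: "gegint \<kappa> p = (\<integral>s. indicator {-1..1} s *\<^sub>R (poly p s * gegw \<kappa> s) \<partial>lborel)"
  unfolding gegint_def set_lebesgue_integral_def
  by (rule integral_completion) (use measurable_poly_gegw in simp)

lemma gegw_eq_0: "s \<in> {-1..1} \<Longrightarrow> \<not> s\<^sup>2 < 1 \<Longrightarrow> gegw \<kappa> s = 0"
proof -
  assume "s \<in> {-1..1}" "\<not> s\<^sup>2 < 1"
  then have "s\<^sup>2 = 1" by (simp add: abs_square_le_1 abs_le_iff order_antisym_conv linorder_not_less)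
  then show ?thesis by (simp add: gegw_def)
qed

text \<open>This is the integral of the weight times a power of s along a chord of half length
  \<open>sqrt c\<close>. Scaling s by \<open>sqrt c\<close> collects the exponents \<mu> - 1/2 from
  the weight, b/2 from the power and 1/2 from ds.\<close>

lemma
  fixes \<mu> c :: real
  assumes mu: "\<mu> \<ge> 0" and c: "c > 0"
  shows fibre_integrable: "integrable lborel (\<lambda>s. if s\<^sup>2 < c then s ^ b * (c - s\<^sup>2) powr (\<mu> - 1/2)
      else 0)"
    and fibre_integral: "(\<integral>s. (if s\<^sup>2 < c then s ^ b * (c - s\<^sup>2) powr (\<mu> - 1/2) else 0) \<partial>lborel) =
      c powr (\<mu> + real b / 2) * gegint \<mu> (monom 1 b)"
proof -
  let ?f = "\<lambda>s. if s\<^sup>2 < c then s ^ b * (c - s\<^sup>2) powr (\<mu> - 1/2) else 0"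
  let ?g = "\<lambda>s. indicator {-1..1} s *\<^sub>R (poly (monom 1 b) s * gegw \<mu> s)"
  have k: "\<mu> > -1/2" using mu by simp
  interpret poly_weight "gegw \<mu>" by (rule poly_weight_gegw[OF k])
  have gm: "?g \<in> borel_measurable lborel" using measurable_poly_gegw by simp
  have gi: "integrable lborel ?g"
    using integrable_poly[of "monom 1 b"] gm by (simp add: set_integrable_def integrable_completion)
  have gv: "integral\<^sup>L lborel ?g = gegint \<mu> (monom 1 b)"
    by (rule gegint_lborel[symmetric])
  have fg: "?f (0 + sqrt c * \<sigma>) = c powr (\<mu> + real b / 2 - 1/2) * ?g \<sigma>" for \<sigma>
  proof (cases "\<sigma>\<^sup>2 < 1")
    case True
    then have "\<bar>\<sigma>\<bar> < 1" by (simp add: abs_square_less_1)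
    have "sqrt c ^ b = c powr (real b / 2)"
      using c by (simp add: powr_half_sqrt[symmetric] powr_realpow[symmetric] powr_powr)
    moreover have "(c - c * \<sigma>\<^sup>2) powr (\<mu> - 1/2) = c powr (\<mu> - 1/2) * (1 - \<sigma>\<^sup>2) powr (\<mu> - 1/2)"
      using c True by (simp add: powr_mult[symmetric] right_diff_distrib)
    moreover have "c powr (\<mu> + real b / 2 - 1/2) = c powr (real b / 2) * c powr (\<mu> - 1/2)"
    proof -
      have "\<mu> + real b / 2 - 1/2 = real b / 2 + (\<mu> - 1/2)" by simp
      then show ?thesis by (simp only: powr_add)
    qed
    ultimately show ?thesis using True c \<open>\<bar>\<sigma>\<bar> < 1\<close>
      by (simp add: power_mult_distrib poly_monom gegw_def indicator_def abs_less_iff)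
  next
    case False
    then have "\<not> (sqrt c * \<sigma>)\<^sup>2 < c" using c by (simp add: power_mult_distrib)
    moreover have "?g \<sigma> = 0"
      using gegw_eq_0[OF _ False] by (cases "\<sigma> \<in> {-1..1}") auto
    ultimately show ?thesis by simp
  qed
  have s: "sqrt c \<noteq> 0" using c by simp
  show "integrable lborel ?f"
    using lborel_integrable_real_affine_iff[OF s, of ?f 0] unfolding fg using gi by simp
  have "integral\<^sup>L lborel ?f = \<bar>sqrt c\<bar> *\<^sub>R (\<integral>\<sigma>. ?f (0 + sqrt c * \<sigma>) \<partial>lborel)"
    by (rule lborel_integral_real_affine[OF s])
  also have "\<dots> = sqrt c * c powr (\<mu> + real b / 2 - 1/2) * gegint \<mu> (monom 1 b)"
    unfolding fg using c gv by simp
  also have "sqrt c * c powr (\<mu> + real b / 2 - 1/2) = c powr (\<mu> + real b / 2)"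
    using c by (simp add: powr_half_sqrt[symmetric] powr_add[symmetric])
  finally show "integral\<^sup>L lborel ?f = c powr (\<mu> + real b / 2) * gegint \<mu> (monom 1 b)" .
qed

lemma bw_vec3_slice: "bw \<mu> (vec3 w t s) =
   (if s\<^sup>2 < 1 - w\<^sup>2 - t\<^sup>2 then (1 - w\<^sup>2 - t\<^sup>2 - s\<^sup>2) powr (\<mu> - 1/2) else 0)"
  unfolding bw_eq vec3_nth by (auto simp: algebra_simps)

text \<open>For \<mu> < 1/2 the weight is unbounded, but its integral along a chord is
  \<open>?c powr \<mu> * ?m\<close>, which is at most \<open>?m\<close> because \<mu> is nonnegative
  and \<open>?c\<close> is at most 1. Tonelli does the rest.\<close>

lemma bw_integrable:
  assumes mu: "\<mu> \<ge> 0"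
  shows "integrable lborel (bw \<mu>)"
proof -
  let ?m = "gegint \<mu> (monom 1 0)"
  have m: "?m > 0" using gegint_1[of \<mu>] mu by (simp add: gegmass_def monom_0 one_pCons)
  have 1: "(\<integral>\<^sup>+s. ennreal (bw \<mu> (vec3 w t s)) \<partial>lborel) \<le> ennreal ?m * indicator {-1..1} w *
      indicator {-1..1} t" for w t
  proof (cases "1 - w\<^sup>2 - t\<^sup>2 > 0")
    case True
    let ?c = "1 - w\<^sup>2 - t\<^sup>2"
    have wt: "w\<^sup>2 \<le> 1" "t\<^sup>2 \<le> 1" using True zero_le_power2[of w] zero_le_power2[of t] by linarith+
    have "(\<integral>\<^sup>+s. ennreal (bw \<mu> (vec3 w t s)) \<partial>lborel) =
        (\<integral>\<^sup>+s. ennreal (if s\<^sup>2 < ?c then s ^ 0 * (?c - s\<^sup>2) powr (\<mu> - 1/2) else 0) \<partial>lborel)"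
      by (intro nn_integral_cong) (simp add: bw_vec3_slice)
    also have "\<dots> = ennreal (?c powr \<mu> * ?m)"
      using fibre_integrable[OF mu True, of 0] fibre_integral[OF mu True, of 0]
      by (subst nn_integral_eq_integral) auto
    also have "\<dots> \<le> ennreal ?m"
    proof -
      have "?c powr \<mu> \<le> 1" using True mu wt by (intro powr_le1) (auto simp: algebra_simps
          add_increasing)
      then show ?thesis using m by (intro ennreal_leI) (simp add: mult_left_le_one_le)
    qed
    finally show ?thesis using wt by (auto simp: abs_square_le_1 abs_le_iff indicator_def)
  next
    case False
    have "bw \<mu> (vec3 w t s) = 0" for s
    proof -
      have "\<not> s\<^sup>2 < 1 - w\<^sup>2 - t\<^sup>2" using False zero_le_power2[of s] by linarith
      then show ?thesis unfolding bw_vec3_slice by simp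
    qed
    then show ?thesis by simp
  qed
  have "(\<integral>\<^sup>+x. ennreal (bw \<mu> x) \<partial>lborel) \<le> (\<integral>\<^sup>+w. (\<integral>\<^sup>+t. ennreal ?m * indicator {-1..1::real} w *
      indicator {-1..1::real} t \<partial>lborel) \<partial>lborel)"
    by (subst nn_integral_vec3, measurable) (intro nn_integral_mono 1)
  also have "\<dots> = (\<integral>\<^sup>+w. ennreal ?m * 2 * indicator {-1..1::real} w \<partial>lborel)"
    by (intro nn_integral_cong) (simp add: nn_integral_cmult mult_ac)
  also have "\<dots> < \<infinity>" by (simp add: nn_integral_cmult ennreal_mult_less_top)
  finally show ?thesis
    by (intro integrableI_nonneg) (auto simp: bw_nonneg)
qed

lemma integrable_mult_bw:
  fixes f g :: "real^3 \<Rightarrow> real"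
  assumes f: "integrable lebesgue (\<lambda>x. f x * bw \<mu> x)" and g: "continuous_on UNIV g"
  shows "integrable lebesgue (\<lambda>x. f x * g x * bw \<mu> x)"
proof -
  have "bounded (g ` cball 0 1)"
    using g by (intro compact_imp_bounded compact_continuous_image) (auto intro: continuous_on_subset)
  then obtain C where C: "\<And>x. x \<in> cball 0 1 \<Longrightarrow> \<bar>g x\<bar> \<le> C"
    unfolding bounded_iff by (metis imageI real_norm_def)
  have [measurable]: "g \<in> borel_measurable lebesgue"
    using g by (intro measurable_completion) (simp add: borel_measurable_continuous_onI)
  have "integrable lebesgue (\<lambda>x. g x * (f x * bw \<mu> x))"
  proof (rule Bochner_Integration.integrable_bound)
    show "integrable lebesgue (\<lambda>x. C * (f x * bw \<mu> x))" using f by simp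
    show "(\<lambda>x. g x * (f x * bw \<mu> x)) \<in> borel_measurable lebesgue"
      using borel_measurable_integrable[OF f] by simp
    show "AE x in lebesgue. norm (g x * (f x * bw \<mu> x)) \<le> norm (C * (f x * bw \<mu> x))"
    proof (intro AE_I2)
      fix x
      show "norm (g x * (f x * bw \<mu> x)) \<le> norm (C * (f x * bw \<mu> x))"
      proof (cases "x \<in> cball 0 1")
        case True
        then have "\<bar>g x\<bar> \<le> \<bar>C\<bar>" using C[of x] by linarith
        then show ?thesis by (simp add: abs_mult mult_right_mono)
      qed (simp add: bw_def)
    qed
  qed
  then show ?thesis by (simp add: mult_ac)
qed

lemma integrable_continuous_bw:
  fixes g :: "real^3 \<Rightarrow> real"
  assumes "\<mu> \<ge> 0" "continuous_on UNIV g"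
  shows "integrable lebesgue (\<lambda>x. g x * bw \<mu> x)" "integrable lborel (\<lambda>x. g x * bw \<mu> x)"
proof -
  have "integrable lebesgue (\<lambda>x. 1 * bw \<mu> x)"
    using bw_integrable[OF assms(1)] by (simp add: integrable_completion)
  from integrable_mult_bw[OF this assms(2)]
  show 1: "integrable lebesgue (\<lambda>x. g x * bw \<mu> x)" by simp
  have [measurable]: "g \<in> borel_measurable borel" using assms(2) by (rule
      borel_measurable_continuous_onI)
  show "integrable lborel (\<lambda>x. g x * bw \<mu> x)"
    using 1 by (subst (asm) integrable_completion) auto
qed

text \<open>The variable \<open>x$2\<close> is integrated out along chords; what remains is a power
  of the squared half length of the chord. This prepares the orthogonality of ridge functions in the
  direction of the first coordinate.\<close>

lemma bint_fibre:
  fixes g :: "real \<Rightarrow> real \<Rightarrow> real"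
  assumes mu: "\<mu> \<ge> 0"
    and [measurable]: "(\<lambda>x::real^3. g (x$3) (x$1)) \<in> borel_measurable borel"
    and i: "integrable lborel (\<lambda>x::real^3. g (x$3) (x$1) * (x$2) ^ b * bw \<mu> x)"
  shows "bint \<mu> (\<lambda>x. g (x$3) (x$1) * (x$2) ^ b) =
    gegint \<mu> (monom 1 b) * (\<integral>w. (\<integral>t. (if t\<^sup>2 < 1 - w\<^sup>2 then g w t * (1 - w\<^sup>2 - t\<^sup>2) powr (\<mu> + real
        b / 2) else 0) \<partial>lborel) \<partial>lborel)"
proof -
  have "bint \<mu> (\<lambda>x. g (x$3) (x$1) * (x$2) ^ b) =
      (\<integral>w. (\<integral>t. (\<integral>s. g w t * s ^ b * bw \<mu> (vec3 w t s) \<partial>lborel) \<partial>lborel) \<partial>lborel)"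
    by (subst bint_lborel, simp, subst integral_vec3[OF i]) simp
  also have "(\<lambda>w t. (\<integral>s. g w t * s ^ b * bw \<mu> (vec3 w t s) \<partial>lborel)) =
     (\<lambda>w t. gegint \<mu> (monom 1 b) * (if t\<^sup>2 < 1 - w\<^sup>2 then g w t * (1 - w\<^sup>2 - t\<^sup>2) powr (\<mu> + real b
         / 2) else 0))"
  proof (intro ext)
    fix w t :: real
    let ?c = "1 - w\<^sup>2 - t\<^sup>2"
    have "(\<integral>s. g w t * s ^ b * bw \<mu> (vec3 w t s) \<partial>lborel) =
      (\<integral>s. g w t * (if s\<^sup>2 < ?c then s ^ b * (?c - s\<^sup>2) powr (\<mu> - 1/2) else 0) \<partial>lborel)"
      by (intro Bochner_Integration.integral_cong refl) (simp add: bw_vec3_slice)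
    also have "\<dots> = g w t * (\<integral>s. (if s\<^sup>2 < ?c then s ^ b * (?c - s\<^sup>2) powr (\<mu> - 1/2) else 0) \<partial>lborel)"
      by simp
    also have "\<dots> = gegint \<mu> (monom 1 b) * (if t\<^sup>2 < 1 - w\<^sup>2 then g w t * ?c powr (\<mu> + real b / 2)
        else 0)"
    proof (cases "?c > 0")
      case True
      then show ?thesis using fibre_integral[OF mu True, of b] by simp
    next
      case False
      then have "\<not> s\<^sup>2 < ?c" for s using zero_le_power2[of s] by linarith
      then show ?thesis using False by simp
    qed
    finally show "(\<integral>s. g w t * s ^ b * bw \<mu> (vec3 w t s) \<partial>lborel) =
     gegint \<mu> (monom 1 b) * (if t\<^sup>2 < 1 - w\<^sup>2 then g w t * ?c powr (\<mu> + real b / 2) else 0)" .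
  qed
  also have "(\<integral>w. (\<integral>t. gegint \<mu> (monom 1 b) * (if t\<^sup>2 < 1 - w\<^sup>2 then g w t * (1 - w\<^sup>2 - t\<^sup>2) powr
      (\<mu> + real b / 2) else 0) \<partial>lborel) \<partial>lborel) =
     gegint \<mu> (monom 1 b) * (\<integral>w. (\<integral>t. (if t\<^sup>2 < 1 - w\<^sup>2 then g w t * (1 - w\<^sup>2 - t\<^sup>2) powr (\<mu> +
         real b / 2) else 0) \<partial>lborel) \<partial>lborel)"
    by simp
  finally show ?thesis .
qed

section \<open>Polynomial functions on \<open>\<real>\<^sup>3\<close>\<close>

abbreviation exponents :: "nat \<Rightarrow> (nat \<times> nat \<times> nat) set" where
  "exponents d \<equiv> {(i, j, k). i + j + k \<le> d}"

abbreviation mon3 :: "nat \<times> nat \<times> nat \<Rightarrow> real^3 \<Rightarrow> real" where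
  "mon3 p x \<equiv> (x$1)^fst p * (x$2)^fst (snd p) * (x$3)^snd (snd p)"

lemma finite_exponents: "finite (exponents d)"
  by (rule finite_subset[of _ "{..d} \<times> {..d} \<times> {..d}"]) auto

lemma polys3_monomial:
  assumes "i + j + k \<le> d"
  shows "(\<lambda>x. c * (x$1) ^ i * (x$2) ^ j * (x$3) ^ k) \<in> polys3_le d"
proof -
  let ?c = "\<lambda>i' j' k'. if i' = i \<and> j' = j \<and> k' = k then c else 0"
  have "(\<Sum>(i', j', k') \<in> exponents d. ?c i' j' k' * (x$1)^i' * (x$2)^j' * (x$3)^k')
     = (\<Sum>p \<in> exponents d. if p = (i, j, k) then c * (x$1)^i * (x$2)^j * (x$3)^k else 0)" for x ::
         "real^3"
  proof (intro sum.cong refl)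
    fix p :: "nat \<times> nat \<times> nat"
    obtain i' j' k' where p: "p = (i', j', k')" by (cases p)
    show "(case p of (i', j', k') \<Rightarrow> ?c i' j' k' * (x$1)^i' * (x$2)^j' * (x$3)^k')
        = (if p = (i, j, k) then c * (x$1)^i * (x$2)^j * (x$3)^k else 0)"
      unfolding p by (cases "i' = i \<and> j' = j \<and> k' = k") auto
  qed
  also have "\<dots> x = c * (x$1)^i * (x$2)^j * (x$3)^k" for x
    using assms by (simp add: finite_exponents)
  finally show ?thesis unfolding polys3_le_def by (auto intro!: exI[of _ ?c])
qed

lemma polys3_0 [simp]: "(\<lambda>x. 0) \<in> polys3_le d"
  using polys3_monomial[of 0 0 0 d 0] by simp

lemma polys3_add:
  assumes "P \<in> polys3_le d" "Q \<in> polys3_le d"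
  shows "(\<lambda>x. P x + Q x) \<in> polys3_le d"
proof -
  from assms obtain a b where
    "\<And>x. P x = (\<Sum>(i, j, k) \<in> exponents d. a i j k * (x$1)^i * (x$2)^j * (x$3)^k)"
    "\<And>x. Q x = (\<Sum>(i, j, k) \<in> exponents d. b i j k * (x$1)^i * (x$2)^j * (x$3)^k)"
    unfolding polys3_le_def by auto
  then have "P x + Q x = (\<Sum>(i, j, k) \<in> exponents d. (a i j k + b i j k) * (x$1)^i * (x$2)^j *
      (x$3)^k)" for x
    by (simp add: sum.distrib[symmetric] split_beta algebra_simps)
  then show ?thesis unfolding polys3_le_def by (auto intro!: exI[of _ "\<lambda>i j k. a i j k + b i j k"])
qed

lemma polys3_sum:
  assumes "\<And>a. a \<in> A \<Longrightarrow> P a \<in> polys3_le d"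
  shows "(\<lambda>x. \<Sum>a\<in>A. P a x) \<in> polys3_le d"
  using assms by (induction A rule: infinite_finite_induct) (auto intro: polys3_add)

lemma polys3E:
  assumes "P \<in> polys3_le d"
  obtains c where "P = (\<lambda>x. \<Sum>p \<in> exponents d. c p * mon3 p x)"
proof -
  from assms obtain a where
    "\<And>x. P x = (\<Sum>(i, j, k) \<in> exponents d. a i j k * (x$1)^i * (x$2)^j * (x$3)^k)"
    unfolding polys3_le_def by auto
  then show ?thesis
    by (intro that[of "\<lambda>(i, j, k). a i j k"]) (auto simp: split_beta mult_ac)
qed

lemma polys3_mult:
  assumes "P \<in> polys3_le d" "Q \<in> polys3_le e"
  shows "(\<lambda>x. P x * Q x) \<in> polys3_le (d + e)"
proof -
  obtain a where P: "P = (\<lambda>x. \<Sum>p \<in> exponents d. a p * mon3 p x)"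
    by (rule polys3E[OF assms(1)])
  obtain b where Q: "Q = (\<lambda>x. \<Sum>p \<in> exponents e. b p * mon3 p x)"
    by (rule polys3E[OF assms(2)])
  have "(\<lambda>x. P x * Q x) = (\<lambda>x. \<Sum>p \<in> exponents d. \<Sum>q \<in> exponents e.
     (a p * b q) * (x$1)^(fst p + fst q) * (x$2)^(fst (snd p) + fst (snd q)) * (x$3)^(snd (snd p)
         + snd (snd q)))"
    unfolding P Q sum_product by (intro ext sum.cong refl) (simp add: power_add mult_ac)
  also have "\<dots> \<in> polys3_le (d + e)"
    by (intro polys3_sum polys3_monomial) auto
  finally show ?thesis .
qed

lemma polys3_mono:
  assumes "P \<in> polys3_le d" "d \<le> e"
  shows "P \<in> polys3_le e"
proof -
  obtain a where P: "P = (\<lambda>x. \<Sum>p \<in> exponents d. a p * mon3 p x)"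
    by (rule polys3E[OF assms(1)])
  have "P = (\<lambda>x. \<Sum>p \<in> exponents d. a p * (x$1)^fst p * (x$2)^fst (snd p) * (x$3)^snd (snd p))"
    unfolding P by (simp add: mult_ac)
  also have "\<dots> \<in> polys3_le e" using assms(2) by (intro polys3_sum polys3_monomial) auto
  finally show ?thesis .
qed

lemma polys3_const [simp]: "(\<lambda>x. c) \<in> polys3_le d"
  using polys3_monomial[of 0 0 0 d c] by simp

lemma polys3_cmult: "P \<in> polys3_le d \<Longrightarrow> (\<lambda>x. c * P x) \<in> polys3_le d"
  using polys3_mult[OF polys3_const[of c 0]] by simp

lemma polys3_diff: "P \<in> polys3_le d \<Longrightarrow> Q \<in> polys3_le d \<Longrightarrow> (\<lambda>x. P x - Q x) \<in> polys3_le d"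
  using polys3_add[of P d "\<lambda>x. (-1) * Q x"] polys3_cmult[of Q d "-1"] by simp

lemma polys3_coord: "(\<lambda>x. x$1) \<in> polys3_le 1" "(\<lambda>x. x$2) \<in> polys3_le 1" "(\<lambda>x. x$3) \<in> polys3_le 1"
  using polys3_monomial[of 1 0 0 1 1] polys3_monomial[of 0 1 0 1 1] polys3_monomial[of 0 0 1 1 1]
      by simp_all

lemma polys3_power: "P \<in> polys3_le d \<Longrightarrow> (\<lambda>x. P x ^ n) \<in> polys3_le (n * d)"
  by (induction n) (auto dest: polys3_mult)

lemma polys3_poly:
  assumes "degree q \<le> d"
  shows "(\<lambda>x. poly q (x$3)) \<in> polys3_le d"
  unfolding poly_altdef
proof (intro polys3_sum)
  fix i assume "i \<in> {..degree q}"
  then show "(\<lambda>x. coeff q i * (x$3) ^ i) \<in> polys3_le d"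
    using polys3_monomial[of 0 0 i d "coeff q i"] assms by simp
qed

lemma polys3_continuous:
  assumes "P \<in> polys3_le d"
  shows "continuous_on UNIV P"
proof -
  obtain c where P: "P = (\<lambda>x. \<Sum>p \<in> exponents d. c p * mon3 p x)"
    by (rule polys3E[OF assms])
  show ?thesis unfolding P by (intro continuous_intros)
qed

text \<open>Along a line through the origin a polynomial function is a univariate polynomial.\<close>

lemma polys3_eq_0_ball:
  assumes P: "P \<in> polys3_le d" and z: "\<And>x. x \<in> ball 0 1 \<Longrightarrow> P x = 0"
  shows "P x = 0"
proof -
  obtain c where Pc: "P = (\<lambda>x. \<Sum>p \<in> exponents d. c p * mon3 p x)"
    by (rule polys3E[OF P])
  define q where "q = (\<Sum>p \<in> exponents d.
    monom (c p * mon3 p x) (fst p + fst (snd p) + snd (snd p)))"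
  have q: "poly q s = P (s *\<^sub>R x)" for s
    unfolding q_def Pc poly_sum poly_monom
    by (intro sum.cong refl) (simp add: power_mult_distrib power_add mult_ac)
  define e where "e = 1 / (norm x + 1)"
  have "norm x + 1 > 0" using norm_ge_zero[of x] by linarith
  then have e: "e > 0" "e * norm x < 1" by (auto simp: e_def pos_divide_less_eq)
  have "poly q s = 0" if "s \<in> {0<..<e}" for s
  proof -
    have "s * norm x \<le> e * norm x" using that by (intro mult_right_mono) auto
    then have "s *\<^sub>R x \<in> ball 0 1" using that e by simp
    then show ?thesis unfolding q by (rule z)
  qed
  then have "{0<..<e} \<subseteq> {s. poly q s = 0}" by blast
  then have "q = 0" using poly_roots_finite[of q] e(1) infinite_Ioo[of 0 e] finite_subset by blast
  then show ?thesis using q[of 1] by simp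
qed

section \<open>Linearity and definiteness of the weighted integral\<close>

lemma bint_add:
  assumes "integrable lebesgue (\<lambda>x. f x * bw \<mu> x)" "integrable lebesgue (\<lambda>x. g x * bw \<mu> x)"
  shows "bint \<mu> (\<lambda>x. f x + g x) = bint \<mu> f + bint \<mu> g"
  using assms by (simp add: bint_def distrib_right)

lemma bint_cmult: "bint \<mu> (\<lambda>x. c * f x) = c * bint \<mu> f"
  by (simp add: bint_def mult.assoc)

lemma bint_0 [simp]: "bint \<mu> (\<lambda>x. 0) = 0"
  by (simp add: bint_def)

lemma bint_sum:
  assumes "\<And>a. a \<in> A \<Longrightarrow> integrable lebesgue (\<lambda>x. f a x * bw \<mu> x)"
  shows "bint \<mu> (\<lambda>x. \<Sum>a\<in>A. f a x) = (\<Sum>a\<in>A. bint \<mu> (f a))"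
  unfolding bint_def sum_distrib_right using assms by (intro Bochner_Integration.integral_sum)

lemma integrable_polys3_bw:
  assumes "\<mu> \<ge> 0" "P \<in> polys3_le d"
  shows "integrable lebesgue (\<lambda>x. P x * bw \<mu> x)"
  by (rule integrable_continuous_bw(1)[OF assms(1) polys3_continuous[OF assms(2)]])

text \<open>The weight is positive in the open ball, so P vanishes almost everywhere there; a
  nonempty open set is not negligible, so P vanishes everywhere there, and then identically by
  \<open>polys3_eq_0_ball\<close>.\<close>

lemma polys3_bint_definite:
  assumes mu: "\<mu> \<ge> 0" and P: "P \<in> polys3_le d" and z: "bint \<mu> (\<lambda>x. P x * P x) = 0"
  shows "P = (\<lambda>x. 0)"
proof -
  have i: "integrable lebesgue (\<lambda>x. P x * P x * bw \<mu> x)"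
    using integrable_polys3_bw[OF mu polys3_mult[OF P P]] by simp
  have "AE x in lebesgue. P x * P x * bw \<mu> x = 0"
    using z integral_nonneg_eq_0_iff_AE[OF i] by (auto simp: bint_def bw_nonneg)
  moreover have "bw \<mu> x > 0" if "x \<in> ball 0 1" for x
  proof -
    have "(norm x)\<^sup>2 < 1" using that by (simp add: abs_square_less_1)
    then show ?thesis by (simp add: bw_eq norm_vec3_sq)
  qed
  ultimately have ae: "AE x in lebesgue. x \<in> ball 0 1 \<longrightarrow> P x = 0"
    by (elim eventually_mono) fastforce
  have "P x = 0" if x: "x \<in> ball 0 1" for x
  proof (rule ccontr)
    assume nz: "P x \<noteq> 0"
    have op: "open ({x. P x \<noteq> 0} \<inter> ball 0 1)"
      using polys3_continuous[OF P] by (intro open_Int open_Collect_neq continuous_intros) auto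
    have "emeasure lebesgue ({x. P x \<noteq> 0} \<inter> ball 0 1) = 0"
      using ae op by (subst (asm) AE_iff_measurable[OF _ refl]) (auto simp: Int_def conj_commute)
    then have "({x. P x \<noteq> 0} \<inter> ball 0 1) \<in> null_sets lebesgue" using op by (auto simp: null_sets_def)
    then have "negligible ({x. P x \<noteq> 0} \<inter> ball 0 1)" by (simp add: negligible_iff_null_sets)
    then show False using open_not_negligible[OF op] nz x by blast
  qed
  then show ?thesis using polys3_eq_0_ball[OF P] by blast
qed

section \<open>The orthonormal basis on the ball\<close>

definition rho2 :: "real^3 \<Rightarrow> real" where
  "rho2 x = (x$1)\<^sup>2 + (x$2)\<^sup>2"

definition zc :: "real^3 \<Rightarrow> complex" where
  "zc x = Complex (x$1) (x$2)"

text \<open>These are \<open>r^j cos (j \<phi>)\<close> and \<open>r^j sin (j \<phi>)\<close> in the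
  first two coordinates. As parts of a complex power they are visibly polynomials, and a rotation
  multiplies the power by a unit complex number.\<close>

definition Zf :: "nat \<Rightarrow> nat \<Rightarrow> real^3 \<Rightarrow> real" where
  "Zf j \<epsilon> x = (if \<epsilon> = 0 then Re (zc x ^ j) else Im (zc x ^ j))"

lemma rho2_rot3 [simp]: "rho2 (rot3 \<theta> x) = rho2 x"
  unfolding rho2_def by (rule rot3_rho)

lemma zc_rot3: "zc (rot3 \<theta> x) = cis \<theta> * zc x"
  by (simp add: zc_def complex_eq_iff algebra_simps)

lemma zc_cnj: "zc x * cnj (zc x) = of_real (rho2 x)"
  by (simp add: zc_def rho2_def complex_mult_cnj)

lemma Zf_0: "Zf 0 \<epsilon> x = (if \<epsilon> = 0 then 1 else 0)"
  by (simp add: Zf_def)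

lemma Zf_Suc: "Zf (Suc j) 0 x = x$1 * Zf j 0 x - x$2 * Zf j 1 x"
  "Zf (Suc j) 1 x = x$1 * Zf j 1 x + x$2 * Zf j 0 x"
  by (simp_all add: Zf_def zc_def)

lemma Zf_eps: "\<epsilon> \<noteq> 0 \<Longrightarrow> Zf j \<epsilon> = Zf j 1"
  by (auto simp: Zf_def)

text \<open>The coordinates are the real and imaginary parts of z, that is (z + cnj z)/2 and (z -
  cnj z)/(2 i), while z times cnj z is \<open>rho2\<close>. So multiplying \<open>z^(j + 1)\<close>
  by a coordinate gives a combination of \<open>z^(j + 2)\<close> and \<open>rho2 * z^j\<close>; the
  spanning proof absorbs coordinates in this way.\<close>

lemma Zf_coord_mult:
  "x$1 * Zf (Suc j) \<epsilon> x = (Zf (Suc (Suc j)) \<epsilon> x + rho2 x * Zf j \<epsilon> x) / 2"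
  "x$2 * Zf (Suc j) 0 x = (Zf (Suc (Suc j)) 1 x - rho2 x * Zf j 1 x) / 2"
  "x$2 * Zf (Suc j) 1 x = (rho2 x * Zf j 0 x - Zf (Suc (Suc j)) 0 x) / 2"
proof -
  have "x$1 * Zf (Suc j) 0 x = (Zf (Suc (Suc j)) 0 x + rho2 x * Zf j 0 x) / 2"
    "x$1 * Zf (Suc j) 1 x = (Zf (Suc (Suc j)) 1 x + rho2 x * Zf j 1 x) / 2"
    unfolding Zf_Suc rho2_def by (auto simp: field_simps power2_eq_square)
  then show "x$1 * Zf (Suc j) \<epsilon> x = (Zf (Suc (Suc j)) \<epsilon> x + rho2 x * Zf j \<epsilon> x) / 2"
    using Zf_eps[of \<epsilon>] by (cases "\<epsilon> = 0") auto
  show "x$2 * Zf (Suc j) 0 x = (Zf (Suc (Suc j)) 1 x - rho2 x * Zf j 1 x) / 2"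
    "x$2 * Zf (Suc j) 1 x = (rho2 x * Zf j 0 x - Zf (Suc (Suc j)) 0 x) / 2"
    unfolding Zf_Suc rho2_def by (auto simp: field_simps power2_eq_square)
qed

lemma polys3_rho2: "rho2 \<in> polys3_le 2"
proof -
  have "(\<lambda>x. (x$1)\<^sup>2 + (x$2)\<^sup>2) \<in> polys3_le 2"
    using polys3_monomial[of 2 0 0 2 1] polys3_monomial[of 0 2 0 2 1] by (intro polys3_add) simp_all
  then show ?thesis by (simp add: rho2_def[abs_def])
qed

lemma polys3_Zf: "Zf j \<epsilon> \<in> polys3_le j"
proof -
  have "Zf j 0 \<in> polys3_le j \<and> Zf j 1 \<in> polys3_le j"
  proof (induction j)
    case 0
    have "Zf 0 0 = (\<lambda>x. 1)" "Zf 0 1 = (\<lambda>x. 0)" by (auto simp: Zf_def)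
    then show ?case by simp
  next
    case (Suc j)
    have "Zf (Suc j) 0 = (\<lambda>x. x$1 * Zf j 0 x - x$2 * Zf j 1 x)" "Zf (Suc j) 1 = (\<lambda>x. x$1 * Zf j 1
        x + x$2 * Zf j 0 x)"
      using Zf_Suc by auto
    moreover have "(\<lambda>x. x$a * Zf j b x) \<in> polys3_le (Suc j)" if "a \<in> {1, 2}" "b \<in> {0, 1}" for a b
      using Suc that polys3_coord polys3_mult[of "\<lambda>x. x$a" 1 "Zf j b" j] by auto
    ultimately show ?case using polys3_add polys3_diff by simp
  qed
  then show ?thesis using Zf_eps[of \<epsilon> j] by (cases "\<epsilon> = 0") auto
qed

lemma continuous_Zf: "continuous_on UNIV (Zf j \<epsilon>)"
  using polys3_continuous[OF polys3_Zf] .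

lemma continuous_rho2: "continuous_on UNIV rho2"
  using polys3_continuous[OF polys3_rho2] .

lemma continuous_zc: "continuous_on UNIV zc"
  unfolding zc_def[abs_def] Complex_eq by (intro continuous_intros)

text \<open>A rotation by \<open>\<pi> / (p - q)\<close> changes the sign of the integrand.\<close>

lemma bint_angular_0:
  assumes a: "continuous_on UNIV a" "\<And>\<theta> x. a (rot3 \<theta> x) = a x" and "p \<noteq> q"
  shows "bint \<mu> (\<lambda>x. a x * Re (zc x ^ p * cnj (zc x) ^ q)) = 0"
    "bint \<mu> (\<lambda>x. a x * Im (zc x ^ p * cnj (zc x) ^ q)) = 0"
proof -
  define \<theta> where "\<theta> = pi / (real p - real q)"
  have pq: "real p - real q \<noteq> 0" using \<open>p \<noteq> q\<close> by simp
  have "(real p - real q) * \<theta> = pi" using pq by (simp add: \<theta>_def)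
  then have "real p * \<theta> + real q * - \<theta> = pi" by (simp add: left_diff_distrib)
  then have "cis (real p * \<theta>) * cis (real q * - \<theta>) = cis pi"
    unfolding cis_mult by (rule arg_cong)
  then have "cis \<theta> ^ p * cnj (cis \<theta>) ^ q = -1"
    by (simp add: Complex.DeMoivre cis_cnj)
  then have m: "zc (rot3 \<theta> x) ^ p * cnj (zc (rot3 \<theta> x)) ^ q = - (zc x ^ p * cnj (zc x) ^ q)" for x
    unfolding zc_rot3 complex_cnj_mult power_mult_distrib by (metis (no_types, lifting) mult.assoc
        mult.commute mult_minus1)
  have c: "continuous_on UNIV (\<lambda>x. zc x ^ p * cnj (zc x) ^ q)"
    by (intro continuous_intros continuous_zc)
  have ms: "(\<lambda>x. a x * Re (zc x ^ p * cnj (zc x) ^ q)) \<in> borel_measurable borel"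
    "(\<lambda>x. a x * Im (zc x ^ p * cnj (zc x) ^ q)) \<in> borel_measurable borel"
    by (intro borel_measurable_continuous_onI continuous_intros a c continuous_zc)+
  have "bint \<mu> (\<lambda>x. a x * Re (zc x ^ p * cnj (zc x) ^ q)) = bint \<mu> (\<lambda>x. (-1) * (a x * Re (zc x ^ p
      * cnj (zc x) ^ q)))"
    using bint_rot3[OF ms(1), of \<mu> \<theta>] by (simp only: m a(2) uminus_complex.sel mult_minus_right
        mult_minus_left mult_1)
  then show "bint \<mu> (\<lambda>x. a x * Re (zc x ^ p * cnj (zc x) ^ q)) = 0" unfolding bint_cmult by simp
  have "bint \<mu> (\<lambda>x. a x * Im (zc x ^ p * cnj (zc x) ^ q)) = bint \<mu> (\<lambda>x. (-1) * (a x * Im (zc x ^ p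
      * cnj (zc x) ^ q)))"
    using bint_rot3[OF ms(2), of \<mu> \<theta>] by (simp only: m a(2) uminus_complex.sel mult_minus_right
        mult_minus_left mult_1)
  then show "bint \<mu> (\<lambda>x. a x * Im (zc x ^ p * cnj (zc x) ^ q)) = 0" unfolding bint_cmult by simp
qed

lemma Zf_products:
  "Zf j 0 x * Zf j' 0 x = (1/2) * Re (zc x ^ (j + j') * cnj (zc x) ^ 0) + (1/2) * Re (zc x ^ j *
      cnj (zc x) ^ j')"
  "Zf j 1 x * Zf j' 1 x = (1/2) * Re (zc x ^ j * cnj (zc x) ^ j') + (-1/2) * Re (zc x ^ (j + j') *
      cnj (zc x) ^ 0)"
  "Zf j 1 x * Zf j' 0 x = (1/2) * Im (zc x ^ (j + j') * cnj (zc x) ^ 0) + (1/2) * Im (zc x ^ j *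
      cnj (zc x) ^ j')"
  by (simp_all add: Zf_def power_add complex_cnj_power[symmetric] del: complex_cnj_power) (auto
      simp: field_simps)

lemma zc_diag: "Re (zc x ^ j * cnj (zc x) ^ j) = rho2 x ^ j" "Im (zc x ^ j * cnj (zc x) ^ j) = 0"
proof -
  have "zc x ^ j * cnj (zc x) ^ j = of_real (rho2 x ^ j)"
    unfolding power_mult_distrib[symmetric] zc_cnj by simp
  then show "Re (zc x ^ j * cnj (zc x) ^ j) = rho2 x ^ j" "Im (zc x ^ j * cnj (zc x) ^ j) = 0" by
      simp_all
qed

text \<open>A product of two harmonics is a combination of real and imaginary parts of
  \<open>z^p * cnj z^q\<close>, and rotation invariance kills those with different p and q. The
  conditions \<epsilon> \<le> j and \<epsilon>' \<le> j' exclude the zero function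
  \<open>Zf 0 1\<close>, for which the diagonal value would be wrong.\<close>

lemma bint_angular:
  assumes mu: "\<mu> \<ge> 0" and a: "continuous_on UNIV a" "\<And>\<theta> x. a (rot3 \<theta> x) = a x"
    and e: "\<epsilon> \<in> {0, 1}" "\<epsilon>' \<in> {0, 1}" "\<epsilon> \<le> j" "\<epsilon>' \<le> j'"
  shows "bint \<mu> (\<lambda>x. a x * (Zf j \<epsilon> x * Zf j' \<epsilon>' x)) =
    (if j = j' \<and> \<epsilon> = \<epsilon>' then (if j = 0 then 1 else 1/2) * bint \<mu> (\<lambda>x. a x * rho2 x ^ j) else 0)"
proof -
  let ?R = "\<lambda>p q x. a x * Re (zc x ^ p * cnj (zc x) ^ q)"
  let ?I = "\<lambda>p q x. a x * Im (zc x ^ p * cnj (zc x) ^ q)"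
  have iR: "integrable lebesgue (\<lambda>x. (c * ?R p q x) * bw \<mu> x)" for c p q
    by (intro integrable_continuous_bw(1)[OF mu] continuous_intros a continuous_zc)
  have iI: "integrable lebesgue (\<lambda>x. (c * ?I p q x) * bw \<mu> x)" for c p q
    by (intro integrable_continuous_bw(1)[OF mu] continuous_intros a continuous_zc)
  have R: "bint \<mu> (?R p q) = (if p = q then bint \<mu> (\<lambda>x. a x * rho2 x ^ p) else 0)" for p q
  proof (cases "p = q")
    case True
    show ?thesis unfolding True zc_diag by simp
  next
    case False
    then show ?thesis using bint_angular_0(1)[OF a False] by simp
  qed
  have I: "bint \<mu> (?I p q) = 0" for p q
  proof (cases "p = q")
    case True
    show ?thesis unfolding True zc_diag by simp
  next
    case False
    then show ?thesis using bint_angular_0(2)[OF a False] by simp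
  qed
  have 00: "bint \<mu> (\<lambda>x. a x * (Zf j 0 x * Zf j' 0 x)) = (1/2) * bint \<mu> (?R (j + j') 0) + (1/2) *
      bint \<mu> (?R j j')" for j j'
    unfolding Zf_products bint_cmult[symmetric] by (subst bint_add[symmetric, OF iR iR]) (simp
        add: algebra_simps)
  have 11: "bint \<mu> (\<lambda>x. a x * (Zf j 1 x * Zf j' 1 x)) = (1/2) * bint \<mu> (?R j j') + (-1/2) * bint \<mu>
      (?R (j + j') 0)" for j j'
    unfolding Zf_products bint_cmult[symmetric] by (subst bint_add[symmetric, OF iR iR]) (simp
        add: algebra_simps)
  have 10: "bint \<mu> (\<lambda>x. a x * (Zf j 1 x * Zf j' 0 x)) = (1/2) * bint \<mu> (?I (j + j') 0) + (1/2) *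
      bint \<mu> (?I j j')" for j j'
    unfolding Zf_products bint_cmult[symmetric] by (subst bint_add[symmetric, OF iI iI]) (simp
        add: algebra_simps)
  have 01: "bint \<mu> (\<lambda>x. a x * (Zf j 0 x * Zf j' 1 x)) = 0"
  proof -
    have "(\<lambda>x. a x * (Zf j 0 x * Zf j' 1 x)) = (\<lambda>x. a x * (Zf j' 1 x * Zf j 0 x))"
      by (simp add: mult.commute)
    then show ?thesis by (simp only: 10 I mult_zero_right add_0)
  qed
  from e consider "\<epsilon> = 0" "\<epsilon>' = 0" | "\<epsilon> = 1" "\<epsilon>' = 1" | "\<epsilon> = 1" "\<epsilon>' = 0" | "\<epsilon> = 0" "\<epsilon>' = 1" by auto
  then show ?thesis
  proof cases
    case 1
    show ?thesis unfolding 1 00 R by auto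
  next
    case 2
    then show ?thesis using e unfolding 2 11 R by auto
  next
    case 3
    show ?thesis unfolding 3 10 I by auto
  next
    case 4
    show ?thesis unfolding 4 01 by auto
  qed
qed

section \<open>Homogenized Jacobi polynomials and integrals over slices\<close>

lemma bint_radial:
  fixes A :: "real \<Rightarrow> real \<Rightarrow> real"
  assumes mu: "\<mu> \<ge> 0" and A: "continuous_on UNIV (\<lambda>(u, w). A u w)"
  shows "bint \<mu> (\<lambda>x. A (rho2 x) (x$3)) =
    pi * (\<integral>w. (\<integral>u. (if 0 \<le> u \<and> u < 1 - w\<^sup>2 then A u w * (1 - w\<^sup>2 - u) powr (\<mu> - 1/2) else 0)
        \<partial>lborel) \<partial>lborel)"
proof -
  have cA: "continuous_on UNIV (\<lambda>x. A (rho2 x) (x$3))"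
  proof -
    have "continuous_on UNIV (\<lambda>x. (rho2 x, x$3))"
      by (intro continuous_on_Pair continuous_rho2 continuous_intros)
    from continuous_on_compose2[OF A this] show ?thesis by simp
  qed
  have mA: "(\<lambda>x. A (rho2 x) (x$3)) \<in> borel_measurable borel"
    using cA by (rule borel_measurable_continuous_onI)
  let ?B = "\<lambda>u w. A u w * (if u + w\<^sup>2 < 1 then (1 - (u + w\<^sup>2)) powr (\<mu> - 1/2) else 0)"
  have e: "A (rho2 x) (x$3) * bw \<mu> x = ?B ((x$1)\<^sup>2 + (x$2)\<^sup>2) (x$3)" for x
    by (simp add: bw_eq rho2_def)
  have m1: "(\<lambda>(u, w). A u w) \<in> borel_measurable borel" using A by (rule borel_measurable_continuous_onI)
  have m2: "(\<lambda>p::real\<times>real. 1 - (fst p + (snd p)\<^sup>2)) \<in> borel_measurable borel"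
    by (intro borel_measurable_continuous_onI continuous_intros)
  have m3: "(\<lambda>p::real\<times>real. if 0 < 1 - (fst p + (snd p)\<^sup>2) then (1 - (fst p + (snd p)\<^sup>2)) powr (\<mu>
      - 1/2) else 0) \<in> borel_measurable borel"
    using m2 by measurable
  have m: "(\<lambda>(u, w). ?B u w) \<in> borel_measurable borel"
    using borel_measurable_times[OF m1 m3] by (simp add: split_beta)
  have "bint \<mu> (\<lambda>x. A (rho2 x) (x$3)) = integral\<^sup>L lborel (\<lambda>x::real^3. ?B ((x$1)\<^sup>2 + (x$2)\<^sup>2) (x$3))"
    by (simp add: bint_lborel[OF mA] e)
  also have "\<dots> = (\<integral>w. (\<integral>u. pi * indicator {0..} u * ?B u w \<partial>lborel) \<partial>lborel)"
    using integrable_continuous_bw(2)[OF mu cA] by (intro integral_radial[OF m]) (simp add: e)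
  also have "\<dots> = (\<integral>w. (\<integral>u. pi * (if 0 \<le> u \<and> u < 1 - w\<^sup>2 then A u w * (1 - w\<^sup>2 - u) powr (\<mu> - 1/2)
      else 0) \<partial>lborel) \<partial>lborel)"
    by (intro Bochner_Integration.integral_cong refl) (auto simp: indicator_def algebra_simps)
  finally show ?thesis by simp
qed

definition jacR :: "real \<Rightarrow> nat \<Rightarrow> nat \<Rightarrow> real poly" where
  "jacR \<mu> i j = pcompose (jacobi_orthonormal i (\<mu> - 1/2) (real j)) [:-1, 2:]"

text \<open>A form of degree i in u and b that is the Jacobi polynomial in u/b times
  \<open>b^i\<close>, see \<open>Hj_scale\<close>. With b = \<open>1 - x$3^2\<close> it stays a
  polynomial at the poles, where u/b has no meaning.\<close>

definition Hj :: "real \<Rightarrow> nat \<Rightarrow> nat \<Rightarrow> real \<Rightarrow> real \<Rightarrow> real" where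
  "Hj \<mu> i j u b = (\<Sum>r\<le>i. coeff (jacR \<mu> i j) r * u ^ r * b ^ (i - r))"

lemma poly_jacR: "poly (jacR \<mu> i j) s = poly (jacobi_orthonormal i (\<mu> - 1/2) (real j)) (2 * s - 1)"
  by (simp add: jacR_def poly_pcompose algebra_simps)

lemma degree_jacR: "\<mu> \<ge> 0 \<Longrightarrow> degree (jacR \<mu> i j) = i"
  using jacobi_degree[of "\<mu> - 1/2" "real j" i] by (simp add: jacR_def degree_pcompose)

lemma jacR_lead:
  assumes "\<mu> \<ge> 0" shows "coeff (jacR \<mu> i j) i \<noteq> 0"
proof -
  have "jacR \<mu> i j \<noteq> 0"
  proof
    assume "jacR \<mu> i j = 0"
    then have "poly (jacobi_orthonormal i (\<mu> - 1/2) (real j)) 1 = 0" using poly_jacR[of \<mu> i j 1] by simp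
    then show False using jacobi_at_1[of "\<mu> - 1/2" "real j" i] assms by simp
  qed
  then show ?thesis using degree_jacR[OF assms, of i j] by (metis leading_coeff_0_iff)
qed

lemma Hj_scale:
  assumes "\<mu> \<ge> 0"
  shows "Hj \<mu> i j (b * s) b = b ^ i * poly (jacR \<mu> i j) s"
  unfolding Hj_def poly_altdef degree_jacR[OF assms] sum_distrib_left
proof (intro sum.cong refl)
  fix r assume "r \<in> {..i}"
  then have "b ^ i = b ^ r * b ^ (i - r)" by (simp add: power_add[symmetric])
  then show "coeff (jacR \<mu> i j) r * (b * s) ^ r * b ^ (i - r) = b ^ i * (coeff (jacR \<mu> i j) r * s ^ r)"
    by (simp add: power_mult_distrib)
qed

text \<open>The substitution u = b (1 + t)/2 leads to the Jacobi inner product on [-1, 1]. The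
  exponent of b collects i + i' from homogenization, j from the power of u, \<mu> - 1/2 from the
  weight and 1 from du.\<close>

lemma jacR_inner:
  assumes mu: "\<mu> \<ge> 0" and b: "b > 0"
  shows "(\<integral>u. (if 0 \<le> u \<and> u < b then Hj \<mu> i j u b * Hj \<mu> i' j u b * u ^ j * (b - u) powr (\<mu> - 1/2)
      else 0) \<partial>lborel) =
    (if i = i' then b powr (real (2 * i + j) + \<mu> + 1/2) * Beta (real j + 1) (\<mu> + 1/2) else 0)"
proof -
  let ?f = "\<lambda>u. if 0 \<le> u \<and> u < b then Hj \<mu> i j u b * Hj \<mu> i' j u b * u ^ j * (b - u) powr (\<mu> -
      1/2) else 0"
  let ?\<alpha> = "\<mu> - 1/2" and ?\<beta> = "real j"
  let ?p = "\<lambda>i. jacobi_orthonormal i ?\<alpha> ?\<beta>"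
  have ab: "?\<alpha> > -1" "?\<beta> > -1" using mu by auto
  interpret poly_weight "\<lambda>t. (1 - t) powr ?\<alpha> * (1 + t) powr ?\<beta>" by (rule poly_weight_jacobi[OF ab])
  let ?g = "\<lambda>t. indicator {-1..1} t *\<^sub>R (poly (?p i * ?p i') t * ((1 - t) powr ?\<alpha> * (1 + t) powr ?\<beta>))"
  have gm: "?g \<in> borel_measurable lborel"
  proof -
    have "poly (?p i * ?p i') \<in> borel_measurable borel"
      by (intro borel_measurable_continuous_onI continuous_intros)
    then show ?thesis by measurable
  qed
  define c where "c = b ^ (i + i') * ((b/2) ^ j * (b/2) powr ?\<alpha>)"
  \<comment> \<open>The equality can fail at t = -1: for j = 0 the left side contains
    \<open>0 ^ 0 = 1\<close>, the right side \<open>0 powr 0 = 0\<close>.\<close>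
  have ae: "AE t in lborel. ?f (b/2 + b/2 * t) = c * ?g t"
  proof -
    have ae: "AE t in lborel. t \<noteq> (c::real)" for c by (simp add: AE_lborel_singleton)
    show ?thesis using ae[of 1] ae[of "-1"]
    proof eventually_elim
      case (elim t)
      have u: "b/2 + b/2 * t = b * ((1 + t) / 2)" by (simp add: field_simps)
      show ?case
      proof (cases "-1 < t \<and> t < 1")
        case True
        then have r: "0 \<le> b * ((1 + t) / 2)" "b * ((1 + t) / 2) < b" using b by (auto simp:
            mult_less_cancel_left_pos)
        have "b - b * ((1 + t) / 2) = b / 2 * (1 - t)" by (simp add: field_simps)
        then have 1: "(b - b * ((1 + t) / 2)) powr ?\<alpha> = (b/2) powr ?\<alpha> * (1 - t) powr ?\<alpha>"
          using True b by (simp only: powr_mult)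
        have 2: "(b * ((1 + t) / 2)) ^ j = (b/2) ^ j * (1 + t) powr ?\<beta>"
          using True by (simp add: powr_realpow power_mult_distrib[symmetric])
        have 3: "2 * ((1 + t) / 2) - 1 = t" by (simp add: field_simps)
        show ?thesis unfolding u Hj_scale[OF mu] poly_jacR 1 2 3
          using r True by (simp add: c_def power_add)
      next
        case False
        then have n: "(0 \<le> b * ((1 + t) / 2) \<and> b * ((1 + t) / 2) < b) = False" using b elim
          by (auto simp: mult_less_cancel_left_pos zero_le_mult_iff)
        moreover have "?g t = 0" using False elim by (auto simp: indicator_def)
        ultimately show ?thesis unfolding u by (simp only: if_False mult_zero_right)
      qed
    qed
  qed
  have hm: "(\<lambda>u. Hj \<mu> i j u b * Hj \<mu> i' j u b * u ^ j) \<in> borel_measurable borel"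
    unfolding Hj_def by (intro borel_measurable_continuous_onI continuous_intros)
  have fm: "?f \<in> borel_measurable borel"
    using hm by measurable
  have fm': "(\<lambda>t. ?f (b/2 + b/2 * t)) \<in> borel_measurable lborel"
    using measurable_compose[of "\<lambda>t. b/2 + b/2 * t" borel borel, OF _ fm] by simp
  have "integral\<^sup>L lborel ?f = \<bar>b/2\<bar> *\<^sub>R (\<integral>t. ?f (b/2 + b/2 * t) \<partial>lborel)"
    using b by (intro lborel_integral_real_affine) simp
  also have "(\<integral>t. ?f (b/2 + b/2 * t) \<partial>lborel) = (\<integral>t. c * ?g t \<partial>lborel)"
    using ae fm' gm by (intro integral_cong_AE) auto
  also have "\<dots> = c * integral\<^sup>L lborel ?g" by simp
  also have "integral\<^sup>L lborel ?g = wint (?p i * ?p i')"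
    using gm by (simp add: wint_def set_lebesgue_integral_def integral_completion)
  also have "\<dots> = jacobi_inner ?\<alpha> ?\<beta> (?p i) (?p i') * (2 powr (?\<alpha> + ?\<beta> + 1) * Beta (?\<beta> + 1) (?\<alpha> + 1))"
    using Beta_real_pos[of "?\<beta> + 1" "?\<alpha> + 1"] mu by (simp add: jacobi_inner_wint[OF ab])
  also have "jacobi_inner ?\<alpha> ?\<beta> (?p i) (?p i') = (if i = i' then 1 else 0)"
  proof -
    have s: "jacobi_inner ?\<alpha> ?\<beta> p q = jacobi_inner ?\<alpha> ?\<beta> q p" for p q by (simp add:
        jacobi_inner_def mult_ac)
    consider "i = i'" | "i < i'" | "i' < i" by linarith
    then show ?thesis
    proof cases
      case 1
      then show ?thesis using jacobi_norm[OF ab] by simp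
    next
      case 2
      then show ?thesis using jacobi_orthogonal[OF ab, of "?p i" i'] jacobi_degree[OF ab, of i] s
          by simp
    next
      case 3
      then show ?thesis using jacobi_orthogonal[OF ab, of "?p i'" i] jacobi_degree[OF ab, of i'] by simp
    qed
  qed
  also have "\<bar>b/2\<bar> *\<^sub>R (c * ((if i = i' then 1 else 0) * (2 powr (?\<alpha> + ?\<beta> + 1) * Beta (?\<beta> + 1) (?\<alpha>
      + 1))))
    = (if i = i' then b powr (real (2 * i + j) + \<mu> + 1/2) * Beta (real j + 1) (\<mu> + 1/2) else 0)"
  proof (cases "i = i'")
    case True
    have "b / 2 * ((b/2) ^ j * (b/2) powr ?\<alpha>) = (b/2) powr (?\<alpha> + ?\<beta> + 1)"
    proof -
      have "(b/2) powr (?\<alpha> + ?\<beta> + 1) = (b/2) powr ?\<alpha> * (b/2) powr ?\<beta> * (b/2) powr 1" by (simp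
          only: powr_add)
      moreover have "(b/2) powr ?\<beta> = (b/2) ^ j" "(b/2) powr 1 = b/2" using b by (simp_all add:
          powr_realpow)
      ultimately show ?thesis by (simp only: mult_ac)
    qed
    moreover have "b ^ (i + i) * b powr (?\<alpha> + ?\<beta> + 1) = b powr (real (2 * i + j) + \<mu> + 1/2)"
    proof -
      have "b ^ (i + i) = b powr (real (i + i))" using b by (simp only: powr_realpow)
      moreover have "real (i + i) + (?\<alpha> + ?\<beta> + 1) = real (2 * i + j) + \<mu> + 1/2" by simp
      ultimately show ?thesis by (metis powr_add)
    qed
    moreover have "(b/2) powr (?\<alpha> + ?\<beta> + 1) * 2 powr (?\<alpha> + ?\<beta> + 1) = b powr (?\<alpha> + ?\<beta> + 1)"
      using b by (simp add: powr_mult[symmetric])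
    moreover have "?\<alpha> + 1 = \<mu> + 1/2" by simp
    moreover have "\<bar>b/2\<bar> *\<^sub>R (c * ((if i = i' then 1 else 0) * (2 powr (?\<alpha> + ?\<beta> + 1) * Beta (?\<beta> +
        1) (?\<alpha> + 1))))
       = b ^ (i + i) * (b / 2 * ((b/2) ^ j * (b/2) powr ?\<alpha>) * 2 powr (?\<alpha> + ?\<beta> + 1)) * Beta (?\<beta> +
           1) (?\<alpha> + 1)"
      using b True by (simp only: c_def real_scaleR_def abs_of_pos half_gt_zero_iff if_True mult_1
          mult_ac simp_thms)
    ultimately show ?thesis by (simp only: True if_True simp_thms)
  qed simp
  finally show ?thesis .
qed

text \<open>The disk polynomial \<open>P\<^sub>i\<^sub>,\<^sub>\<epsilon>\<^sup>k\<close> on the disks \<open>x\<^sub>3 = const\<close>, homogenized by \<open>1 - x\<^sub>3\<^sup>2\<close>.\<close>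

definition disk_hom :: "real \<Rightarrow> nat \<Rightarrow> nat \<Rightarrow> nat \<Rightarrow> real^3 \<Rightarrow> real" where
  "disk_hom \<mu> k i \<epsilon> x = disk_h \<mu> i k * Hj \<mu> i (k - 2 * i) (rho2 x) (1 - (x$3)\<^sup>2) * Zf (k - 2 * i) \<epsilon> x"

text \<open>Integrating the square of \<open>disk_hom\<close> over the slice at height w leaves a
  multiple of \<open>(1 - w^2) powr (k + \<mu> + 1/2)\<close>. This is the Gegenbauer weight of
  parameter k + \<mu> + 1, hence the family of the last factor.\<close>

fun ball_E :: "real \<Rightarrow> nat \<times> nat \<times> nat \<times> nat \<Rightarrow> real^3 \<Rightarrow> real" where
  "ball_E \<mu> (l, k, i, \<epsilon>) x = sqrt (ball_h_sq \<mu> k) * disk_hom \<mu> k i \<epsilon> x * poly (gegN (real k + \<mu> +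
      1) (l - k)) (x$3)"

definition ball_ix :: "nat \<Rightarrow> (nat \<times> nat \<times> nat \<times> nat) set" where
  "ball_ix l = {l} \<times> (SIGMA k:{..l}. disk_indices k)"

definition ball_IX :: "nat \<Rightarrow> (nat \<times> nat \<times> nat \<times> nat) set" where
  "ball_IX n = (\<Union>l\<in>{..n}. ball_ix l)"

lemma finite_disk_indices: "finite (disk_indices k)"
  by (rule finite_subset[of _ "{..k} \<times> {0, 1}"]) (auto simp: disk_indices_def)

lemma finite_ball_ix: "finite (ball_ix l)"
  unfolding ball_ix_def by (intro finite_cartesian_product finite_SigmaI finite_disk_indices) auto

lemma finite_ball_IX: "finite (ball_IX n)"
  unfolding ball_IX_def by (simp add: finite_ball_ix)

lemma ball_IX_iff: "(l, k, i, \<epsilon>) \<in> ball_IX n \<longleftrightarrow> l \<le> n \<and> k \<le> l \<and> \<epsilon> \<in> {0, 1} \<and> 2 * i + \<epsilon> \<le> k"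
  by (auto simp: ball_IX_def ball_ix_def disk_indices_def)

lemma polys3_Hj: "(\<lambda>x. Hj \<mu> i j (rho2 x) (1 - (x$3)\<^sup>2)) \<in> polys3_le (2 * i)"
  unfolding Hj_def
proof (intro polys3_sum)
  fix r assume r: "r \<in> {..i}"
  have b: "(\<lambda>x. 1 - (x$3)\<^sup>2) \<in> polys3_le 2"
    using polys3_diff[OF polys3_const[of 1 2], of "\<lambda>x. (x$3)\<^sup>2"] polys3_power[OF polys3_coord(3),
        of 2] by simp
  have "(\<lambda>x. coeff (jacR \<mu> i j) r * (rho2 x ^ r * (1 - (x$3)\<^sup>2) ^ (i - r))) \<in> polys3_le (r * 2 +
      (i - r) * 2)"
    by (intro polys3_cmult polys3_mult polys3_power polys3_rho2 b)
  also have "r * 2 + (i - r) * 2 = 2 * i" using r by auto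
  finally show "(\<lambda>x. coeff (jacR \<mu> i j) r * rho2 x ^ r * (1 - (x$3)\<^sup>2) ^ (i - r)) \<in> polys3_le (2 * i)"
    by (simp add: mult.assoc)
qed

lemma polys3_disk_hom:
  assumes "2 * i \<le> k" shows "disk_hom \<mu> k i \<epsilon> \<in> polys3_le k"
proof -
  have "(\<lambda>x. disk_h \<mu> i k * (Hj \<mu> i (k - 2 * i) (rho2 x) (1 - (x$3)\<^sup>2) * Zf (k - 2 * i) \<epsilon> x)) \<in>
      polys3_le (2 * i + (k - 2 * i))"
    by (intro polys3_cmult polys3_mult polys3_Hj polys3_Zf)
  also have "2 * i + (k - 2 * i) = k" using assms by simp
  also have "(\<lambda>x. disk_h \<mu> i k * (Hj \<mu> i (k - 2 * i) (rho2 x) (1 - (x$3)\<^sup>2) * Zf (k - 2 * i) \<epsilon> x))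
      = disk_hom \<mu> k i \<epsilon>"
    by (auto simp: disk_hom_def mult.assoc)
  finally show ?thesis .
qed

lemma polys3_ball_E:
  assumes "\<mu> \<ge> 0" "2 * i + \<epsilon> \<le> k" "k \<le> l"
  shows "ball_E \<mu> (l, k, i, \<epsilon>) \<in> polys3_le l"
proof -
  have "(\<lambda>x. sqrt (ball_h_sq \<mu> k) * (disk_hom \<mu> k i \<epsilon> x * poly (gegN (real k + \<mu> + 1) (l - k))
      (x$3))) \<in> polys3_le (k + (l - k))"
    using assms degree_gegN[of "real k + \<mu> + 1" "l - k"]
    by (intro polys3_cmult polys3_mult polys3_disk_hom polys3_poly) auto
  also have "k + (l - k) = l" using assms by simp
  also have "(\<lambda>x. sqrt (ball_h_sq \<mu> k) * (disk_hom \<mu> k i \<epsilon> x * poly (gegN (real k + \<mu> + 1) (l -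
      k)) (x$3))) = ball_E \<mu> (l, k, i, \<epsilon>)"
    by (auto simp: mult.assoc)
  finally show ?thesis .
qed

lemma bint_basis:
  assumes mu: "\<mu> \<ge> 0"
  shows "bint \<mu> (\<lambda>x. (Hj \<mu> i j (rho2 x) (1 - (x$3)\<^sup>2) * Hj \<mu> i' j (rho2 x) (1 - (x$3)\<^sup>2)) * (poly
      p (x$3) * poly q (x$3)) * rho2 x ^ j)
    = (if i = i' then pi * Beta (real j + 1) (\<mu> + 1/2) * gegint (real (2 * i + j) + \<mu> + 1) (p * q)
        else 0)"
proof -
  let ?A = "\<lambda>u w. (Hj \<mu> i j u (1 - w\<^sup>2) * Hj \<mu> i' j u (1 - w\<^sup>2)) * (poly p w * poly q w) * u ^ j"
  let ?K = "real (2 * i + j) + \<mu> + 1"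
  have cont: "continuous_on UNIV (\<lambda>(u, w). ?A u w)"
    unfolding Hj_def split_beta by (intro continuous_intros)
  have inner: "(\<integral>u. (if 0 \<le> u \<and> u < 1 - w\<^sup>2 then ?A u w * (1 - w\<^sup>2 - u) powr (\<mu> - 1/2) else 0)
      \<partial>lborel) =
     (if i = i' then Beta (real j + 1) (\<mu> + 1/2) * (indicator {-1..1} w *\<^sub>R (poly (p * q) w * gegw
         ?K w)) else 0)" for w
  proof (cases "1 - w\<^sup>2 > 0")
    case True
    have "w \<in> {-1..1}" using True by (auto simp: abs_square_less_1 abs_less_iff)
    have "(\<integral>u. (if 0 \<le> u \<and> u < 1 - w\<^sup>2 then ?A u w * (1 - w\<^sup>2 - u) powr (\<mu> - 1/2) else 0) \<partial>lborel)
      = (\<integral>u. poly (p * q) w * (if 0 \<le> u \<and> u < 1 - w\<^sup>2 then Hj \<mu> i j u (1 - w\<^sup>2) * Hj \<mu> i' j u (1 -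
          w\<^sup>2) * u ^ j * (1 - w\<^sup>2 - u) powr (\<mu> - 1/2) else 0) \<partial>lborel)"
      by (intro Bochner_Integration.integral_cong refl) auto
    also have "\<dots> = poly (p * q) w * (if i = i' then (1 - w\<^sup>2) powr (real (2 * i + j) + \<mu> + 1/2) *
        Beta (real j + 1) (\<mu> + 1/2) else 0)"
      by (subst integral_mult_right_zero, subst jacR_inner[OF mu True]) simp
    also have "(1 - w\<^sup>2) powr (real (2 * i + j) + \<mu> + 1/2) = gegw ?K w"
      unfolding gegw_def by (rule arg_cong[where f = "\<lambda>e. (1 - w\<^sup>2) powr e"]) simp
    finally show ?thesis using \<open>w \<in> {-1..1}\<close> by simp
  next
    case False
    have n: "(0 \<le> u \<and> u < 1 - w\<^sup>2) = False" for u using False by auto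
    have g0: "indicator {-1..1} w *\<^sub>R (poly (p * q) w * gegw ?K w) = 0"
      using gegw_eq_0[of w ?K] False by (cases "w \<in> {-1..1}") auto
    show ?thesis unfolding n g0 by simp
  qed
  have "bint \<mu> (\<lambda>x. ?A (rho2 x) (x$3)) = pi * (\<integral>w. (if i = i' then Beta (real j + 1) (\<mu> + 1/2) *
      (indicator {-1..1} w *\<^sub>R (poly (p * q) w * gegw ?K w)) else 0) \<partial>lborel)"
    by (subst bint_radial[OF mu cont]) (simp only: inner)
  also have "\<dots> = (if i = i' then pi * Beta (real j + 1) (\<mu> + 1/2) * gegint ?K (p * q) else 0)"
  proof (cases "i = i'")
    case True
    show ?thesis unfolding True gegint_lborel by (simp only: if_True refl integral_mult_right_zero
        mult.assoc)
  qed simp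
  finally show ?thesis .
qed

text \<open>Every Gamma value occurs once above and once below: \<open>ball_h_sq\<close> balances
  \<open>gegmass\<close>, \<open>disk_h\<close> balances the Beta value, and
  \<open>ball_const\<close> what is left. The factor 1 or 1/2 is the mean of a squared cosine or
  sine and equals \<open>disk_d i k\<close>.\<close>

lemma ball_norm_constant:
  assumes mu: "\<mu> \<ge> 0" and ik: "2 * i \<le> k"
  shows "ball_const \<mu> * (ball_h_sq \<mu> k * (disk_h \<mu> i k)\<^sup>2 * ((if k - 2 * i = 0 then 1 else 1/2) *
     (pi * Beta (real (k - 2 * i) + 1) (\<mu> + 1/2) * gegmass (real k + \<mu> + 1)))) = 1"
proof -
  define j where "j = k - 2 * i"
  define G1 G2 G3 G4 G5 G6 G7 where "G1 = Gamma (\<mu> + 2)" and "G2 = Gamma (\<mu> + 1/2)" and "G3 =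
      Gamma (\<mu> + 3/2)"
    and "G4 = Gamma (real j + \<mu> + 3/2)" and "G5 = Gamma (real j + 1)"
    and "G6 = Gamma (\<mu> + 2 + real k)" and "G7 = Gamma (\<mu> + 3/2 + real k)"
  have pos: "G1 > 0" "G2 > 0" "G3 > 0" "G4 > 0" "G5 > 0" "G6 > 0" "G7 > 0"
    using mu by (auto simp: G1_def G2_def G3_def G4_def G5_def G6_def G7_def intro!: Gamma_real_pos)
  define d where "d = disk_d i k"
  have d: "d > 0" "(if k - 2 * i = 0 then 1 else 1/2) = d" using ik by (auto simp: disk_d_def d_def)
  have np: "\<mu> + 2 \<notin> \<int>\<^sub>\<le>\<^sub>0" "\<mu> + 3/2 \<notin> \<int>\<^sub>\<le>\<^sub>0"
    using mu nonpos_Ints_nonpos[of "\<mu> + 2"] nonpos_Ints_nonpos[of "\<mu> + 3/2"] by linarith+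
  have 1: "ball_h_sq \<mu> k = (G6 / G1) / (G7 / G3)"
    unfolding ball_h_sq_def G1_def G3_def G6_def G7_def using np by (simp add: pochhammer_Gamma)
  have 2: "(disk_h \<mu> i k)\<^sup>2 = 1 / d * (G4 / (G3 * G5))"
    unfolding disk_h_def d_def[symmetric] j_def[symmetric] G3_def[symmetric] G4_def[symmetric]
        G5_def[symmetric]
    using pos d by (intro real_sqrt_pow2) auto
  have e: "real j + 1 + (\<mu> + 1/2) = real j + \<mu> + 3/2" by simp
  have 3: "Beta (real (k - 2 * i) + 1) (\<mu> + 1/2) = G5 * G2 / G4"
    unfolding Beta_def j_def[symmetric] e G2_def G4_def G5_def ..
  have e: "real k + \<mu> + 1 + 1/2 = \<mu> + 3/2 + real k" "real k + \<mu> + 1 + 1 = \<mu> + 2 + real k" by simp_all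
  have 4: "gegmass (real k + \<mu> + 1) = sqrt pi * G7 / G6"
    unfolding gegmass_def e G6_def G7_def ..
  have "pi powr (3/2) = pi powr (1 + 1/2)" by simp
  then have p: "pi powr (3/2) = pi * sqrt pi" by (simp only: powr_add) (simp add: powr_half_sqrt)
  have 5: "ball_const \<mu> = G1 / (pi * sqrt pi * G2)" unfolding ball_const_def p G1_def G2_def ..
  have "sqrt pi > 0" by simp
  then show ?thesis unfolding 1 2 3 4 5 d(2) using pos d(1) pi_gt_zero by simp
qed

lemma ball_h_sq_pos: "\<mu> \<ge> 0 \<Longrightarrow> ball_h_sq \<mu> k > 0"
  by (simp add: ball_h_sq_def pochhammer_pos)

text \<open>The order of separation matters. Gegenbauer factors belonging to different k have
  different parameters and are not orthogonal to each other; they are compared only after the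
  angular integral has forced equal j and the Jacobi integral equal i, which makes k equal.\<close>

lemma ball_E_orthonormal:
  assumes mu: "\<mu> \<ge> 0"
    and s: "s \<in> ball_IX n" and t: "t \<in> ball_IX n"
  shows "ball_inner \<mu> (ball_E \<mu> s) (ball_E \<mu> t) = (if s = t then 1 else 0)"
proof -
  obtain l k i \<epsilon> where s': "s = (l, k, i, \<epsilon>)" by (cases s)
  obtain l' k' i' \<epsilon>' where t': "t = (l', k', i', \<epsilon>')" by (cases t)
  have sx: "k \<le> l" "\<epsilon> \<in> {0, 1}" "2 * i + \<epsilon> \<le> k" using s by (auto simp: s' ball_IX_iff)
  have tx: "k' \<le> l'" "\<epsilon>' \<in> {0, 1}" "2 * i' + \<epsilon>' \<le> k'" using t by (auto simp: t' ball_IX_iff)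
  define j j' where "j = k - 2 * i" and "j' = k' - 2 * i'"
  have kj: "k = 2 * i + j" "k' = 2 * i' + j'" "\<epsilon> \<le> j" "\<epsilon>' \<le> j'" using sx tx by (auto simp: j_def j'_def)
  define C where "C = sqrt (ball_h_sq \<mu> k) * disk_h \<mu> i k * (sqrt (ball_h_sq \<mu> k') * disk_h \<mu> i' k')"
  define p q where "p = gegN (real k + \<mu> + 1) (l - k)" and "q = gegN (real k' + \<mu> + 1) (l' - k')"
  let ?a = "\<lambda>x. (Hj \<mu> i j (rho2 x) (1 - (x$3)\<^sup>2) * Hj \<mu> i' j' (rho2 x) (1 - (x$3)\<^sup>2)) * (poly p
      (x$3) * poly q (x$3))"
  have a: "continuous_on UNIV ?a" "\<And>\<theta> x. ?a (rot3 \<theta> x) = ?a x"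
    unfolding Hj_def by (intro continuous_intros continuous_rho2) simp
  have "(\<lambda>x. ball_E \<mu> s x * ball_E \<mu> t x) = (\<lambda>x. C * (?a x * (Zf j \<epsilon> x * Zf j' \<epsilon>' x)))"
    unfolding s' t' ball_E.simps disk_hom_def C_def p_def q_def j_def j'_def by (simp add: mult_ac)
  then have e: "ball_inner \<mu> (ball_E \<mu> s) (ball_E \<mu> t) = ball_const \<mu> * (C * bint \<mu> (\<lambda>x. ?a x *
      (Zf j \<epsilon> x * Zf j' \<epsilon>' x)))"
    unfolding ball_inner_bint by (simp only: bint_cmult)
  show ?thesis
  proof (cases "j = j' \<and> \<epsilon> = \<epsilon>'")
    case False
    then have "s \<noteq> t" by (auto simp: s' t' j_def j'_def)
    then show ?thesis unfolding e bint_angular[OF mu a sx(2) tx(2) kj(3,4)]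
      by (simp only: False if_False mult_zero_right)
  next
    case jj: True
    have e2: "ball_inner \<mu> (ball_E \<mu> s) (ball_E \<mu> t) = ball_const \<mu> * (C * ((if j = 0 then 1 else 1/2) *
      (if i = i' then pi * Beta (real j + 1) (\<mu> + 1/2) * gegint (real (2 * i + j) + \<mu> + 1) (p * q)
          else 0)))"
      unfolding e bint_angular[OF mu a sx(2) tx(2) kj(3,4)] using jj bint_basis[OF mu, of i j i' p
          q] by simp
    show ?thesis
    proof (cases "i = i'")
      case False
      then show ?thesis unfolding e2 by (simp add: s' t')
    next
      case True
      then have kk: "k = k'" using kj jj by simp
      have K: "real k + \<mu> + 1 > 0" using mu by simp
      have g: "gegint (real (2 * i + j) + \<mu> + 1) (p * q) = (if l - k = l' - k' then gegmass (real
          k + \<mu> + 1) else 0)"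
        unfolding kj(1)[symmetric] p_def q_def kk[symmetric] by (rule gegN_orthonormal[OF K])
      have st: "s = t \<longleftrightarrow> l - k = l' - k'" using True kk jj sx tx by (auto simp: s' t')
      have C: "C = ball_h_sq \<mu> k * (disk_h \<mu> i k)\<^sup>2"
        unfolding C_def kk[symmetric] True[symmetric] using ball_h_sq_pos[OF mu, of k] by (simp
            add: power2_eq_square mult_ac)
      have "ball_const \<mu> * (C * ((if j = 0 then 1 else 1/2) * (pi * Beta (real j + 1) (\<mu> + 1/2) *
          gegmass (real k + \<mu> + 1)))) = 1"
        unfolding C j_def by (rule ball_norm_constant[OF mu]) (use sx in simp)
      then show ?thesis unfolding e2 g st using True by simp
    qed
  qed
qed

section \<open>The basis spans all polynomials\<close>

definition ball_span :: "real \<Rightarrow> nat \<Rightarrow> (real^3 \<Rightarrow> real) set" where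
  "ball_span \<mu> n = {P. \<exists>c. P = (\<lambda>x. \<Sum>t\<in>ball_IX n. c t * ball_E \<mu> t x)}"

lemma ball_span_add:
  assumes "P \<in> ball_span \<mu> n" "Q \<in> ball_span \<mu> n"
  shows "(\<lambda>x. P x + Q x) \<in> ball_span \<mu> n"
proof -
  from assms obtain a b where "P = (\<lambda>x. \<Sum>t\<in>ball_IX n. a t * ball_E \<mu> t x)" "Q = (\<lambda>x. \<Sum>t\<in>ball_IX n.
      b t * ball_E \<mu> t x)"
    unfolding ball_span_def by auto
  then have "(\<lambda>x. P x + Q x) = (\<lambda>x. \<Sum>t\<in>ball_IX n. (a t + b t) * ball_E \<mu> t x)"
    by (simp add: sum.distrib[symmetric] distrib_right)
  then show ?thesis unfolding ball_span_def by auto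
qed

lemma ball_span_cmult:
  assumes "P \<in> ball_span \<mu> n"
  shows "(\<lambda>x. c * P x) \<in> ball_span \<mu> n"
proof -
  from assms obtain a where "P = (\<lambda>x. \<Sum>t\<in>ball_IX n. a t * ball_E \<mu> t x)"
    unfolding ball_span_def by auto
  then have "(\<lambda>x. c * P x) = (\<lambda>x. \<Sum>t\<in>ball_IX n. (c * a t) * ball_E \<mu> t x)"
    by (simp add: sum_distrib_left mult.assoc)
  then show ?thesis unfolding ball_span_def by (auto intro!: exI[of _ "\<lambda>t. c * a t"])
qed

lemma ball_span_0 [simp]: "(\<lambda>x. 0) \<in> ball_span \<mu> n"
  unfolding ball_span_def by (auto intro!: exI[of _ "\<lambda>t. 0"])

lemma ball_span_sum:
  assumes "\<And>a. a \<in> A \<Longrightarrow> P a \<in> ball_span \<mu> n"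
  shows "(\<lambda>x. \<Sum>a\<in>A. P a x) \<in> ball_span \<mu> n"
  using assms by (induction A rule: infinite_finite_induct) (auto intro: ball_span_add)

lemma ball_span_diff:
  "P \<in> ball_span \<mu> n \<Longrightarrow> Q \<in> ball_span \<mu> n \<Longrightarrow> (\<lambda>x. P x - Q x) \<in> ball_span \<mu> n"
  using ball_span_add[of P \<mu> n "\<lambda>x. (-1) * Q x"] ball_span_cmult[of Q \<mu> n "-1"] by simp

lemma ball_span_E:
  assumes "t \<in> ball_IX n" shows "ball_E \<mu> t \<in> ball_span \<mu> n"
proof -
  have "ball_E \<mu> t = (\<lambda>x. \<Sum>s\<in>ball_IX n. (if s = t then 1 else 0) * ball_E \<mu> s x)"
  proof
    fix x
    have "(\<Sum>s\<in>ball_IX n. (if s = t then 1 else 0) * ball_E \<mu> s x) = (\<Sum>s\<in>ball_IX n. if s = t then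
        ball_E \<mu> t x else 0)"
      by (intro sum.cong refl) auto
    then show "ball_E \<mu> t x = (\<Sum>s\<in>ball_IX n. (if s = t then 1 else 0) * ball_E \<mu> s x)"
      using assms by (simp add: finite_ball_IX)
  qed
  then show ?thesis unfolding ball_span_def by (intro CollectI exI[of _ "\<lambda>s. if s = t then 1 else 0"])
qed

lemma disk_h_pos: "\<mu> \<ge> 0 \<Longrightarrow> disk_h \<mu> i k > 0"
  by (auto simp: disk_h_def disk_d_def intro!: divide_pos_pos mult_pos_pos Gamma_real_pos)

lemma ball_span_disk_hom:
  assumes mu: "\<mu> \<ge> 0" and ix: "(i, \<epsilon>) \<in> disk_indices k" and q: "degree q + k \<le> n"
  shows "(\<lambda>x. poly q (x$3) * disk_hom \<mu> k i \<epsilon> x) \<in> ball_span \<mu> n"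
proof (rule poly_degree_induct[where P = "\<lambda>q. (\<lambda>x. poly q (x$3) * disk_hom \<mu> k i \<epsilon> x) \<in> ball_span \<mu> n"
      and B = "gegN (real k + \<mu> + 1)" and k = "n - k"])
  have K: "real k + \<mu> + 1 > 0" using mu by simp
  show "degree (gegN (real k + \<mu> + 1) m) = m \<and> gegN (real k + \<mu> + 1) m \<noteq> 0" for m
    using degree_gegN[OF K] gegN_nonzero[OF K] by blast
  show "(\<lambda>x. poly (p + q) (x$3) * disk_hom \<mu> k i \<epsilon> x) \<in> ball_span \<mu> n"
    if "(\<lambda>x. poly p (x$3) * disk_hom \<mu> k i \<epsilon> x) \<in> ball_span \<mu> n" "(\<lambda>x. poly q (x$3) * disk_hom \<mu> k
        i \<epsilon> x) \<in> ball_span \<mu> n" for p q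
    using ball_span_add[OF that] by (simp add: distrib_right)
  show "(\<lambda>x. poly (smult c (gegN (real k + \<mu> + 1) m)) (x$3) * disk_hom \<mu> k i \<epsilon> x) \<in> ball_span \<mu> n"
      if m: "m \<le> n - k" for c m
  proof -
    have "(k + m, k, i, \<epsilon>) \<in> ball_IX n" using m q ix by (auto simp: ball_IX_iff disk_indices_def)
    then have "(\<lambda>x. (c / sqrt (ball_h_sq \<mu> k)) * ball_E \<mu> (k + m, k, i, \<epsilon>) x) \<in> ball_span \<mu> n"
      by (intro ball_span_cmult ball_span_E)
    then show ?thesis using ball_h_sq_pos[OF mu, of k] by (simp add: mult_ac)
  qed
  show "degree q \<le> n - k" using q by simp
qed simp

text \<open>Since the leading coefficient of \<open>jacR\<close> is nonzero, the definition of
  \<open>disk_hom\<close> can be solved for its highest power of \<open>rho2\<close>. The remaining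
  terms have lower powers of \<open>rho2\<close>, with powers of \<open>1 - x$3^2\<close> absorbed
  into q, so the weighted degree does not grow.\<close>

lemma ball_span_rho2_Zf:
  assumes mu: "\<mu> \<ge> 0" and e: "\<epsilon> \<in> {0, 1}"
  shows "degree q + 2 * i + j \<le> n \<Longrightarrow> (\<lambda>x. poly q (x$3) * rho2 x ^ i * Zf j \<epsilon> x) \<in> ball_span \<mu> n"
proof (induction i arbitrary: q rule: less_induct)
  case (less i)
  show ?case
  proof (cases "\<epsilon> \<le> j")
    case False
    then have "j = 0" "\<epsilon> = 1" using e by auto
    then have "Zf j \<epsilon> = (\<lambda>x. 0)" by (simp add: Zf_0 fun_eq_iff)
    then show ?thesis by simp
  next
    case True
    define k where "k = 2 * i + j"
    have ix: "(i, \<epsilon>) \<in> disk_indices k" using e True by (auto simp: disk_indices_def k_def)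
    define a where "a r = coeff (jacR \<mu> i j) r" for r
    define h where "h = disk_h \<mu> i k"
    have nz: "a i \<noteq> 0" "h \<noteq> 0" using jacR_lead[OF mu] disk_h_pos[OF mu, of i k] by (auto simp:
        a_def h_def)
    have 1: "(\<lambda>x. poly q (x$3) * disk_hom \<mu> k i \<epsilon> x) \<in> ball_span \<mu> n"
      by (rule ball_span_disk_hom[OF mu ix]) (use less.prems in \<open>simp add: k_def\<close>)
    let ?q = "\<lambda>r. q * [:1, 0, -1:] ^ (i - r)"
    have 2: "(\<lambda>x. \<Sum>r<i. (a r / a i) * (poly (?q r) (x$3) * rho2 x ^ r * Zf j \<epsilon> x)) \<in> ball_span \<mu> n"
    proof (intro ball_span_sum ball_span_cmult)
      fix r assume r: "r \<in> {..<i}"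
      have "degree (?q r) \<le> degree q + (i - r) * 2"
        by (rule order_trans[OF degree_mult_le], rule add_left_mono, rule order_trans[OF
            degree_power_le]) simp
      then show "(\<lambda>x. poly (?q r) (x$3) * rho2 x ^ r * Zf j \<epsilon> x) \<in> ball_span \<mu> n"
        using r less.prems by (intro less.IH) auto
    qed
    have "poly q (x$3) * rho2 x ^ i * Zf j \<epsilon> x = (1 / (a i * h)) * (poly q (x$3) * disk_hom \<mu> k i \<epsilon> x)
      - (\<Sum>r<i. (a r / a i) * (poly (?q r) (x$3) * rho2 x ^ r * Zf j \<epsilon> x))" for x
    proof -
      have p2: "poly [:1, 0, -1:] (x$3) = 1 - (x$3)\<^sup>2" by (simp add: power2_eq_square)
      have kj: "k - 2 * i = j" by (simp add: k_def)
      have "(1 / (a i * h)) * (poly q (x$3) * disk_hom \<mu> k i \<epsilon> x) =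
        (\<Sum>r\<le>i. (a r / a i) * (poly (?q r) (x$3) * rho2 x ^ r * Zf j \<epsilon> x))"
        unfolding disk_hom_def Hj_def kj a_def[symmetric] h_def[symmetric] sum_distrib_left
            sum_distrib_right poly_mult poly_power p2
        using nz by (intro sum.cong refl) simp
      also have "\<dots> = (\<Sum>r<i. (a r / a i) * (poly (?q r) (x$3) * rho2 x ^ r * Zf j \<epsilon> x)) + poly q
          (x$3) * rho2 x ^ i * Zf j \<epsilon> x"
        using nz by (simp add: lessThan_Suc_atMost[symmetric])
      finally show ?thesis by simp
    qed
    then show ?thesis using ball_span_diff[OF ball_span_cmult[OF 1, of "1 / (a i * h)"] 2] by simp
  qed
qed

text \<open>Each factor \<open>x$1\<close> or \<open>x$2\<close> is absorbed into the harmonic by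
  \<open>Zf_coord_mult\<close>, which raises j by one or lowers it by one while raising i. The
  quantity 2 i + j + a + b is unchanged. For j = 0 the coordinate itself is the harmonic of
  frequency 1.\<close>

lemma ball_span_coords:
  assumes mu: "\<mu> \<ge> 0"
  shows "\<epsilon> \<in> {0, 1} \<Longrightarrow> degree q + 2 * i + j + a + b \<le> n \<Longrightarrow>
    (\<lambda>x. poly q (x$3) * rho2 x ^ i * Zf j \<epsilon> x * (x$1) ^ a * (x$2) ^ b) \<in> ball_span \<mu> n"
proof (induction "a + b" arbitrary: a b i j \<epsilon>)
  case 0
  then show ?case using ball_span_rho2_Zf[OF mu, of \<epsilon> q i j n] by simp
next
  case (Suc m)
  let ?F = "\<lambda>i j \<epsilon> a b x. poly q (x$3) * rho2 x ^ i * Zf j \<epsilon> x * (x$1) ^ a * (x$2) ^ b"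
  show ?case
  proof (cases a)
    case (Suc a')
    have m: "m = a' + b" using Suc \<open>Suc m = a + b\<close> by simp
    show ?thesis
    proof (cases j)
      case 0
      show ?thesis
      proof (cases "\<epsilon> = 0")
        case True
        have "?F i j \<epsilon> a b = ?F i 1 0 a' b"
          by (auto simp: Suc 0 True Zf_def zc_def fun_eq_iff)
        moreover have "?F i 1 0 a' b \<in> ball_span \<mu> n"
          by (rule Suc.hyps(1)[OF m]) (use Suc.prems Suc 0 in auto)
        ultimately show ?thesis by simp
      qed (simp add: 0 Zf_0)
    next
      case (Suc j')
      have eq: "?F i j \<epsilon> a b = (\<lambda>x. (1/2) * ?F i (Suc (Suc j')) \<epsilon> a' b x + (1/2) * ?F (Suc i) j' \<epsilon>
          a' b x)"
      proof
        fix x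
        have "?F i j \<epsilon> a b x = poly q (x$3) * rho2 x ^ i * (x$1 * Zf (Suc j') \<epsilon> x) * (x$1) ^ a' *
            (x$2) ^ b"
          by (simp add: \<open>a = Suc a'\<close> Suc mult_ac)
        then show "?F i j \<epsilon> a b x = (1/2) * ?F i (Suc (Suc j')) \<epsilon> a' b x + (1/2) * ?F (Suc i) j' \<epsilon>
            a' b x"
          unfolding Zf_coord_mult by (simp add: field_simps)
      qed
      have "?F i (Suc (Suc j')) \<epsilon> a' b \<in> ball_span \<mu> n" "?F (Suc i) j' \<epsilon> a' b \<in> ball_span \<mu> n"
        by (rule Suc.hyps(1)[OF m]; use Suc.prems Suc \<open>a = Suc a'\<close> in auto)+
      then show ?thesis unfolding eq by (intro ball_span_add ball_span_cmult)
    qed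
  next
    case a0: 0
    then obtain b' where b': "b = Suc b'" using \<open>Suc m = a + b\<close> by (cases b) auto
    have m: "m = a + b'" using b' \<open>Suc m = a + b\<close> by simp
    show ?thesis
    proof (cases j)
      case 0
      show ?thesis
      proof (cases "\<epsilon> = 0")
        case True
        have "?F i j \<epsilon> a b = ?F i 1 1 a b'"
          by (auto simp: b' 0 True Zf_def zc_def fun_eq_iff)
        moreover have "?F i 1 1 a b' \<in> ball_span \<mu> n"
          by (rule Suc.hyps(1)[OF m]) (use Suc.prems b' 0 in auto)
        ultimately show ?thesis by simp
      qed (simp add: 0 Zf_0)
    next
      case (Suc j')
      have mem: "?F i (Suc (Suc j')) e a b' \<in> ball_span \<mu> n" "?F (Suc i) j' e a b' \<in> ball_span \<mu>
          n" if "e \<in> {0, 1}" for e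
        by (rule Suc.hyps(1)[OF m]; use Suc.prems Suc b' that in auto)+
      have e: "?F i j \<epsilon> a b x = poly q (x$3) * rho2 x ^ i * (x$2 * Zf (Suc j') \<epsilon> x) * (x$1) ^ a *
          (x$2) ^ b'" for x
        by (simp add: b' Suc mult_ac)
      from Suc.prems(1) consider "\<epsilon> = 0" | "\<epsilon> = 1" by auto
      then show ?thesis
      proof cases
        case 1
        have eq: "?F i j \<epsilon> a b = (\<lambda>x. (1/2) * ?F i (Suc (Suc j')) 1 a b' x - (1/2) * ?F (Suc i) j'
            1 a b' x)"
          unfolding e unfolding 1 Zf_coord_mult by (simp add: field_simps fun_eq_iff)
        show ?thesis unfolding eq by (intro ball_span_diff ball_span_cmult mem) simp_all
      next
        case 2
        have eq: "?F i j \<epsilon> a b = (\<lambda>x. (1/2) * ?F (Suc i) j' 0 a b' x - (1/2) * ?F i (Suc (Suc j'))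
            0 a b' x)"
          unfolding e unfolding 2 Zf_coord_mult by (simp add: field_simps fun_eq_iff)
        show ?thesis unfolding eq by (intro ball_span_diff ball_span_cmult mem) simp_all
      qed
    qed
  qed
qed

lemma polys3_ball_span:
  assumes mu: "\<mu> \<ge> 0" and P: "P \<in> polys3_le n"
  shows "P \<in> ball_span \<mu> n"
proof -
  obtain c where P: "P = (\<lambda>x. \<Sum>p \<in> exponents n. c p * mon3 p x)"
    by (rule polys3E[OF P])
  show ?thesis unfolding P
  proof (intro ball_span_sum ball_span_cmult)
    fix p assume p: "p \<in> exponents n"
    have "(\<lambda>x. poly (monom 1 (snd (snd p))) (x$3) * rho2 x ^ 0 * Zf 0 0 x * (x$1) ^ fst p * (x$2)
        ^ fst (snd p)) \<in> ball_span \<mu> n"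
      by (rule ball_span_coords[OF mu]) (use p in \<open>auto simp: degree_monom_eq\<close>)
    then show "(\<lambda>x. (x$1)^fst p * (x$2)^fst (snd p) * (x$3)^snd (snd p)) \<in> ball_span \<mu> n"
      by (simp add: Zf_0 poly_monom mult_ac)
  qed
qed

section \<open>The orthogonal projections\<close>

text \<open>The weight has finite mass and \<bar>f\<bar> is at most \<open>f^2 + 1\<close>.\<close>

lemma ball_L2_integrable:
  assumes mu: "\<mu> \<ge> 0" and f: "f \<in> ball_L2 \<mu>"
  shows "integrable lebesgue (\<lambda>x. f x * bw \<mu> x)"
proof (rule Bochner_Integration.integrable_bound)
  have "integrable lebesgue (\<lambda>x. (f x)\<^sup>2 * bw \<mu> x)"
    using f by (simp add: ball_L2_def set_integrable_def bw_def mult_ac)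
  moreover have b: "integrable lebesgue (bw \<mu>)" using bw_integrable[OF mu] by (simp add:
      integrable_completion)
  ultimately show "integrable lebesgue (\<lambda>x. (f x)\<^sup>2 * bw \<mu> x + bw \<mu> x)" by simp
  have "(\<lambda>x. (indicator (cball 0 1) x *\<^sub>R f x) * bw \<mu> x) \<in> borel_measurable lebesgue"
    using f b by (intro borel_measurable_times) (auto simp: ball_L2_def set_borel_measurable_def)
  moreover have "(\<lambda>x. (indicator (cball 0 1) x *\<^sub>R f x) * bw \<mu> x) = (\<lambda>x. f x * bw \<mu> x)"
    by (auto simp: bw_def indicator_def)
  ultimately show "(\<lambda>x. f x * bw \<mu> x) \<in> borel_measurable lebesgue" by simp
  show "AE x in lebesgue. norm (f x * bw \<mu> x) \<le> norm ((f x)\<^sup>2 * bw \<mu> x + bw \<mu> x)"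
  proof (intro AE_I2)
    fix x
    have "\<bar>f x\<bar> \<le> (f x)\<^sup>2 + 1"
      using zero_le_power2[of "\<bar>f x\<bar> - 1"] abs_ge_zero[of "f x"] by (simp add: power2_diff) 
    then have "\<bar>f x\<bar> * bw \<mu> x \<le> ((f x)\<^sup>2 + 1) * bw \<mu> x" using bw_nonneg by (intro mult_right_mono)
    then show "norm (f x * bw \<mu> x) \<le> norm ((f x)\<^sup>2 * bw \<mu> x + bw \<mu> x)"
      using bw_nonneg[of \<mu> x] by (simp add: abs_mult distrib_right)
  qed
qed

lemma ball_inner_sum_right:
  assumes f: "integrable lebesgue (\<lambda>x. f x * bw \<mu> x)" and g: "\<And>t. t \<in> A \<Longrightarrow> continuous_on UNIV (g t)"
  shows "ball_inner \<mu> f (\<lambda>x. \<Sum>t\<in>A. c t * g t x) = (\<Sum>t\<in>A. c t * ball_inner \<mu> f (g t))"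
proof -
  have "bint \<mu> (\<lambda>x. f x * (\<Sum>t\<in>A. c t * g t x)) = bint \<mu> (\<lambda>x. \<Sum>t\<in>A. c t * (f x * g t x))"
    by (simp add: sum_distrib_left mult_ac)
  also have "\<dots> = (\<Sum>t\<in>A. bint \<mu> (\<lambda>x. c t * (f x * g t x)))"
  proof (rule bint_sum)
    fix t assume "t \<in> A"
    from integrable_mult_bw[OF f g[OF this]]
    show "integrable lebesgue (\<lambda>x. c t * (f x * g t x) * bw \<mu> x)" by (simp add: mult.assoc)
  qed
  finally show ?thesis unfolding ball_inner_bint by (simp add: bint_cmult sum_distrib_left mult_ac)
qed

lemma ball_inner_commute: "ball_inner \<mu> f g = ball_inner \<mu> g f"
  by (simp add: ball_inner_bint mult.commute)

lemma ball_const_pos: "\<mu> \<ge> 0 \<Longrightarrow> ball_const \<mu> > 0"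
  by (auto simp: ball_const_def intro!: divide_pos_pos mult_pos_pos Gamma_real_pos)

context
  fixes \<mu> :: real
  assumes mu: "\<mu> \<ge> 0"
begin

lemma ball_E_polys: "t \<in> ball_IX n \<Longrightarrow> ball_E \<mu> t \<in> polys3_le (fst t)"
  by (cases t) (auto simp: ball_IX_iff intro!: polys3_ball_E[OF mu])

lemma ball_E_continuous: "t \<in> ball_IX n \<Longrightarrow> continuous_on UNIV (ball_E \<mu> t)"
  using polys3_continuous ball_E_polys by blast

lemma ball_expansion:
  assumes P: "P \<in> polys3_le n"
  shows "P = (\<lambda>x. \<Sum>t\<in>ball_IX n. ball_inner \<mu> P (ball_E \<mu> t) * ball_E \<mu> t x)"
proof -
  obtain c where c: "P = (\<lambda>x. \<Sum>t\<in>ball_IX n. c t * ball_E \<mu> t x)"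
    using polys3_ball_span[OF mu P] unfolding ball_span_def by blast
  have "ball_inner \<mu> P (ball_E \<mu> s) = c s" if s: "s \<in> ball_IX n" for s
  proof -
    have "ball_inner \<mu> (ball_E \<mu> s) P = (\<Sum>t\<in>ball_IX n. c t * ball_inner \<mu> (ball_E \<mu> s) (ball_E \<mu> t))"
      unfolding c by (intro ball_inner_sum_right ball_E_continuous integrable_polys3_bw[OF mu
          ball_E_polys[OF s]])
    also have "\<dots> = (\<Sum>t\<in>ball_IX n. if t = s then c s else 0)"
      by (intro sum.cong refl) (use ball_E_orthonormal[OF mu s] in auto)
    also have "\<dots> = c s" using s by (simp add: finite_ball_IX)
    finally show ?thesis by (simp add: ball_inner_commute)
  qed
  then show ?thesis by (subst (1) c) (simp cong: sum.cong)
qed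

lemma ball_ix_IX: "t \<in> ball_ix l \<Longrightarrow> l \<le> n \<Longrightarrow> t \<in> ball_IX n"
  by (auto simp: ball_IX_def)

lemma ball_E_orth_lower:
  assumes t: "t \<in> ball_ix l" and "d < l" and Q: "Q \<in> polys3_le d"
  shows "ball_inner \<mu> (ball_E \<mu> t) Q = 0"
proof -
  have t': "t \<in> ball_IX l" by (rule ball_ix_IX[OF t]) simp
  have "ball_inner \<mu> (ball_E \<mu> t) Q = (\<Sum>s\<in>ball_IX d. ball_inner \<mu> Q (ball_E \<mu> s) * ball_inner \<mu>
      (ball_E \<mu> t) (ball_E \<mu> s))"
    by (subst ball_expansion[OF Q]) (intro ball_inner_sum_right ball_E_continuous
        integrable_polys3_bw[OF mu ball_E_polys[OF t']])
  also have "\<dots> = 0"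
  proof (intro sum.neutral ballI)
    fix s assume s: "s \<in> ball_IX d"
    then have "s \<in> ball_IX l" using \<open>d < l\<close> by (auto simp: ball_IX_def)
    moreover have "s \<noteq> t" using s t \<open>d < l\<close> by (auto simp: ball_IX_def ball_ix_def)
    ultimately show "ball_inner \<mu> Q (ball_E \<mu> s) * ball_inner \<mu> (ball_E \<mu> t) (ball_E \<mu> s) = 0"
      using ball_E_orthonormal[OF mu t'] by simp
  qed
  finally show ?thesis .
qed

text \<open>The degree is exactly l unless P is zero: a P of lower degree would be among its own
  test polynomials and have norm 0.\<close>

lemma ball_VI:
  assumes P: "P \<in> polys3_le l" and o: "\<And>d Q. d < l \<Longrightarrow> Q \<in> polys3_le d \<Longrightarrow> ball_inner \<mu> P Q = 0"
  shows "P \<in> ball_V \<mu> l"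
proof -
  have "P = (\<lambda>x. 0)" if "P \<in> polys3_le d" "d < l" for d
  proof (rule polys3_bint_definite[OF mu P])
    show "bint \<mu> (\<lambda>x. P x * P x) = 0"
      using o[OF that(2,1)] ball_const_pos[OF mu] by (simp add: ball_inner_bint)
  qed
  then show ?thesis using P o unfolding ball_V_def has_degree3_def by blast
qed

lemma ball_V_expansion:
  assumes "P \<in> ball_V \<mu> l"
  shows "P = (\<lambda>x. \<Sum>t\<in>ball_ix l. ball_inner \<mu> P (ball_E \<mu> t) * ball_E \<mu> t x)"
proof -
  have P: "P \<in> polys3_le l" and o: "\<And>d Q. d < l \<Longrightarrow> Q \<in> polys3_le d \<Longrightarrow> ball_inner \<mu> P Q = 0"
    using assms by (auto simp: ball_V_def has_degree3_def)
  have "(\<Sum>t\<in>ball_IX l. ball_inner \<mu> P (ball_E \<mu> t) * ball_E \<mu> t x) = (\<Sum>t\<in>ball_ix l. ball_inner \<mu> P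
      (ball_E \<mu> t) * ball_E \<mu> t x)" for x
  proof (rule sum.mono_neutral_right[OF finite_ball_IX])
    show "ball_ix l \<subseteq> ball_IX l" by (auto intro: ball_ix_IX)
    show "\<forall>t\<in>ball_IX l - ball_ix l. ball_inner \<mu> P (ball_E \<mu> t) * ball_E \<mu> t x = 0"
    proof
      fix t assume t: "t \<in> ball_IX l - ball_ix l"
      then have "fst t < l" by (auto simp: ball_IX_def ball_ix_def order.strict_iff_order)
      then have "ball_inner \<mu> P (ball_E \<mu> t) = 0" using o[OF _ ball_E_polys[of t l]] t by blast
      then show "ball_inner \<mu> P (ball_E \<mu> t) * ball_E \<mu> t x = 0" by simp
    qed
  qed
  then show ?thesis using ball_expansion[OF P] by simp
qed

lemma ball_E_V: "t \<in> ball_ix l \<Longrightarrow> ball_E \<mu> t \<in> ball_V \<mu> l"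
  using ball_E_polys[OF ball_ix_IX[of t l l]] ball_E_orth_lower
  by (intro ball_VI) (auto simp: ball_ix_def)

text \<open>The sum has the same inner products with the basis of degree l as f, and by
  \<open>ball_V_expansion\<close> these determine the inner products with all of
  \<open>ball_V \<mu> l\<close>. For uniqueness, the basis elements are themselves admissible test
  functions, so they fix the coefficients of any competitor.\<close>

lemma ball_proj_eq:
  assumes f: "f \<in> ball_L2 \<mu>"
  shows "ball_proj \<mu> l f = (\<lambda>x. \<Sum>t\<in>ball_ix l. ball_inner \<mu> f (ball_E \<mu> t) * ball_E \<mu> t x)"
proof -
  let ?P = "\<lambda>x. \<Sum>t\<in>ball_ix l. ball_inner \<mu> f (ball_E \<mu> t) * ball_E \<mu> t x"
  have fi: "integrable lebesgue (\<lambda>x. f x * bw \<mu> x)" by (rule ball_L2_integrable[OF mu f])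
  have ix: "t \<in> ball_ix l \<Longrightarrow> t \<in> ball_IX l" for t by (rule ball_ix_IX) auto
  have Epoly: "t \<in> ball_ix l \<Longrightarrow> ball_E \<mu> t \<in> polys3_le l" for t
    using ball_E_polys[OF ix] by (auto simp: ball_ix_def)
  have Ec: "t \<in> ball_ix l \<Longrightarrow> continuous_on UNIV (ball_E \<mu> t)" for t
    using ball_E_continuous[OF ix] .
  have diff: "ball_inner \<mu> (\<lambda>x. f x - P x) Q = ball_inner \<mu> f Q - ball_inner \<mu> P Q"
    if "P \<in> polys3_le l" "continuous_on UNIV Q" for P Q
  proof -
    have "integrable lebesgue (\<lambda>x. f x * Q x * bw \<mu> x)" "integrable lebesgue (\<lambda>x. P x * Q x * bw \<mu> x)"
      by (rule integrable_mult_bw[OF fi that(2)], rule integrable_mult_bw[OF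
          integrable_polys3_bw[OF mu that(1)] that(2)])
    then show ?thesis unfolding ball_inner_bint bint_def
      by (simp add: left_diff_distrib right_diff_distrib)
  qed
  have Pp: "?P \<in> polys3_le l" by (intro polys3_sum polys3_cmult Epoly)
  have PV: "?P \<in> ball_V \<mu> l"
  proof (rule ball_VI[OF Pp])
    fix d Q assume dQ: "d < l" "Q \<in> polys3_le d"
    have "ball_inner \<mu> Q ?P = (\<Sum>t\<in>ball_ix l. ball_inner \<mu> f (ball_E \<mu> t) * ball_inner \<mu> Q (ball_E \<mu> t))"
      by (intro ball_inner_sum_right Ec integrable_polys3_bw[OF mu dQ(2)])
    also have "\<dots> = 0"
      by (intro sum.neutral ballI) (simp add: ball_inner_commute[of \<mu> Q] ball_E_orth_lower[OF _ dQ])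
    finally show "ball_inner \<mu> ?P Q = 0" by (simp add: ball_inner_commute)
  qed
  have PE: "ball_inner \<mu> ?P (ball_E \<mu> s) = ball_inner \<mu> f (ball_E \<mu> s)" if s: "s \<in> ball_ix l" for s
  proof -
    have "ball_inner \<mu> (ball_E \<mu> s) ?P = (\<Sum>t\<in>ball_ix l. ball_inner \<mu> f (ball_E \<mu> t) * ball_inner \<mu>
        (ball_E \<mu> s) (ball_E \<mu> t))"
      by (intro ball_inner_sum_right Ec integrable_polys3_bw[OF mu Epoly] s)
    also have "\<dots> = (\<Sum>t\<in>ball_ix l. if t = s then ball_inner \<mu> f (ball_E \<mu> s) else 0)"
      by (intro sum.cong refl) (use ball_E_orthonormal[OF mu ix[OF s] ix] in auto)
    also have "\<dots> = ball_inner \<mu> f (ball_E \<mu> s)" using s by (simp add: finite_ball_ix)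
    finally show ?thesis by (simp add: ball_inner_commute)
  qed
  show ?thesis unfolding ball_proj_def
  proof (rule the_equality, intro conjI ballI)
    show "?P \<in> ball_V \<mu> l" by (rule PV)
    fix Q assume Q: "Q \<in> ball_V \<mu> l"
    then have Qp: "Q \<in> polys3_le l" by (auto simp: ball_V_def has_degree3_def)
    have "ball_inner \<mu> g Q = (\<Sum>t\<in>ball_ix l. ball_inner \<mu> Q (ball_E \<mu> t) * ball_inner \<mu> g (ball_E \<mu> t))"
      if "integrable lebesgue (\<lambda>x. g x * bw \<mu> x)" for g
      by (subst ball_V_expansion[OF Q]) (intro ball_inner_sum_right Ec that)
    from this[OF fi] this[OF integrable_polys3_bw[OF mu Pp]]
    have "ball_inner \<mu> f Q = ball_inner \<mu> ?P Q" using PE by simp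
    then show "ball_inner \<mu> (\<lambda>x. f x - ?P x) Q = 0"
      using diff[OF Pp polys3_continuous[OF Qp]] by simp
  next
    fix P assume P: "P \<in> ball_V \<mu> l \<and> (\<forall>Q\<in>ball_V \<mu> l. ball_inner \<mu> (\<lambda>x. f x - P x) Q = 0)"
    then have Pp': "P \<in> polys3_le l" by (auto simp: ball_V_def has_degree3_def)
    have "ball_inner \<mu> P (ball_E \<mu> t) = ball_inner \<mu> f (ball_E \<mu> t)" if t: "t \<in> ball_ix l" for t
      using P ball_E_V[OF t] diff[OF Pp' Ec[OF t]] by auto
    then show "P = ?P" using ball_V_expansion[of P l] P by (auto cong: sum.cong)
  qed
qed

end

section \<open>Zonal functions\<close>

text \<open>The Chebyshev polynomial made homogeneous with u of degree 1 and b of degree 2, so that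
  b can be \<open>1 - w^2\<close> without square roots.\<close>

fun chebhom :: "nat \<Rightarrow> real \<Rightarrow> real \<Rightarrow> real" where
  "chebhom 0 u b = 1"
| "chebhom (Suc 0) u b = u"
| "chebhom (Suc (Suc n)) u b = 2 * u * chebhom (Suc n) u b - b * chebhom n u b"

lemma chebhom_scale: "chebhom n (\<beta> * t) (\<beta>\<^sup>2) = \<beta> ^ n * poly (cheb n) t"
  by (induction n rule: cheb.induct) (simp_all add: algebra_simps power2_eq_square)

text \<open>By \<open>zon_scale\<close> below this is \<open>(1 - w\<^sup>2)\<^bsup>k/2\<^esup> C\<^sub>k\<^sup>\<kappa>(t / (1 - w\<^sup>2)\<^bsup>1/2\<^esup>)\<close>, written as a polynomial in \<open>t\<close> and \<open>w\<close>.\<close>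

definition zon :: "real \<Rightarrow> nat \<Rightarrow> real \<Rightarrow> real \<Rightarrow> real" where
  "zon \<kappa> k w t = (\<Sum>i\<le>k. gegcoef \<kappa> k i * ((1 - w\<^sup>2) ^ min i (k - i) * chebhom (nat \<bar>int k - 2 * int
      i\<bar>) t (1 - w\<^sup>2)))"

lemma zon_scale:
  assumes "\<beta>\<^sup>2 = 1 - w\<^sup>2"
  shows "zon \<kappa> k w (\<beta> * t) = \<beta> ^ k * poly (gegR \<kappa> k) t"
  unfolding zon_def gegR_def poly_sum sum_distrib_left assms[symmetric] chebhom_scale
proof (intro sum.cong refl)
  fix i assume i: "i \<in> {..k}"
  have "2 * min i (k - i) + nat \<bar>int k - 2 * int i\<bar> = k" using i by (auto simp: min_def)
  then have "(\<beta>\<^sup>2) ^ min i (k - i) * \<beta> ^ nat \<bar>int k - 2 * int i\<bar> = \<beta> ^ k"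
    by (simp add: power_mult[symmetric] power_add[symmetric])
  then show "gegcoef \<kappa> k i * ((\<beta>\<^sup>2) ^ min i (k - i) * (\<beta> ^ nat \<bar>int k - 2 * int i\<bar> * poly (cheb
      (nat \<bar>int k - 2 * int i\<bar>)) t)) =
     \<beta> ^ k * poly (smult (gegcoef \<kappa> k i) (cheb (nat \<bar>int k - 2 * int i\<bar>))) t"
    by (simp add: mult.assoc[symmetric])
qed

definition Zon :: "real \<Rightarrow> nat \<Rightarrow> real^3 \<Rightarrow> real" where
  "Zon \<kappa> k x = zon \<kappa> k (x$3) (x$1)"

lemma polys3_one_minus: "(\<lambda>x. 1 - (x$3)\<^sup>2) \<in> polys3_le 2"
  using polys3_diff[OF polys3_const[of 1 2], of "\<lambda>x. (x$3)\<^sup>2"] polys3_power[OF polys3_coord(3), of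
      2] by simp

lemma polys3_chebhom:
  assumes "P \<in> polys3_le 1"
  shows "(\<lambda>x. chebhom n (P x) (1 - (x$3)\<^sup>2)) \<in> polys3_le n"
proof (induction n rule: cheb.induct)
  case (3 n)
  have "(\<lambda>x. 2 * (P x * chebhom (Suc n) (P x) (1 - (x$3)\<^sup>2))) \<in> polys3_le (1 + Suc n)"
    by (intro polys3_cmult polys3_mult assms 3)
  moreover have "(\<lambda>x. (1 - (x$3)\<^sup>2) * chebhom n (P x) (1 - (x$3)\<^sup>2)) \<in> polys3_le (2 + n)"
    by (intro polys3_mult polys3_one_minus 3)
  ultimately have "(\<lambda>x. 2 * (P x * chebhom (Suc n) (P x) (1 - (x$3)\<^sup>2)) - (1 - (x$3)\<^sup>2) * chebhom
      n (P x) (1 - (x$3)\<^sup>2)) \<in> polys3_le (Suc (Suc n))"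
    by (intro polys3_diff) simp_all
  then show ?case by (simp add: mult.assoc)
qed (use assms in simp_all)

lemma polys3_Zon_rot3: "(\<lambda>x. Zon \<kappa> k (rot3 \<theta> x)) \<in> polys3_le k"
  unfolding Zon_def zon_def rot3_nth
proof (intro polys3_sum polys3_cmult)
  fix i assume i: "i \<in> {..k}"
  have P: "(\<lambda>x. x$1 * cos \<theta> - x$2 * sin \<theta>) \<in> polys3_le 1"
    using polys3_diff[OF polys3_cmult[OF polys3_coord(1)] polys3_cmult[OF polys3_coord(2)], of
        "cos \<theta>" "sin \<theta>"]
    by (simp add: mult.commute)
  have "(\<lambda>x. (1 - (x$3)\<^sup>2) ^ min i (k - i) * chebhom (nat \<bar>int k - 2 * int i\<bar>) (x$1 * cos \<theta> - x$2
      * sin \<theta>) (1 - (x$3)\<^sup>2))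
      \<in> polys3_le (min i (k - i) * 2 + nat \<bar>int k - 2 * int i\<bar>)"
    by (intro polys3_mult polys3_power polys3_one_minus polys3_chebhom P)
  also have "min i (k - i) * 2 + nat \<bar>int k - 2 * int i\<bar> = k" using i by (auto simp: min_def)
  finally show "(\<lambda>x. (1 - (x$3)\<^sup>2) ^ min i (k - i) * chebhom (nat \<bar>int k - 2 * int i\<bar>) (x$1 * cos
      \<theta> - x$2 * sin \<theta>) (1 - (x$3)\<^sup>2))
      \<in> polys3_le k" .
qed

lemma rot3_0 [simp]: "rot3 0 x = x"
  by (simp add: vec_eq_iff forall_3)

lemma polys3_Zon: "Zon \<kappa> k \<in> polys3_le k"
  using polys3_Zon_rot3[of \<kappa> k 0] by simp

text \<open>Applying \<open>gegint_gegL\<close> to monomials gives a recursion for the moments in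
  steps of two; the odd chain starts from the value 0.\<close>

lemma gegint_monom_odd:
  assumes k: "\<kappa> > -1/2" and "odd c"
  shows "gegint \<kappa> (monom 1 c) = 0"
proof -
  interpret poly_weight "gegw \<kappa>" by (rule poly_weight_gegw[OF k])
  \<comment> \<open>At m = 0 the truncated exponent m - 1 is harmless because of the factor
    m.\<close>
  have rec: "(2 * \<kappa> + 1 + real m) * gegint \<kappa> (monom 1 (m + 1)) = real m * gegint \<kappa> (monom 1 (m -
      1))" for m
  proof -
    have "gegL \<kappa> (monom 1 m) = smult (2 * \<kappa> + 1 + real m) (monom 1 (m + 1)) - smult (real m)
        (monom 1 (m - 1))"
    proof (rule poly_ext)
      fix x
      show "poly (gegL \<kappa> (monom 1 m)) x = poly (smult (2 * \<kappa> + 1 + real m) (monom 1 (m + 1)) -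
          smult (real m) (monom 1 (m - 1))) x"
        by (cases m) (simp_all add: gegL_def pderiv_monom poly_monom algebra_simps)
    qed
    then show ?thesis using gegint_gegL[OF k, of "monom 1 m"] by (simp add: gegint_wint[OF k]
        wint_diff wint_smult)
  qed
  have nz: "2 * \<kappa> + 1 + real m \<noteq> 0" for m using k by linarith
  have "gegint \<kappa> (monom 1 (2 * d + 1)) = 0" for d
  proof (induction d)
    case 0
    then show ?case using rec[of 0] nz[of 0] by simp
  next
    case (Suc d)
    then show ?case using rec[of "2 * d + 2"] nz[of "2 * d + 2"] by simp
  qed
  then show ?thesis using \<open>odd c\<close> by (metis oddE)
qed

lemma gegint_shift_power: "gegint (\<kappa> + real d) p = gegint \<kappa> ([:1, 0, -1:] ^ d * p)"
proof (induction d arbitrary: p)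
  case (Suc d)
  have "gegint (\<kappa> + real (Suc d)) p = gegint ((\<kappa> + real d) + 1) p" by (simp add: add_ac)
  also have "\<dots> = gegint \<kappa> ([:1, 0, -1:] ^ d * ([:1, 0, -1:] * p))" unfolding gegint_shift Suc ..
  finally show ?case by (simp only: power_Suc mult_ac)
qed simp

text \<open>Odd powers of \<open>x$2\<close> integrate to 0 along chords. For c = 2 d the chord
  integral leaves the power \<mu> + d of the squared half length; after scaling t this is the
  Gegenbauer weight of \<mu> + 1/2 times \<open>(1 - t^2)^d\<close>, and \<open>zon\<close> becomes
  a multiple of \<open>gegR\<close>. So \<open>gegR\<close> is tested against a polynomial of degree
  at most 2 d + a, which is less than k.\<close>

lemma bint_Zon_monomial:
  assumes mu: "\<mu> \<ge> 0" and ac: "a + c < k"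
  shows "bint \<mu> (\<lambda>x. Zon (\<mu> + 1/2) k x * (poly q (x$3) * (x$1) ^ a * (x$2) ^ c)) = 0"
proof -
  let ?\<kappa> = "\<mu> + 1/2"
  let ?g = "\<lambda>w t. zon ?\<kappa> k w t * (poly q w * t ^ a)"
  have k: "?\<kappa> > -1/2" "?\<kappa> > 0" using mu by auto
  have cont: "continuous_on UNIV (\<lambda>x::real^3. ?g (x$3) (x$1))"
    using polys3_continuous[OF polys3_Zon] unfolding Zon_def[abs_def] by (intro continuous_intros)
  have "bint \<mu> (\<lambda>x. ?g (x$3) (x$1) * (x$2) ^ c) = gegint \<mu> (monom 1 c) *
     (\<integral>w. (\<integral>t. (if t\<^sup>2 < 1 - w\<^sup>2 then ?g w t * (1 - w\<^sup>2 - t\<^sup>2) powr (\<mu> + real c / 2) else 0)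
         \<partial>lborel) \<partial>lborel)"
  proof (rule bint_fibre[OF mu])
    show "(\<lambda>x::real^3. ?g (x$3) (x$1)) \<in> borel_measurable borel" using cont by (rule
        borel_measurable_continuous_onI)
    show "integrable lborel (\<lambda>x::real^3. ?g (x$3) (x$1) * (x$2) ^ c * bw \<mu> x)"
      by (intro integrable_continuous_bw(2)[OF mu] continuous_intros cont)
  qed
  also have "\<dots> = 0"
  proof (cases "odd c")
    case True
    then show ?thesis using gegint_monom_odd[of \<mu> c] mu by simp
  next
    case False
    then obtain d where d: "c = 2 * d" by (auto elim: evenE)
    have "(\<integral>t. (if t\<^sup>2 < 1 - w\<^sup>2 then ?g w t * (1 - w\<^sup>2 - t\<^sup>2) powr (\<mu> + real c / 2) else 0)
        \<partial>lborel) = 0" for w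
    proof (cases "1 - w\<^sup>2 > 0")
      case True
      define \<beta> where "\<beta> = sqrt (1 - w\<^sup>2)"
      have b: "\<beta> > 0" "\<beta>\<^sup>2 = 1 - w\<^sup>2" using True by (auto simp: \<beta>_def)
      let ?F = "\<lambda>t. if t\<^sup>2 < 1 - w\<^sup>2 then ?g w t * (1 - w\<^sup>2 - t\<^sup>2) powr (\<mu> + real c / 2) else 0"
      let ?p = "gegR ?\<kappa> k * monom 1 a"
      let ?G = "\<lambda>t. indicator {-1..1} t *\<^sub>R (poly ?p t * gegw (?\<kappa> + real d) t)"
      define C where "C = \<beta> ^ k * poly q w * \<beta> ^ a * (\<beta>\<^sup>2) powr (\<mu> + real d)"
      have FG: "?F (0 + \<beta> * t) = C * ?G t" for t
      proof (cases "t\<^sup>2 < 1")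
        case True
        then have "\<bar>t\<bar> < 1" by (simp add: abs_square_less_1)
        have "1 - w\<^sup>2 - (\<beta> * t)\<^sup>2 = \<beta>\<^sup>2 * (1 - t\<^sup>2)" using b by (simp add: power_mult_distrib
            algebra_simps)
        then have 1: "(1 - w\<^sup>2 - (\<beta> * t)\<^sup>2) powr (\<mu> + real c / 2) = (\<beta>\<^sup>2) powr (\<mu> + real d) * (1 -
            t\<^sup>2) powr (\<mu> + real d)"
          using True by (simp add: d powr_mult)
        have "(\<beta> * t)\<^sup>2 < 1 - w\<^sup>2" using b True by (simp add: power_mult_distrib b(2)[symmetric])
        moreover have "gegw (?\<kappa> + real d) t = (1 - t\<^sup>2) powr (\<mu> + real d)" by (simp add: gegw_def)
        ultimately show ?thesis using \<open>\<bar>t\<bar> < 1\<close> unfolding add_0 1 zon_scale[OF b(2)]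
          by (simp add: C_def indicator_def abs_less_iff poly_monom power_mult_distrib)
      next
        case False
        then have "\<not> (\<beta> * t)\<^sup>2 < 1 - w\<^sup>2" using b by (simp add: power_mult_distrib b(2)[symmetric])
        moreover have "?G t = 0"
          using gegw_eq_0[OF _ False] by (cases "t \<in> {-1..1}") auto
        ultimately show ?thesis by simp
      qed
      have "integral\<^sup>L lborel ?F = \<bar>\<beta>\<bar> *\<^sub>R (\<integral>t. ?F (0 + \<beta> * t) \<partial>lborel)"
        by (rule lborel_integral_real_affine) (use b in simp)
      also have "(\<integral>t. ?F (0 + \<beta> * t) \<partial>lborel) = C * integral\<^sup>L lborel ?G" unfolding FG by simp
      also have "integral\<^sup>L lborel ?G = gegint (?\<kappa> + real d) ?p"
        by (rule gegint_lborel[symmetric])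
      also have "\<dots> = gegint ?\<kappa> (gegR ?\<kappa> k * ([:1, 0, -1:] ^ d * monom 1 a))"
        unfolding gegint_shift_power by (simp only: mult_ac)
      also have "\<dots> = 0"
      proof (rule geg_ode_orth[OF k(2) gegR_ode])
        have "degree ([:1, 0, -1:] ^ d * monom (1::real) a) \<le> 2 * d + a"
          by (rule order_trans[OF degree_mult_le], rule add_mono, rule order_trans[OF degree_power_le])
            (simp_all add: degree_monom_eq)
        then show "degree ([:1, 0, -1:] ^ d * monom (1::real) a) < k" using ac d by simp
      qed
      finally show ?thesis by simp
    next
      case False
      have "\<not> t\<^sup>2 < 1 - w\<^sup>2" for t using False zero_le_power2[of t] by linarith
      then have n: "(t\<^sup>2 < 1 - w\<^sup>2) = False" for t by blast
      show ?thesis unfolding n by simp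
    qed
    then show ?thesis by simp
  qed
  also have "(\<lambda>x::real^3. ?g (x$3) (x$1) * (x$2) ^ c) = (\<lambda>x. Zon ?\<kappa> k x * (poly q (x$3) * (x$1) ^
      a * (x$2) ^ c))"
    by (auto simp: Zon_def)
  finally show ?thesis .
qed

lemma bint_lincomb_0:
  assumes mu: "\<mu> \<ge> 0" and Z: "continuous_on UNIV Z" and F: "continuous_on UNIV F" "continuous_on UNIV G"
    and 0: "bint \<mu> (\<lambda>x. Z x * F x) = 0" "bint \<mu> (\<lambda>x. Z x * G x) = 0"
  shows "bint \<mu> (\<lambda>x. Z x * (a * F x + b * G x)) = 0"
proof -
  have "bint \<mu> (\<lambda>x. Z x * (a * F x + b * G x)) = bint \<mu> (\<lambda>x. a * (Z x * F x) + b * (Z x * G x))"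
    by (simp add: algebra_simps)
  also have "\<dots> = bint \<mu> (\<lambda>x. a * (Z x * F x)) + bint \<mu> (\<lambda>x. b * (Z x * G x))"
    by (intro bint_add integrable_continuous_bw(1)[OF mu] continuous_intros Z F)
  finally show ?thesis by (simp add: bint_cmult 0)
qed

text \<open>Powers of \<open>rho2\<close> and harmonics are expanded into coordinates one factor at
  a time, down to \<open>bint_Zon_monomial\<close>. Only the degree in the first two coordinates is
  bounded; q is arbitrary.\<close>

lemma bint_Zon_Zf:
  assumes mu: "\<mu> \<ge> 0"
  shows "2 * r + j + a + c < k \<Longrightarrow>
    bint \<mu> (\<lambda>x. Zon (\<mu> + 1/2) k x * (poly q (x$3) * rho2 x ^ r * Zf j \<epsilon> x * (x$1) ^ a * (x$2) ^ c)) = 0"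
proof (induction r arbitrary: a c)
  case 0
  have Zc: "continuous_on UNIV (Zon (\<mu> + 1/2) k)" by (rule polys3_continuous[OF polys3_Zon])
  let ?F = "\<lambda>j \<epsilon> a c x. poly q (x$3) * Zf j \<epsilon> x * (x$1) ^ a * (x$2) ^ c"
  have Fc: "continuous_on UNIV (?F j \<epsilon> a c)" for j \<epsilon> a c by (intro continuous_intros continuous_Zf)
  have "bint \<mu> (\<lambda>x. Zon (\<mu> + 1/2) k x * ?F j 0 a c x) = 0 \<and> bint \<mu> (\<lambda>x. Zon (\<mu> + 1/2) k x * ?F j 1
      a c x) = 0"
    if "j + a + c < k" for j a c using that
  proof (induction j arbitrary: a c)
    case 0
    then show ?case using bint_Zon_monomial[OF mu, of a c k q] by (simp add: Zf_0)
  next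
    case (Suc j)
    have e: "?F (Suc j) 0 a c x = 1 * ?F j 0 (Suc a) c x + (-1) * ?F j 1 a (Suc c) x"
      "?F (Suc j) 1 a c x = 1 * ?F j 1 (Suc a) c x + 1 * ?F j 0 a (Suc c) x" for x
      unfolding Zf_Suc by (simp_all add: algebra_simps)
    have l: "j + Suc a + c < k" "j + a + Suc c < k" using Suc.prems by auto
    show ?case unfolding e
      using Suc.IH[OF l(1)] Suc.IH[OF l(2)] by (intro conjI bint_lincomb_0[OF mu Zc Fc Fc]) blast+
  qed
  then have "bint \<mu> (\<lambda>x. Zon (\<mu> + 1/2) k x * ?F j \<epsilon> a c x) = 0"
    using 0 Zf_eps[of \<epsilon> j] by (cases "\<epsilon> = 0") simp_all
  then show ?case by simp
next
  case (Suc r)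
  have Zc: "continuous_on UNIV (Zon (\<mu> + 1/2) k)" by (rule polys3_continuous[OF polys3_Zon])
  let ?F = "\<lambda>r a c x. poly q (x$3) * rho2 x ^ r * Zf j \<epsilon> x * (x$1) ^ a * (x$2) ^ c"
  have Fc: "continuous_on UNIV (?F r a c)" for r a c by (intro continuous_intros continuous_Zf
      continuous_rho2)
  have e: "?F (Suc r) a c x = 1 * ?F r (Suc (Suc a)) c x + 1 * ?F r a (Suc (Suc c)) x" for x
    by (simp add: rho2_def[of x] power2_eq_square algebra_simps)
  show ?case unfolding e
    using Suc by (intro bint_lincomb_0[OF mu Zc Fc Fc] Suc.IH) auto
qed

lemma Zf_rot3:
  "Zf j 0 (rot3 \<theta> x) = cos (real j * \<theta>) * Zf j 0 x + (- sin (real j * \<theta>)) * Zf j 1 x"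
  "Zf j 1 (rot3 \<theta> x) = sin (real j * \<theta>) * Zf j 0 x + cos (real j * \<theta>) * Zf j 1 x"
  unfolding Zf_def zc_rot3 power_mult_distrib Complex.DeMoivre by simp_all

text \<open>Rotation invariance moves the angle from the ridge function to the basis element, where
  it merely mixes the two harmonics of one frequency. The Gegenbauer factor depends on
  \<open>x$3\<close> alone and therefore does not affect the degree that counts.\<close>

lemma bint_Zon_E:
  assumes mu: "\<mu> \<ge> 0" and t: "2 * i + \<epsilon> \<le> k'" "k' \<le> l" and k: "k' < k"
  shows "bint \<mu> (\<lambda>x. Zon (\<mu> + 1/2) k (rot3 (-\<theta>) x) * ball_E \<mu> (l, k', i, \<epsilon>) x) = 0"
proof -
  let ?Z = "Zon (\<mu> + 1/2) k" and ?E = "ball_E \<mu> (l, k', i, \<epsilon>)"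
  define j where "j = k' - 2 * i"
  define p where "p = gegN (real k' + \<mu> + 1) (l - k')"
  define C where "C = sqrt (ball_h_sq \<mu> k') * disk_h \<mu> i k'"
  have Zc: "continuous_on UNIV ?Z" by (rule polys3_continuous[OF polys3_Zon])
  have Ec: "continuous_on UNIV ?E" by (rule polys3_continuous[OF polys3_ball_E[OF mu t]])
  have "(\<lambda>x. ?Z (rot3 (-\<theta>) x) * ?E x) \<in> borel_measurable borel"
    by (intro borel_measurable_continuous_onI continuous_intros Ec polys3_continuous[OF
        polys3_Zon_rot3])
  from bint_rot3[OF this, of \<mu> \<theta>]
  have "bint \<mu> (\<lambda>x. ?Z (rot3 (-\<theta>) x) * ?E x) = bint \<mu> (\<lambda>x. ?Z x * ?E (rot3 \<theta> x))"
    by (simp only: rot3_inverse)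
  also have "(\<lambda>x. ?Z x * ?E (rot3 \<theta> x)) = (\<lambda>x. \<Sum>r\<le>i. (C * coeff (jacR \<mu> i j) r) *
     (?Z x * (poly (p * [:1, 0, -1:] ^ (i - r)) (x$3) * rho2 x ^ r * Zf j \<epsilon> (rot3 \<theta> x))))"
  proof
    fix x :: "real^3"
    have p2: "poly [:1, 0, -1:] (x$3) = 1 - (x$3)\<^sup>2" by (simp add: power2_eq_square)
    show "?Z x * ?E (rot3 \<theta> x) = (\<Sum>r\<le>i. (C * coeff (jacR \<mu> i j) r) *
     (?Z x * (poly (p * [:1, 0, -1:] ^ (i - r)) (x$3) * rho2 x ^ r * Zf j \<epsilon> (rot3 \<theta> x))))"
      unfolding ball_E.simps disk_hom_def Hj_def j_def[symmetric] p_def[symmetric] C_def rho2_rot3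
          rot3_nth
        sum_distrib_left sum_distrib_right poly_mult poly_power p2
      by (intro sum.cong refl) (simp only: mult_ac)
  qed
  also have "bint \<mu> \<dots> = (\<Sum>r\<le>i. bint \<mu> (\<lambda>x. (C * coeff (jacR \<mu> i j) r) *
     (?Z x * (poly (p * [:1, 0, -1:] ^ (i - r)) (x$3) * rho2 x ^ r * Zf j \<epsilon> (rot3 \<theta> x)))))"
  proof (rule bint_sum)
    have "continuous_on UNIV (rot3 \<theta>)" using orthogonal_rot3 orthogonal_transformation_linear
        linear_continuous_on linear_conv_bounded_linear by blast
    then have "continuous_on UNIV (\<lambda>x. Zf j \<epsilon> (rot3 \<theta> x))"
      using continuous_on_compose2[OF continuous_Zf] by blast
    then show "integrable lebesgue (\<lambda>x. (C * coeff (jacR \<mu> i j) r) *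
       (?Z x * (poly (p * [:1, 0, -1:] ^ (i - r)) (x$3) * rho2 x ^ r * Zf j \<epsilon> (rot3 \<theta> x))) * bw \<mu>
           x)" for r
      by (intro integrable_continuous_bw(1)[OF mu] continuous_intros Zc continuous_rho2)
  qed
  also have "\<dots> = 0"
  proof (intro sum.neutral ballI)
    fix r assume r: "r \<in> {..i}"
    let ?q = "p * [:1, 0, -1:] ^ (i - r)"
    have z: "bint \<mu> (\<lambda>x. ?Z x * (poly ?q (x$3) * rho2 x ^ r * Zf j e x)) = 0" for e
      using bint_Zon_Zf[OF mu, of r j 0 0 k ?q e] r t k by (simp add: j_def)
    have c: "continuous_on UNIV (\<lambda>x. poly ?q (x$3) * rho2 x ^ r * Zf j e x)" for e
      by (intro continuous_intros continuous_rho2 continuous_Zf)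
    have "bint \<mu> (\<lambda>x. ?Z x * (A * (poly ?q (x$3) * rho2 x ^ r * Zf j 0 x) + B * (poly ?q (x$3) *
        rho2 x ^ r * Zf j 1 x))) = 0" for A B
      by (rule bint_lincomb_0[OF mu Zc c c z z])
    then have "bint \<mu> (\<lambda>x. ?Z x * (poly ?q (x$3) * rho2 x ^ r * (A * Zf j 0 x + B * Zf j 1 x))) =
        0" for A B
      by (simp add: algebra_simps)
    then have "bint \<mu> (\<lambda>x. ?Z x * (poly ?q (x$3) * rho2 x ^ r * Zf j \<epsilon> (rot3 \<theta> x))) = 0"
      by (cases "\<epsilon> = 0") (simp_all only: Zf_eps[of \<epsilon>] Zf_rot3 not_False_eq_True)
    then show "bint \<mu> (\<lambda>x. (C * coeff (jacR \<mu> i j) r) * (?Z x * (poly ?q (x$3) * rho2 x ^ r * Zf j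
        \<epsilon> (rot3 \<theta> x)))) = 0"
      by (simp only: bint_cmult mult_zero_right)
  qed
  finally show ?thesis .
qed

text \<open>The ridge function is a polynomial of degree k, so it expands in basis elements with l
  \<le> k. Those with k' < k drop out by \<open>bint_Zon_E\<close>, leaving l = k' = k, where the
  Gegenbauer factor has degree 0 and equals 1.\<close>

lemma Zon_expansion_exists:
  assumes mu: "\<mu> \<ge> 0"
  shows "\<exists>c. \<forall>x. Zon (\<mu> + 1/2) k (rot3 (-\<theta>) x) = (\<Sum>p\<in>disk_indices k. c p * disk_hom \<mu> k (fst p)
      (snd p) x)"
proof -
  let ?Z = "\<lambda>x. Zon (\<mu> + 1/2) k (rot3 (-\<theta>) x)"
  let ?f = "\<lambda>p. (k, k, p) :: nat \<times> nat \<times> nat \<times> nat"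
  define c where "c t = ball_inner \<mu> ?Z (ball_E \<mu> t)" for t
  have "?Z x = (\<Sum>p\<in>disk_indices k. (c (?f p) * sqrt (ball_h_sq \<mu> k)) * disk_hom \<mu> k (fst p) (snd
      p) x)" for x
  proof -
    have "?Z x = (\<Sum>t\<in>ball_IX k. c t * ball_E \<mu> t x)"
      unfolding c_def by (rule fun_cong[OF ball_expansion[OF mu polys3_Zon_rot3]])
    also have "\<dots> = (\<Sum>t\<in>?f ` disk_indices k. c t * ball_E \<mu> t x)"
    proof (rule sum.mono_neutral_right[OF finite_ball_IX])
      show "?f ` disk_indices k \<subseteq> ball_IX k" by (auto simp: ball_IX_iff disk_indices_def)
      show "\<forall>t\<in>ball_IX k - ?f ` disk_indices k. c t * ball_E \<mu> t x = 0"
      proof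
        fix t assume t: "t \<in> ball_IX k - ?f ` disk_indices k"
        obtain l k' i \<epsilon> where t': "t = (l, k', i, \<epsilon>)" by (cases t)
        have "l \<le> k" "k' \<le> l" "2 * i + \<epsilon> \<le> k'" "\<epsilon> \<in> {0, 1}" using t by (auto simp: t' ball_IX_iff)
        moreover have "k' \<noteq> k"
        proof
          assume "k' = k"
          then have "t = ?f (i, \<epsilon>)" "(i, \<epsilon>) \<in> disk_indices k" using calculation by (auto simp: t'
              disk_indices_def)
          then show False using t by blast
        qed
        ultimately have "bint \<mu> (\<lambda>x. ?Z x * ball_E \<mu> t x) = 0" unfolding t' by (intro
            bint_Zon_E[OF mu]) auto
        then show "c t * ball_E \<mu> t x = 0" by (simp add: c_def ball_inner_bint)
      qed
    qed
    also have "\<dots> = (\<Sum>p\<in>disk_indices k. c (?f p) * ball_E \<mu> (?f p) x)"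
      by (subst sum.reindex) (auto simp: inj_on_def)
    also have "\<dots> = (\<Sum>p\<in>disk_indices k. (c (?f p) * sqrt (ball_h_sq \<mu> k)) * disk_hom \<mu> k (fst p)
        (snd p) x)"
    proof (intro sum.cong refl)
      fix p
      have "gegN (real k + \<mu> + 1) 0 = 1" using mu by (simp add: gegN_def gegR_def gegcoef_def)
      then show "c (?f p) * ball_E \<mu> (?f p) x = (c (?f p) * sqrt (ball_h_sq \<mu> k)) * disk_hom \<mu> k
          (fst p) (snd p) x"
        by (cases p) simp
    qed
    finally show ?thesis .
  qed
  then show ?thesis by (intro exI[of _ "\<lambda>p. c (?f p) * sqrt (ball_h_sq \<mu> k)"]) blast
qed

section \<open>Quadrature in the angle and the kernels\<close>

text \<open>The sum is geometric with a ratio that is a root of unity of order dividing n + 1, and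
  different from 1 because n + 1 does not divide m. The factor s covers both node sets of the
  theorem: s = 1 for the half circle, s = 2 for the full circle.\<close>

lemma sum_cis_nodes:
  assumes "0 < m" "m \<le> n"
  shows "(\<Sum>\<nu><s * (n + 1). cis (2 * real m * (real \<nu> * pi / real (n + 1)))) = 0"
proof -
  define z where "z = cis (2 * real m * pi / real (n + 1))"
  have zp: "cis (2 * real m * (real \<nu> * pi / real (n + 1))) = z ^ \<nu>" for \<nu>
    unfolding z_def Complex.DeMoivre by (simp add: field_simps)
  have "z \<noteq> 1"
  proof
    assume "z = 1"
    then have "cos (2 * real m * pi / real (n + 1)) = 1" by (simp add: z_def complex_eq_iff)
    then obtain i :: int where "2 * real m * pi / real (n + 1) = of_int i * 2 * pi" using
        cos_one_2pi_int by auto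
    then have "2 * pi * (real m / real (n + 1)) = 2 * pi * of_int i" by (simp add: mult_ac)
    then have "real m / real (n + 1) = of_int i" by (simp only: mult_cancel_left) simp
    then have "real m = of_int i * real (n + 1)" by (simp add: divide_eq_eq)
    then have "int m = i * int (n + 1)" by (metis of_int_eq_iff of_int_mult of_int_of_nat_eq)
    then have "int (n + 1) dvd int m" by simp
    then have "n + 1 dvd m" by (simp only: int_dvd_int_iff)
    then have "n + 1 \<le> m" using assms by (intro dvd_imp_le)
    then show False using assms by simp
  qed
  moreover have "z ^ (s * (n + 1)) = 1"
  proof -
    have "z ^ (n + 1) = cis (real (n + 1) * (2 * real m * pi / real (n + 1)))"
      unfolding z_def Complex.DeMoivre ..
    also have "real (n + 1) * (2 * real m * pi / real (n + 1)) = 2 * real m * pi" by simp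
    also have "cis (2 * real m * pi) = 1" by (simp add: complex_eq_iff)
    finally show ?thesis by (metis mult.commute power_mult power_one)
  qed

  ultimately show ?thesis unfolding zp by (simp add: geometric_sum)
qed

lemma
  fixes n s :: nat
  defines "N \<equiv> s * (n + 1)"
  assumes m: "m \<le> n"
  shows sum_cos_nodes: "(\<Sum>\<nu><N. cos (2 * real m * (real \<nu> * pi / real (n + 1)))) = (if m = 0 then
      real N else 0)"
    and sum_sin_nodes: "(\<Sum>\<nu><N. sin (2 * real m * (real \<nu> * pi / real (n + 1)))) = 0"
proof -
  have "m > 0 \<Longrightarrow> (\<Sum>\<nu><N. cis (2 * real m * (real \<nu> * pi / real (n + 1)))) = 0"
    unfolding N_def by (rule sum_cis_nodes[OF _ m])
  then have *: "m > 0 \<Longrightarrow> Re (\<Sum>\<nu><N. cis (2 * real m * (real \<nu> * pi / real (n + 1)))) = 0"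
    "m > 0 \<Longrightarrow> Im (\<Sum>\<nu><N. cis (2 * real m * (real \<nu> * pi / real (n + 1)))) = 0" by simp_all
  show "(\<Sum>\<nu><N. cos (2 * real m * (real \<nu> * pi / real (n + 1)))) = (if m = 0 then real N else 0)"
    using * by (cases "m = 0") auto
  show "(\<Sum>\<nu><N. sin (2 * real m * (real \<nu> * pi / real (n + 1)))) = 0"
    using * by (cases "m = 0") auto
qed

lemma trig_S_orthogonal:
  fixes n s :: nat
  defines "N \<equiv> s * (n + 1)" and "\<xi> \<equiv> \<lambda>\<nu>. real \<nu> * pi / real (n + 1)"
  assumes k: "k \<le> n" and p: "(i, \<epsilon>) \<in> disk_indices k" "(i', \<epsilon>') \<in> disk_indices k"
  shows "(\<Sum>\<nu><N. trig_S (k - 2 * i) \<epsilon> (\<xi> \<nu>) * trig_S (k - 2 * i') \<epsilon>' (\<xi> \<nu>)) =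
    (if (i, \<epsilon>) = (i', \<epsilon>') then real N * disk_d i k else 0)"
proof -
  \<comment> \<open>P is half the sum of the frequencies and Q half their distance; both are at most
    k and hence at most n, which puts them in the range of the node sums.\<close>
  define j j' P Q where "j = k - 2 * i" and "j' = k - 2 * i'" and "P = k - i - i'" and "Q = (if i
      \<le> i' then i' - i else i - i')"
  have b: "2 * i \<le> k" "2 * i' \<le> k" "\<epsilon> \<le> j" "\<epsilon>' \<le> j'" "\<epsilon> \<in> {0, 1}" "\<epsilon>' \<in> {0, 1}"
    using p by (auto simp: disk_indices_def j_def j'_def)
  have PQ: "P \<le> n" "Q \<le> n" "Q = 0 \<longleftrightarrow> i = i'" using b k by (auto simp: P_def Q_def)
  have P0: "P = 0 \<longleftrightarrow> j = 0 \<and> j' = 0" using b by (auto simp: P_def j_def j'_def)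
  have jp: "real j + real j' = 2 * real P" "\<bar>real j - real j'\<bar> = 2 * real Q"
    using b by (auto simp: P_def Q_def j_def j'_def)
  have cP: "cos (real j * x + real j' * x) = cos (2 * real P * x)" for x
    using jp(1) by (metis distrib_right)
  have sP: "sin (real j * x + real j' * x) = sin (2 * real P * x)" for x
    using jp(1) by (metis distrib_right)
  have jq: "real j - real j' = 2 * real Q \<or> real j - real j' = - (2 * real Q)" using jp(2) by linarith
  have cQ: "cos (real j * x - real j' * x) = cos (2 * real Q * x)" for x
    using jq by (auto simp: left_diff_distrib[symmetric])
  have sQ: "(\<Sum>\<nu><N. sin (real j * \<xi> \<nu> - real j' * \<xi> \<nu>)) = 0"
  proof -
    have "\<exists>g. \<forall>x. sin (real j * x - real j' * x) = g * sin (2 * real Q * x)"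
      using jq by (elim disjE; intro exI[of _ "1"] exI[of _ "-1"]; simp add:
          left_diff_distrib[symmetric])
    then obtain g where "\<And>x. sin (real j * x - real j' * x) = g * sin (2 * real Q * x)" by blast
    then show ?thesis using sum_sin_nodes[OF PQ(2), of s] unfolding N_def \<xi>_def
      by (simp only: sum_distrib_left[symmetric] mult_zero_right)
  qed
  note S = sum_cos_nodes[OF PQ(1), of s, folded N_def] sum_cos_nodes[OF PQ(2), of s, folded N_def]
    sum_sin_nodes[OF PQ(1), of s, folded N_def]
  have cc: "(\<Sum>\<nu><N. cos (real j * \<xi> \<nu>) * cos (real j' * \<xi> \<nu>)) = ((if Q = 0 then real N else 0) +
      (if P = 0 then real N else 0)) / 2"
    unfolding cos_times_cos cP cQ sum_divide_distrib[symmetric] sum.distrib unfolding \<xi>_def S ..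
  have ss: "(\<Sum>\<nu><N. sin (real j * \<xi> \<nu>) * sin (real j' * \<xi> \<nu>)) = ((if Q = 0 then real N else 0) -
      (if P = 0 then real N else 0)) / 2"
    unfolding sin_times_sin cP cQ sum_divide_distrib[symmetric] sum_subtractf unfolding \<xi>_def S ..
  have sc: "(\<Sum>\<nu><N. sin (real j * \<xi> \<nu>) * cos (real j' * \<xi> \<nu>)) = 0"
    unfolding sin_times_cos sP sum_divide_distrib[symmetric] sum.distrib sQ unfolding \<xi>_def S by simp
  have cs: "(\<Sum>\<nu><N. cos (real j * \<xi> \<nu>) * sin (real j' * \<xi> \<nu>)) = 0"
    unfolding cos_times_sin sP sum_divide_distrib[symmetric] sum_subtractf sQ unfolding \<xi>_def S by simp
  have d: "disk_d i k = (if j = 0 then 1 else 1/2)" using b by (auto simp: disk_d_def j_def)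
  show ?thesis unfolding j_def[symmetric] j'_def[symmetric] d trig_S_def
    using b(5,6,3,4) PQ(3) P0 cc ss sc cs by (auto simp: j_def[symmetric] j'_def[symmetric])
qed

text \<open>Terms i and k - i are merged; division by \<open>disk_d\<close> doubles each term except
  a possible middle one.\<close>

lemma sum_fold_half:
  fixes f :: "nat \<Rightarrow> real"
  assumes "\<And>i. i \<le> k \<Longrightarrow> f (k - i) = f i"
  shows "(\<Sum>i\<le>k. f i) = (\<Sum>i | 2 * i \<le> k. f i / disk_d i k)"
proof -
  let ?L = "{i. 2 * i < k}" and ?M = "{i. 2 * i = k}" and ?U = "{i. i \<le> k \<and> k < 2 * i}"
  have fin: "finite ?L" "finite ?M" "finite ?U"
    by (rule finite_subset[of _ "{..k}"]; auto)+
  have "{..k} = (?L \<union> ?M) \<union> ?U" by auto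
  then have "(\<Sum>i\<le>k. f i) = sum f ((?L \<union> ?M) \<union> ?U)" by (rule arg_cong)
  also have "\<dots> = sum f ?L + sum f ?M + sum f ?U"
    using fin by (subst sum.union_disjoint, auto, subst sum.union_disjoint, auto)
  also have "sum f ?U = (\<Sum>i\<in>?L. f (k - i))"
    by (rule sum.reindex_bij_witness[of _ "\<lambda>i. k - i" "\<lambda>i. k - i"]) auto
  also have "\<dots> = sum f ?L" using assms by (intro sum.cong refl) auto
  also have "sum f ?L + sum f ?M + sum f ?L = (\<Sum>i\<in>?L. f i / disk_d i k) + (\<Sum>i\<in>?M. f i / disk_d i k)"
    by (simp add: disk_d_def sum_distrib_left[symmetric] sum_distrib_right[symmetric]
        sum_divide_distrib[symmetric])
  also have "\<dots> = (\<Sum>i | 2 * i \<le> k. f i / disk_d i k)"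
    using fin by (subst sum.union_disjoint[symmetric]) (auto intro!: sum.cong)
  finally show ?thesis .
qed

lemma sum_disk_indices:
  fixes c :: "nat \<Rightarrow> real"
  shows "(\<Sum>p\<in>disk_indices k. c (fst p) * trig_S (k - 2 * fst p) (snd p) \<theta> * trig_S (k - 2 * fst p)
      (snd p) \<phi>) =
    (\<Sum>i | 2 * i \<le> k. c i * cos (real (k - 2 * i) * (\<phi> - \<theta>)))"
proof -
  let ?F = "\<lambda>p. c (fst p) * trig_S (k - 2 * fst p) (snd p) \<theta> * trig_S (k - 2 * fst p) (snd p) \<phi>"
  have fin: "finite {i. 2 * i \<le> k}" by (rule finite_subset[of _ "{..k}"]) auto
  \<comment> \<open>The pairs added to make the index set a product are those with frequency 0 and
    the sine, whose terms vanish.\<close>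
  have "sum ?F (disk_indices k) = sum ?F ({i. 2 * i \<le> k} \<times> {0, 1})"
  proof (rule sum.mono_neutral_left)
    show "\<forall>p\<in>{i. 2 * i \<le> k} \<times> {0, 1} - disk_indices k. ?F p = 0"
    proof
      fix p assume "p \<in> {i. 2 * i \<le> k} \<times> {0, 1} - disk_indices k"
      then have "snd p = 1" "k - 2 * fst p = 0" by (auto simp: disk_indices_def)
      then show "?F p = 0" by (simp add: trig_S_def)
    qed
  qed (use fin in \<open>auto simp: disk_indices_def\<close>)
  also have "\<dots> = (\<Sum>i | 2 * i \<le> k. \<Sum>\<epsilon>\<in>{0, 1}. ?F (i, \<epsilon>))"
    by (simp only: sum.cartesian_product) (intro sum.cong refl, simp add: split_beta)
  also have "\<dots> = (\<Sum>i | 2 * i \<le> k. c i * cos (real (k - 2 * i) * (\<phi> - \<theta>)))"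
  proof (intro sum.cong refl)
    fix i
    define J where "J = real (k - 2 * i)"
    have "cos (J * (\<phi> - \<theta>)) = cos (J * \<theta>) * cos (J * \<phi>) + sin (J * \<theta>) * sin (J * \<phi>)"
      by (simp add: right_diff_distrib cos_diff mult.commute)
    moreover have "(\<Sum>\<epsilon>\<in>{0, 1}. ?F (i, \<epsilon>)) = c i * cos (J * \<theta>) * cos (J * \<phi>) + c i * sin (J * \<theta>) *
        sin (J * \<phi>)"
      by (simp add: trig_S_def J_def)
    ultimately show "(\<Sum>\<epsilon>\<in>{0, 1}. ?F (i, \<epsilon>)) = c i * cos (real (k - 2 * i) * (\<phi> - \<theta>))"
      by (simp only: J_def[symmetric] distrib_left mult.assoc)
  qed
  finally show ?thesis .
qed

lemma gegR_fourier:
  "poly (gegR \<kappa> k) (cos (\<phi> - \<theta>)) = (\<Sum>p\<in>disk_indices k.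
     gegcoef \<kappa> k (fst p) / disk_d (fst p) k * trig_S (k - 2 * fst p) (snd p) \<theta> * trig_S (k - 2 *
         fst p) (snd p) \<phi>)"
proof -
  let ?f = "\<lambda>i. gegcoef \<kappa> k i * cos ((real k - 2 * real i) * (\<phi> - \<theta>))"
  have "poly (gegR \<kappa> k) (cos (\<phi> - \<theta>)) = (\<Sum>i | 2 * i \<le> k. ?f i / disk_d i k)"
    unfolding poly_gegR_cos
  proof (rule sum_fold_half)
    fix i assume "i \<le> k"
    then have "real k - 2 * real (k - i) = - (real k - 2 * real i)" "gegcoef \<kappa> k (k - i) = gegcoef
        \<kappa> k i"
      by (auto simp: gegcoef_def mult_ac)
    then show "?f (k - i) = ?f i" by (simp only: mult_minus_left cos_minus)
  qed
  also have "\<dots> = (\<Sum>i | 2 * i \<le> k. gegcoef \<kappa> k i / disk_d i k * cos (real (k - 2 * i) * (\<phi> - \<theta>)))"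
    by (intro sum.cong refl) (auto simp: of_nat_diff)
  also have "\<dots> = (\<Sum>p\<in>disk_indices k.
     gegcoef \<kappa> k (fst p) / disk_d (fst p) k * trig_S (k - 2 * fst p) (snd p) \<theta> * trig_S (k - 2 *
         fst p) (snd p) \<phi>)"
    by (rule sum_disk_indices[symmetric])
  finally show ?thesis .
qed

section \<open>Boundary values on the circle and the expansion of ridge functions\<close>

definition pj1 :: "real \<Rightarrow> nat \<Rightarrow> nat \<Rightarrow> real" where
  "pj1 \<mu> k i = poly (jacobi_orthonormal i (\<mu> - 1/2) (real (k - 2 * i))) 1"

lemma pj1_nonzero: "\<mu> \<ge> 0 \<Longrightarrow> pj1 \<mu> k i \<noteq> 0"
  unfolding pj1_def by (rule jacobi_at_1) auto

lemma Zf_circle: "\<epsilon> \<in> {0, 1} \<Longrightarrow> Zf j \<epsilon> (vec3 0 (cos \<phi>) (sin \<phi>)) = trig_S j \<epsilon> \<phi>"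
proof -
  have "zc (vec3 0 (cos \<phi>) (sin \<phi>)) = cis \<phi>" by (simp add: zc_def complex_eq_iff)
  then show "\<epsilon> \<in> {0, 1} \<Longrightarrow> ?thesis" by (auto simp: Zf_def trig_S_def Complex.DeMoivre)
qed

lemma disk_hom_circle:
  assumes "\<mu> \<ge> 0" "\<epsilon> \<in> {0, 1}"
  shows "disk_hom \<mu> k i \<epsilon> (vec3 0 (cos \<phi>) (sin \<phi>)) = disk_h \<mu> i k * pj1 \<mu> k i * trig_S (k - 2 * i) \<epsilon> \<phi>"
proof -
  have "rho2 (vec3 0 (cos \<phi>) (sin \<phi>)) = 1" by (simp add: rho2_def)
  moreover have "Hj \<mu> i (k - 2 * i) 1 1 = pj1 \<mu> k i"
    using Hj_scale[OF assms(1), of i "k - 2 * i" 1 1] by (simp add: poly_jacR pj1_def)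
  ultimately show ?thesis by (simp add: disk_hom_def Zf_circle[OF assms(2)])
qed

text \<open>The coefficients of the expansion are read off on the unit circle in the plane \<open>x\<^sub>3 = 0\<close>.\<close>

lemma Zon_expansion:
  assumes mu: "\<mu> \<ge> 0"
  shows "Zon (\<mu> + 1/2) k (rot3 (-\<theta>) x) = (\<Sum>p\<in>disk_indices k.
    gegcoef (\<mu> + 1/2) k (fst p) / (disk_d (fst p) k * disk_h \<mu> (fst p) k * pj1 \<mu> k (fst p)) *
    trig_S (k - 2 * fst p) (snd p) \<theta> * disk_hom \<mu> k (fst p) (snd p) x)"
proof -
  let ?S = "\<lambda>p. trig_S (k - 2 * fst p) (snd p)"
  obtain c where c: "\<And>x. Zon (\<mu> + 1/2) k (rot3 (-\<theta>) x) = (\<Sum>p\<in>disk_indices k. c p * disk_hom \<mu> k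
      (fst p) (snd p) x)"
    using Zon_expansion_exists[OF mu] by blast
  define g where "g p = gegcoef (\<mu> + 1/2) k (fst p) / disk_d (fst p) k * ?S p \<theta>" for p
  define e where "e p = c p * (disk_h \<mu> (fst p) k * pj1 \<mu> k (fst p)) - g p" for p
  have e0: "(\<Sum>p\<in>disk_indices k. e p * ?S p \<phi>) = 0" for \<phi>
  proof -
    let ?x = "vec3 0 (cos \<phi>) (sin \<phi>)"
    have "Zon (\<mu> + 1/2) k (rot3 (-\<theta>) ?x) = poly (gegR (\<mu> + 1/2) k) (cos (\<phi> - \<theta>))"
      using zon_scale[of 1 0 "\<mu> + 1/2" k "cos (\<phi> - \<theta>)"] by (simp add: Zon_def cos_diff)
    moreover have "(\<Sum>p\<in>disk_indices k. c p * disk_hom \<mu> k (fst p) (snd p) ?x) =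
        (\<Sum>p\<in>disk_indices k. c p * (disk_h \<mu> (fst p) k * pj1 \<mu> k (fst p)) * ?S p \<phi>)"
      by (intro sum.cong refl) (auto simp: disk_indices_def disk_hom_circle[OF mu])
    ultimately have "(\<Sum>p\<in>disk_indices k. c p * (disk_h \<mu> (fst p) k * pj1 \<mu> k (fst p)) * ?S p \<phi>) =
        (\<Sum>p\<in>disk_indices k. g p * ?S p \<phi>)"
      using c[of ?x] gegR_fourier[of "\<mu> + 1/2" k \<phi> \<theta>] by (simp add: g_def)
    then show ?thesis by (simp add: e_def left_diff_distrib sum_subtractf)
  qed
  \<comment> \<open>For fixed k, distinct index pairs restrict to distinct cosines and sines on the
    circle. Their independence follows from the discrete orthogonality itself, with n = k and s =
    1.\<close>
  have "e q = 0" if q: "q \<in> disk_indices k" for q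
  proof -
    let ?\<xi> = "\<lambda>\<nu>. real \<nu> * pi / real (k + 1)"
    have "0 = (\<Sum>\<nu><1 * (k + 1). (\<Sum>p\<in>disk_indices k. e p * ?S p (?\<xi> \<nu>)) * ?S q (?\<xi> \<nu>))"
      unfolding e0 by simp
    also have "\<dots> = (\<Sum>p\<in>disk_indices k. e p * (\<Sum>\<nu><1 * (k + 1). ?S p (?\<xi> \<nu>) * ?S q (?\<xi> \<nu>)))"
      unfolding sum_distrib_right sum_distrib_left by (subst sum.swap) (simp only: mult.assoc)
    also have "\<dots> = (\<Sum>p\<in>disk_indices k. if p = q then e q * (real (k + 1) * disk_d (fst q) k) else 0)"
    proof (intro sum.cong refl)
      fix p assume p: "p \<in> disk_indices k"
      have "(fst p, snd p) \<in> disk_indices k" "(fst q, snd q) \<in> disk_indices k" using p q by simp_all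
      from trig_S_orthogonal[OF le_refl this, of 1]
      show "e p * (\<Sum>\<nu><1 * (k + 1). ?S p (?\<xi> \<nu>) * ?S q (?\<xi> \<nu>)) = (if p = q then e q * (real (k + 1)
          * disk_d (fst q) k) else 0)"
        by (simp only: prod.collapse) auto
    qed
    also have "\<dots> = e q * (real (k + 1) * disk_d (fst q) k)" using q by (simp add: finite_disk_indices)
    finally show ?thesis by (auto simp: disk_d_def split: if_splits)
  qed
  then have cg: "c p = g p / (disk_h \<mu> (fst p) k * pj1 \<mu> k (fst p))" if "p \<in> disk_indices k" for p
    using that disk_h_pos[OF mu, of "fst p" k] pj1_nonzero[OF mu, of k "fst p"] by (simp add:
        e_def field_simps)
  show ?thesis unfolding c by (intro sum.cong refl) (simp add: cg g_def)
qed

text \<open>De Moivre turns the modulus and the chosen argument back into a power of x + i y, so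
  that the choice of argument disappears.\<close>

lemma disk_P_alt:
  assumes "\<epsilon> \<in> {0, 1}"
  shows "disk_P \<mu> k i \<epsilon> x y = disk_h \<mu> i k * poly (jacobi_orthonormal i (\<mu> - 1/2) (real (k - 2 *
      i))) (2 * (x\<^sup>2 + y\<^sup>2) - 1) *
    Zf (k - 2 * i) \<epsilon> (vec3 0 x y)"
proof -
  define z where "z = Complex x y"
  have "z ^ j = of_real (cmod z ^ j) * cis (real j * Arg z)" for j
    using DeMoivre2[of "cmod z" "Arg z" j] unfolding rcis_cmod_Arg unfolding rcis_def .
  then have "Zf j \<epsilon> (vec3 0 x y) = cmod z ^ j * trig_S j \<epsilon> (Arg z)" for j
    using assms by (auto simp: Zf_def zc_def z_def[symmetric] trig_S_def)
  moreover have "(cmod z)\<^sup>2 = x\<^sup>2 + y\<^sup>2" by (simp add: z_def cmod_power2)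
  ultimately show ?thesis by (simp add: disk_P_def Let_def z_def[symmetric] mult.assoc)
qed

lemma disk_P_circle:
  assumes "\<epsilon> \<in> {0, 1}"
  shows "disk_P \<mu> k i \<epsilon> (cos \<xi>) (sin \<xi>) = disk_h \<mu> i k * pj1 \<mu> k i * trig_S (k - 2 * i) \<epsilon> \<xi>"
  unfolding disk_P_alt[OF assms] Zf_circle[OF assms] by (simp add: pj1_def)

text \<open>With \<beta> = \<open>sqrt (1 - x$3^2)\<close>, the factor \<open>\<beta>^k\<close>
  splits into \<open>\<beta>^(2 i)\<close>, which homogenizes the Jacobi polynomial, and
  \<open>\<beta>^(k - 2 i)\<close>, which undoes the scaling of the harmonic.\<close>

lemma disk_P_hom:
  assumes mu: "\<mu> \<ge> 0" and x: "\<bar>x$3\<bar> < 1" and ix: "(i, \<epsilon>) \<in> disk_indices k"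
  shows "(1 - (x$3)\<^sup>2) powr (real k / 2) * disk_P \<mu> k i \<epsilon> (x$1 / sqrt (1 - (x$3)\<^sup>2)) (x$2 / sqrt
      (1 - (x$3)\<^sup>2)) = disk_hom \<mu> k i \<epsilon> x"
proof -
  define \<beta> where "\<beta> = sqrt (1 - (x$3)\<^sup>2)"
  have "(x$3)\<^sup>2 < 1" using x by (simp add: abs_square_less_1)
  then have b: "\<beta> > 0" "\<beta>\<^sup>2 = 1 - (x$3)\<^sup>2" by (auto simp: \<beta>_def)
  have e: "\<epsilon> \<in> {0, 1}" and k: "k = 2 * i + (k - 2 * i)" using ix by (auto simp: disk_indices_def)
  define j where "j = k - 2 * i"
  have bk: "(1 - (x$3)\<^sup>2) powr (real k / 2) = \<beta> ^ k"
  proof -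
    have "1 - (x$3)\<^sup>2 = \<beta> powr 2" using b(1) by (simp add: b(2))
    then show ?thesis using b(1) by (simp only: powr_powr) (simp add: powr_realpow)
  qed
  have z: "zc (vec3 0 (x$1 / \<beta>) (x$2 / \<beta>)) = zc x / of_real \<beta>"
    using b by (simp add: zc_def complex_eq_iff)
  have z1: "\<beta> ^ j * Zf j \<epsilon> (vec3 0 (x$1 / \<beta>) (x$2 / \<beta>)) = Zf j \<epsilon> x"
    unfolding Zf_def z power_divide of_real_power[symmetric] using b by simp
  have z2: "\<beta> ^ (2 * i) * poly (jacobi_orthonormal i (\<mu> - 1/2) (real j)) (2 * ((x$1 / \<beta>)\<^sup>2 + (x$2
      / \<beta>)\<^sup>2) - 1)
      = Hj \<mu> i j (rho2 x) (1 - (x$3)\<^sup>2)"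
  proof -
    have "rho2 x = \<beta>\<^sup>2 * ((x$1 / \<beta>)\<^sup>2 + (x$2 / \<beta>)\<^sup>2)"
      using b(1) by (simp add: rho2_def power_divide distrib_left)
    then show ?thesis unfolding b(2)[symmetric] poly_jacR[symmetric]
      by (simp only: Hj_scale[OF mu] power_mult)
  qed
  have "\<beta> ^ k = \<beta> ^ (2 * i) * \<beta> ^ j" using k by (simp add: j_def power_add[symmetric])
  then have "\<beta> ^ k * (a * p * z) = a * (\<beta> ^ (2 * i) * p) * (\<beta> ^ j * z)" for a p z by (simp only:
      mult_ac)
  then show ?thesis
    unfolding \<beta>_def[symmetric] bk disk_P_alt[OF e] disk_hom_def j_def[symmetric] by (simp only: z1 z2)
qed

section \<open>The kernel as a polynomial in both points\<close>

definition disk_D_hom :: "real \<Rightarrow> nat \<Rightarrow> real \<Rightarrow> real^3 \<Rightarrow> real" where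
  "disk_D_hom \<mu> k \<xi> x = (\<Sum>p\<in>disk_indices k.
     disk_lambda \<mu> (fst p) k * disk_P \<mu> k (fst p) (snd p) (cos \<xi>) (sin \<xi>) * disk_hom \<mu> k (fst p)
         (snd p) x)"

definition ball_D_poly :: "real \<Rightarrow> nat \<Rightarrow> real \<Rightarrow> real \<Rightarrow> real^3 \<Rightarrow> real" where
  "ball_D_poly \<mu> k \<xi> t x = (real k + \<mu> + 1/2) / (\<mu> + 1/2) * poly (gegenbauer k (\<mu> + 1/2)) t *
      disk_D_hom \<mu> k \<xi> x"

lemma ball_D_expr_poly:
  assumes mu: "\<mu> \<ge> 0" and x: "\<bar>x$3\<bar> < 1"
  shows "ball_D_expr \<mu> k \<xi> t x = ball_D_poly \<mu> k \<xi> t x"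
proof -
  let ?u = "x$1 / sqrt (1 - (x$3)\<^sup>2)" and ?v = "x$2 / sqrt (1 - (x$3)\<^sup>2)" and ?b = "(1 - (x$3)\<^sup>2)
      powr (real k / 2)"
  have "?b * disk_D \<mu> k \<xi> ?u ?v = (\<Sum>p\<in>disk_indices k. disk_lambda \<mu> (fst p) k * disk_P \<mu> k (fst p)
      (snd p) (cos \<xi>) (sin \<xi>) *
     (?b * disk_P \<mu> k (fst p) (snd p) ?u ?v))"
    unfolding disk_D_def split_beta sum_distrib_left by (intro sum.cong refl) (simp only: mult_ac)
  also have "\<dots> = (\<Sum>p\<in>disk_indices k. disk_lambda \<mu> (fst p) k * disk_P \<mu> k (fst p) (snd p) (cos \<xi>)
      (sin \<xi>) * disk_hom \<mu> k (fst p) (snd p) x)"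
  proof (intro sum.cong refl)
    fix p assume "p \<in> disk_indices k"
    then have "(fst p, snd p) \<in> disk_indices k" by simp
    from disk_P_hom[OF mu x this]
    show "disk_lambda \<mu> (fst p) k * disk_P \<mu> k (fst p) (snd p) (cos \<xi>) (sin \<xi>) * (?b * disk_P \<mu> k
        (fst p) (snd p) ?u ?v)
       = disk_lambda \<mu> (fst p) k * disk_P \<mu> k (fst p) (snd p) (cos \<xi>) (sin \<xi>) * disk_hom \<mu> k (fst
           p) (snd p) x" by simp
  qed
  finally show ?thesis unfolding ball_D_expr_def disk_D_t_def ball_D_poly_def disk_D_hom_def by
      (simp add: mult_ac)
qed

text \<open>At the poles \<open>ball_D\<close> is a described polynomial. It is unique because the
  prescribed values cover the open ball, where \<open>polys3_eq_0_ball\<close> applies to the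
  difference of two candidates.\<close>

lemma ball_D_eq:
  assumes mu: "\<mu> \<ge> 0"
  shows "ball_D \<mu> k \<xi> t x = ball_D_poly \<mu> k \<xi> t x"
proof (cases "\<bar>x$3\<bar> < 1")
  case True
  then show ?thesis by (simp add: ball_D_def ball_D_expr_poly[OF mu])
next
  case False
  let ?Q = "ball_D_poly \<mu> k \<xi> t"
  have Qp: "?Q \<in> polys3_le k"
    unfolding ball_D_poly_def[abs_def] disk_D_hom_def
    by (intro polys3_cmult polys3_sum polys3_disk_hom) (auto simp: disk_indices_def)
  have "(THE Q. (\<exists>d. Q \<in> polys3_le d) \<and> (\<forall>y \<in> cball 0 1. \<bar>y$3\<bar> < 1 \<longrightarrow> Q y = ball_D_expr \<mu> k \<xi> t y)) = ?Q"
  proof (rule the_equality)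
    show "(\<exists>d. ?Q \<in> polys3_le d) \<and> (\<forall>y \<in> cball 0 1. \<bar>y$3\<bar> < 1 \<longrightarrow> ?Q y = ball_D_expr \<mu> k \<xi> t y)"
      using Qp ball_D_expr_poly[OF mu] by auto
    fix Q assume Q: "(\<exists>d. Q \<in> polys3_le d) \<and> (\<forall>y \<in> cball 0 1. \<bar>y$3\<bar> < 1 \<longrightarrow> Q y = ball_D_expr \<mu> k \<xi> t y)"
    then obtain d where d: "Q \<in> polys3_le d" by blast
    have D: "(\<lambda>y. Q y - ?Q y) \<in> polys3_le (max d k)"
      by (intro polys3_diff polys3_mono[OF d] polys3_mono[OF Qp]) auto
    have "Q y - ?Q y = 0" for y
    proof (rule polys3_eq_0_ball[OF D])
      fix y :: "real^3" assume y: "y \<in> ball 0 1"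
      then have "\<bar>y$3\<bar> < 1" using component_le_norm_cart[of y 3] by simp
      then show "Q y - ?Q y = 0" using Q y ball_D_expr_poly[OF mu] by auto
    qed
    then show "Q = ?Q" by auto
  qed
  then show ?thesis using False by (simp add: ball_D_def)
qed

text \<open>The parameter t of the segment through y for the angle \<xi>;
  \<open>tpar_rot3_vec3\<close> shows that it inverts \<open>radon_line\<close> in t.\<close>

definition tpar :: "real \<Rightarrow> real^3 \<Rightarrow> real" where
  "tpar \<xi> y = (y$1 * cos \<xi> + y$2 * sin \<xi>) / sqrt (1 - (y$3)\<^sup>2)"

lemma Zon_tpar:
  assumes y: "\<bar>y$3\<bar> < 1"
  shows "(1 - (y$3)\<^sup>2) powr (real k / 2) * poly (gegR \<kappa> k) (tpar \<xi> y) = Zon \<kappa> k (rot3 (-\<xi>) y)"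
proof -
  define \<beta> where "\<beta> = sqrt (1 - (y$3)\<^sup>2)"
  have "(y$3)\<^sup>2 < 1" using y by (simp add: abs_square_less_1)
  then have b: "\<beta> > 0" "\<beta>\<^sup>2 = 1 - (y$3)\<^sup>2" by (auto simp: \<beta>_def)
  have bk: "(1 - (y$3)\<^sup>2) powr (real k / 2) = \<beta> ^ k"
  proof -
    have "1 - (y$3)\<^sup>2 = \<beta> powr 2" using b(1) by (simp add: b(2))
    then show ?thesis using b(1) by (simp only: powr_powr) (simp add: powr_realpow)
  qed
  have "rot3 (-\<xi>) y $ 1 = \<beta> * tpar \<xi> y" using b(1) by (simp add: tpar_def \<beta>_def[symmetric])
  then show ?thesis unfolding Zon_def rot3_nth(3) bk by (simp only: zon_scale[OF b(2)])
qed

text \<open>\<open>kernel_G\<close> with the pair (t, w) replaced by a point y of the segment.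
  Half-integral powers of \<open>1 - w^2\<close> are gone, so continuity in y on the whole space is
  immediate.\<close>

definition kern_poly :: "real \<Rightarrow> nat \<Rightarrow> real \<Rightarrow> real^3 \<Rightarrow> real^3 \<Rightarrow> real" where
  "kern_poly \<mu> l \<xi> x y = ball_const \<mu> * (\<Sum>k\<le>l. ball_h_sq \<mu> k * ((real k + \<mu> + 1/2) / (\<mu> + 1/2) *
      disk_D_hom \<mu> k \<xi> x *
     Zon (\<mu> + 1/2) k (rot3 (-\<xi>) y)) *
     poly (gegN (real k + \<mu> + 1) (l - k)) (y$3) * poly (gegN (real k + \<mu> + 1) (l - k)) (x$3))"

lemma kernel_G_tpar:
  assumes mu: "\<mu> \<ge> 0" and y: "\<bar>y$3\<bar> < 1"
  shows "kernel_G \<mu> l \<xi> (tpar \<xi> y) (y$3) x = kern_poly \<mu> l \<xi> x y"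
proof -
  have g: "gegenbauer k (\<mu> + 1/2) = gegR (\<mu> + 1/2) k" for k using mu by (intro gegenbauer_eq_gegR) simp
  have gn: "gegenbauer_normalized m (real k + \<mu> + 1) = poly (gegN (real k + \<mu> + 1) m)" for k m
    using mu by (intro ext gegenbauer_normalized_eq) simp
  show ?thesis unfolding kernel_G_def kern_poly_def ball_D_eq[OF mu] ball_D_poly_def g gn
      Zon_tpar[OF y, symmetric]
    by (simp only: mult_ac)
qed

lemma continuous_kern_poly: "continuous_on UNIV (kern_poly \<mu> l \<xi> x)"
  unfolding kern_poly_def[abs_def]
  by (intro continuous_intros polys3_continuous[OF polys3_Zon_rot3])

text \<open>The rising factorials in \<open>gegcoef\<close> are those of \<kappa> = \<mu> + 1/2,
  while one in \<open>disk_lambda\<close> starts at \<kappa> + 1; the two are matched by \<kappa>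
  (\<kappa> + 1)...(\<kappa> + m) written once as \<kappa> times \<open>D\<close> and once as
  \<open>B\<close> times \<kappa> + m, with m = k - i.\<close>

lemma zonal_constants:
  assumes mu: "\<mu> \<ge> 0" and "i \<le> k"
  shows "(real k + \<mu> + 1/2) / (\<mu> + 1/2) * gegcoef (\<mu> + 1/2) k i * disk_lambda \<mu> i k = 1"
proof -
  define \<kappa> where "\<kappa> = \<mu> + 1/2"
  have k: "\<kappa> > 0" using mu by (simp add: \<kappa>_def)
  have "\<mu> + 3/2 = \<kappa> + 1" by (simp add: \<kappa>_def)
  define A B D F1 F2 where "A = pochhammer \<kappa> i" and "B = pochhammer \<kappa> (k - i)"
    and "D = pochhammer (\<kappa> + 1) (k - i)" and "F1 = (fact i :: real)" and "F2 = (fact (k - i) :: real)"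
  have pos: "A > 0" "B > 0" "F1 > 0" "F2 > 0" "D > 0" using k by (auto simp: A_def B_def D_def
      F1_def F2_def pochhammer_pos)
  have "\<kappa> * D = B * (\<kappa> + real (k - i))"
    unfolding B_def D_def by (simp only: pochhammer_rec[symmetric] pochhammer_Suc)
  then have D: "D = B * (\<kappa> + real (k - i)) / \<kappa>" using k by (simp add: field_simps)
  have s: "real k + \<kappa> > 0" "real (k - i) + \<kappa> > 0" using k by (auto intro: add_nonneg_pos)
  have gen: "S1 / \<kappa> * (A * B / (F1 * F2)) * (F1 * F2 * S2 / (A * (B * S2 / \<kappa>) * S1)) = 1"
    if "S1 > 0" "S2 > 0" for S1 S2 :: real
    using pos k that by simp
  have "(real k + \<kappa>) / \<kappa> * (A * B / (F1 * F2)) * (F1 * F2 * (real (k - i) + \<kappa>) / (A * D * (real k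
      + \<kappa>))) = 1"
    unfolding D add.commute[of \<kappa> "real (k - i)"] by (rule gen[OF s])
  then show ?thesis
    unfolding gegcoef_def disk_lambda_def \<open>\<mu> + 3/2 = \<kappa> + 1\<close> add.assoc[of _ \<mu> "1/2"] \<kappa>_def[symmetric]
      A_def[symmetric] B_def[symmetric] D_def[symmetric] F1_def[symmetric] F2_def[symmetric] .
qed

section \<open>Summation over the nodes\<close>

lemma disk_quadrature:
  fixes n s :: nat
  defines "N \<equiv> s * (n + 1)" and "\<xi> \<equiv> \<lambda>\<nu>. real \<nu> * pi / real (n + 1)"
  assumes mu: "\<mu> \<ge> 0" and k: "k \<le> n"
  shows "(\<Sum>\<nu><N. (real k + \<mu> + 1/2) / (\<mu> + 1/2) * disk_D_hom \<mu> k (\<xi> \<nu>) x *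
     Zon (\<mu> + 1/2) k (rot3 (- \<xi> \<nu>) y)) =
    real N * (\<Sum>p\<in>disk_indices k. disk_hom \<mu> k (fst p) (snd p) y * disk_hom \<mu> k (fst p) (snd p) x)"
proof -
  let ?S = "\<lambda>p. trig_S (k - 2 * fst p) (snd p)"
  let ?K = "(real k + \<mu> + 1/2) / (\<mu> + 1/2)"
  let ?dh = "\<lambda>p. disk_hom \<mu> k (fst p) (snd p)"
  define hp where "hp p = disk_h \<mu> (fst p) k * pj1 \<mu> k (fst p)" for p :: "nat \<times> nat"
  define g where "g p = gegcoef (\<mu> + 1/2) k (fst p) / (disk_d (fst p) k * hp p)" for p :: "nat \<times> nat"
  have hp: "hp p \<noteq> 0" for p using disk_h_pos[OF mu, of "fst p" k] pj1_nonzero[OF mu, of k "fst p"]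
      by (simp add: hp_def)
  have dd: "disk_d i k \<noteq> 0" for i by (simp add: disk_d_def)
  have Z: "Zon (\<mu> + 1/2) k (rot3 (- \<xi> \<nu>) y) = (\<Sum>q\<in>disk_indices k. g q * ?S q (\<xi> \<nu>) * ?dh q y)" for \<nu>
    unfolding Zon_expansion[OF mu] g_def hp_def by (simp only: mult.assoc)
  have P: "disk_P \<mu> k (fst p) (snd p) (cos (\<xi> \<nu>)) (sin (\<xi> \<nu>)) = hp p * ?S p (\<xi> \<nu>)" if "p \<in>
      disk_indices k" for p \<nu>
    unfolding hp_def using that by (intro disk_P_circle) (auto simp: disk_indices_def)
  have "(\<Sum>\<nu><N. ?K * disk_D_hom \<mu> k (\<xi> \<nu>) x *
     Zon (\<mu> + 1/2) k (rot3 (- \<xi> \<nu>) y)) =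
    (\<Sum>\<nu><N. \<Sum>p\<in>disk_indices k. \<Sum>q\<in>disk_indices k. (?K * disk_lambda \<mu> (fst p) k * hp p * ?dh p x *
        g q * ?dh q y) * (?S p (\<xi> \<nu>) * ?S q (\<xi> \<nu>)))"
  proof (intro sum.cong refl)
    fix \<nu>
    have F: "disk_D_hom \<mu> k (\<xi> \<nu>) x
       = (\<Sum>p\<in>disk_indices k. disk_lambda \<mu> (fst p) k * (hp p * ?S p (\<xi> \<nu>)) * ?dh p x)"
      unfolding disk_D_hom_def by (intro sum.cong refl) (simp only: P)
    show "?K * disk_D_hom \<mu> k (\<xi> \<nu>) x *
       Zon (\<mu> + 1/2) k (rot3 (- \<xi> \<nu>) y) =
      (\<Sum>p\<in>disk_indices k. \<Sum>q\<in>disk_indices k. (?K * disk_lambda \<mu> (fst p) k * hp p * ?dh p x * g q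
          * ?dh q y) * (?S p (\<xi> \<nu>) * ?S q (\<xi> \<nu>)))"
      unfolding F Z mult.assoc[of ?K] unfolding sum_product unfolding sum_distrib_left
      by (intro sum.cong refl) (simp only: mult_ac)
  qed
  also have "\<dots> = (\<Sum>p\<in>disk_indices k. \<Sum>q\<in>disk_indices k. (?K * disk_lambda \<mu> (fst p) k * hp p * ?dh
      p x * g q * ?dh q y) * (\<Sum>\<nu><N. ?S p (\<xi> \<nu>) * ?S q (\<xi> \<nu>)))"
    unfolding sum_distrib_left by (subst sum.swap, intro sum.cong refl, subst sum.swap, rule refl)
  also have "\<dots> = (\<Sum>p\<in>disk_indices k. \<Sum>q\<in>disk_indices k. if q = p then real N * (?dh p y * ?dh p x)
      else 0)"
  proof (intro sum.cong refl)
    fix p q assume pq: "p \<in> disk_indices k" "q \<in> disk_indices k"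
    have o: "(\<Sum>\<nu><N. ?S p (\<xi> \<nu>) * ?S q (\<xi> \<nu>)) = (if p = q then real N * disk_d (fst p) k else 0)"
      using trig_S_orthogonal[OF k, of "fst p" "snd p" "fst q" "snd q" s] pq unfolding N_def \<xi>_def
          by simp
    show "(?K * disk_lambda \<mu> (fst p) k * hp p * ?dh p x * g q * ?dh q y) * (\<Sum>\<nu><N. ?S p (\<xi> \<nu>) * ?S
        q (\<xi> \<nu>))
      = (if q = p then real N * (?dh p y * ?dh p x) else 0)"
    proof (cases "p = q")
      case True
      have "fst p \<le> k" using pq by (auto simp: disk_indices_def)
      from zonal_constants[OF mu this] have c: "?K * gegcoef (\<mu> + 1/2) k (fst p) * disk_lambda \<mu>
          (fst p) k = 1" .
      \<comment> \<open>The boundary value \<open>hp p\<close> enters once from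
        \<open>disk_P\<close> on the circle and once as a divisor in the ridge expansion, and
        cancels; \<open>disk_d\<close> cancels against the discrete norm of the trigonometric
        function.\<close>
      have "g p * hp p * disk_d (fst p) k = gegcoef (\<mu> + 1/2) k (fst p)" using hp[of p] dd by
          (simp add: g_def)
      then have c': "?K * disk_lambda \<mu> (fst p) k * (g p * hp p * disk_d (fst p) k) = 1" using c
          by (simp only: mult_ac)
      have "(?K * disk_lambda \<mu> (fst p) k * hp p * ?dh p x * g p * ?dh p y) * (real N * disk_d
          (fst p) k)
        = (?K * disk_lambda \<mu> (fst p) k * (g p * hp p * disk_d (fst p) k)) * (real N * (?dh p y *
            ?dh p x))"
        by (simp only: mult_ac)
      then show ?thesis unfolding o c' using True by simp
    qed (simp add: o)
  qed
  also have "\<dots> = (\<Sum>p\<in>disk_indices k. real N * (?dh p y * ?dh p x))"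
    by (intro sum.cong refl) (simp add: finite_disk_indices)
  finally show ?thesis by (simp only: sum_distrib_left)
qed

lemma kernel_quadrature:
  fixes n s :: nat
  defines "N \<equiv> s * (n + 1)" and "\<xi> \<equiv> \<lambda>\<nu>. real \<nu> * pi / real (n + 1)"
  assumes mu: "\<mu> \<ge> 0" and l: "l \<le> n"
  shows "(\<Sum>\<nu><N. kern_poly \<mu> l (\<xi> \<nu>) x y) = real N * (ball_const \<mu> * (\<Sum>t\<in>ball_ix l. ball_E \<mu> t y *
      ball_E \<mu> t x))"
proof -
  let ?g = "\<lambda>k z. poly (gegN (real k + \<mu> + 1) (l - k)) (z$3)"
  let ?dh = "\<lambda>k p. disk_hom \<mu> k (fst p) (snd p)"
  have "(\<Sum>\<nu><N. kern_poly \<mu> l (\<xi> \<nu>) x y) = ball_const \<mu> * (\<Sum>k\<le>l. ball_h_sq \<mu> k * (\<Sum>\<nu><N. (real k + \<mu>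
      + 1/2) / (\<mu> + 1/2) * disk_D_hom \<mu> k (\<xi> \<nu>) x *
     Zon (\<mu> + 1/2) k (rot3 (- \<xi> \<nu>) y)) * ?g k y * ?g k x)"
    unfolding kern_poly_def sum_distrib_left[symmetric]
    by (subst sum.swap) (simp only: sum_distrib_left[symmetric] sum_distrib_right[symmetric])
  also have "\<dots> = ball_const \<mu> * (\<Sum>k\<le>l. ball_h_sq \<mu> k * (real N * (\<Sum>p\<in>disk_indices k. ?dh k p y *
      ?dh k p x)) * ?g k y * ?g k x)"
  proof -
    have "(\<Sum>\<nu><N. (real k + \<mu> + 1/2) / (\<mu> + 1/2) * disk_D_hom \<mu> k (\<xi> \<nu>) x *
     Zon (\<mu> + 1/2) k (rot3 (- \<xi> \<nu>) y)) = real N * (\<Sum>p\<in>disk_indices k. ?dh k p y * ?dh k p x)" if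
         "k \<in> {..l}" for k
      unfolding N_def \<xi>_def by (rule disk_quadrature[OF mu]) (use that l in simp)
    then show ?thesis by (intro arg_cong[where f = "\<lambda>z. ball_const \<mu> * z"] sum.cong refl) (simp only:)
  qed
  also have "\<dots> = ball_const \<mu> * (\<Sum>k\<le>l. \<Sum>p\<in>disk_indices k. real N * (ball_E \<mu> (l, k, p) y * ball_E
      \<mu> (l, k, p) x))"
  proof -
    have "ball_h_sq \<mu> k * (real N * (\<Sum>p\<in>disk_indices k. ?dh k p y * ?dh k p x)) * ?g k y * ?g k x =
       (\<Sum>p\<in>disk_indices k. real N * (ball_E \<mu> (l, k, p) y * ball_E \<mu> (l, k, p) x))" for k
    proof -
      define s where "s = sqrt (ball_h_sq \<mu> k)"
      have E: "ball_E \<mu> (l, k, p) z = s * ?dh k p z * ?g k z" for p z by (cases p) (simp add: s_def)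
      have h: "ball_h_sq \<mu> k = s * s"
        using ball_h_sq_pos[OF mu, of k] by (simp add: s_def)
      show ?thesis unfolding sum_distrib_left sum_distrib_right E h
        by (intro sum.cong refl) (simp only: mult_ac)
    qed
    then show ?thesis by simp
  qed
  also have "\<dots> = real N * (ball_const \<mu> * (\<Sum>k\<le>l. \<Sum>p\<in>disk_indices k. ball_E \<mu> (l, k, p) y * ball_E
      \<mu> (l, k, p) x))"
    by (simp only: sum_distrib_left[symmetric] mult.left_commute)
  also have "(\<Sum>k\<le>l. \<Sum>p\<in>disk_indices k. ball_E \<mu> (l, k, p) y * ball_E \<mu> (l, k, p) x) = (\<Sum>t\<in>ball_ix
      l. ball_E \<mu> t y * ball_E \<mu> t x)"
  proof -
    have "ball_ix l = Pair l ` (SIGMA k:{..l}. disk_indices k)" by (auto simp: ball_ix_def)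
    then have "(\<Sum>t\<in>ball_ix l. ball_E \<mu> t y * ball_E \<mu> t x) = (\<Sum>t\<in>(SIGMA k:{..l}. disk_indices k).
        ball_E \<mu> (l, t) y * ball_E \<mu> (l, t) x)"
      by (simp only:) (subst sum.reindex, auto simp: inj_on_def)
    also have "\<dots> = (\<Sum>k\<le>l. \<Sum>p\<in>disk_indices k. ball_E \<mu> (l, k, p) y * ball_E \<mu> (l, k, p) x)"
      by (subst sum.Sigma) (auto simp: finite_disk_indices split_beta)
    finally show ?thesis by simp
  qed
  finally show ?thesis .
qed

section \<open>Radon projections\<close>

text \<open>Measurability of f is a conclusion drawn from the almost everywhere equality. This suits
  iterated integrals of a Lebesgue measurable function, whose sections are known only up to null
  sets.\<close>

lemma lebesgue_integral_AE_borel: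
  fixes f g :: "real \<Rightarrow> real"
  assumes g: "g \<in> borel_measurable borel" and ae: "AE x in lborel. f x = g x"
  shows "integral\<^sup>L lebesgue f = integral\<^sup>L lborel g"
proof -
  have gl: "g \<in> borel_measurable lebesgue" using g by (intro measurable_completion) simp
  have ae': "AE x in lebesgue. g x = f x" using AE_completion[OF ae] by (auto simp: eq_commute)
  have "f \<in> borel_measurable lebesgue" by (rule borel_measurable_AE[OF gl ae'])
  then have "integral\<^sup>L lebesgue f = integral\<^sup>L lebesgue g"
    using gl AE_completion[OF ae] by (intro integral_cong_AE) auto
  also have "\<dots> = integral\<^sup>L lborel g" using g by (intro integral_completion) simp
  finally show ?thesis .
qed

lemma radon_line_rot3: "radon_line \<theta> t w s = rot3 \<theta> (vec3 w (t * sqrt (1 - w\<^sup>2)) s)"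
  by (simp add: radon_line_def vec_eq_iff forall_3)

lemma radon_segment_iff: "radon_line \<theta> t w s \<in> radon_segment \<theta> t w \<longleftrightarrow> radon_line \<theta> t w s \<in> cball 0 1"
proof -
  let ?u = "t * sqrt (1 - w\<^sup>2)"
  have "(?u * cos \<theta> - s * sin \<theta>) * cos \<theta> + (?u * sin \<theta> + s * cos \<theta>) * sin \<theta> = ?u"
    using sin_cos_squared_add[of \<theta>] by algebra
  then show ?thesis unfolding radon_segment_def radon_line_rot3 by simp
qed

lemma radon_bw: "radon \<mu> \<theta> f t w = (\<integral>s. f (radon_line \<theta> t w s) * bw \<mu> (radon_line \<theta> t w s) \<partial>lebesgue)"
  unfolding radon_def set_lebesgue_integral_def radon_segment_iff bw_def
  by (intro Bochner_Integration.integral_cong refl) (auto simp: indicator_def)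

lemma tpar_rot3_vec3:
  assumes "\<bar>w\<bar> < 1"
  shows "tpar \<xi> (rot3 \<xi> (vec3 w (t * sqrt (1 - w\<^sup>2)) s)) = t"
proof -
  let ?u = "t * sqrt (1 - w\<^sup>2)"
  have "w\<^sup>2 < 1" using assms by (simp add: abs_square_less_1)
  moreover have "(?u * cos \<xi> - s * sin \<xi>) * cos \<xi> + (?u * sin \<xi> + s * cos \<xi>) * sin \<xi> = ?u"
    using sin_cos_squared_add[of \<xi>] by algebra
  ultimately show ?thesis unfolding tpar_def by simp
qed

text \<open>In rotated coordinates a segment has constant w and t, and K is constant along it, so
  the integral along it is a Radon projection times \<Phi>. The factor \<open>sqrt (1 - w^2)\<close>
  is the Jacobian of passing from t to the distance of the line from the axis. All equalities are
  derived off the Borel null set \<open>N\<close>, where f times the weight may differ from its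
  Borel version.\<close>

lemma radon_integral:
  fixes f K :: "real^3 \<Rightarrow> real" and \<Phi> :: "real \<Rightarrow> real \<Rightarrow> real"
  assumes f: "integrable lebesgue (\<lambda>x. f x * bw \<mu> x)" and K: "continuous_on UNIV K"
    and \<Phi>: "\<And>y. \<bar>y$3\<bar> < 1 \<Longrightarrow> \<Phi> (tpar \<xi> y) (y$3) = K y"
  shows "(LINT w:{-1<..<1}|lebesgue. (LINT t:{-1<..<1}|lebesgue. radon \<mu> \<xi> f t w * \<Phi> t w) * sqrt
      (1 - w\<^sup>2)) = bint \<mu> (\<lambda>y. f y * K y)"
proof -
  obtain g' where g': "g' \<in> borel_measurable lborel" and ae': "AE x in lborel. f x * bw \<mu> x = g' x"
    using completion_ex_borel_measurable_real[OF borel_measurable_integrable[OF f]] by auto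
  \<comment> \<open>The cut at the open ball makes the line integrals \<open>H w t\<close> vanish
    exactly for lines that miss it, see \<open>H0\<close>; the weight is 0 outside, so nothing is
    lost.\<close>
  define g where "g x = indicator (ball 0 1) x * g' x" for x
  have gm [measurable]: "g \<in> borel_measurable borel" using g' unfolding g_def[abs_def]
    by (intro borel_measurable_times borel_measurable_indicator) simp_all
  have ae: "AE x in lborel. f x * bw \<mu> x = g x"
    using ae'
  proof eventually_elim
    case (elim x)
    have "bw \<mu> x = 0" if "x \<notin> ball 0 1"
    proof -
      have "\<not> norm x < 1" using that by simp
      then have "\<not> (norm x)\<^sup>2 < 1" by (simp add: abs_square_less_1)
      then show ?thesis by (simp add: bw_eq norm_vec3_sq)
    qed
    then show ?case using elim by (auto simp: g_def indicator_def)
  qed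
  obtain N where N: "{x. f x * bw \<mu> x \<noteq> g x} \<subseteq> N" "emeasure lborel N = 0" "N \<in> sets borel"
    using AE_E[OF ae] by auto
  have Km [measurable]: "K \<in> borel_measurable borel" using K by (rule borel_measurable_continuous_onI)
  define G where "G x = g x * K x" for x
  have Gm [measurable]: "G \<in> borel_measurable borel" unfolding G_def[abs_def] by measurable
  have aeG: "AE x in lborel. f x * K x * bw \<mu> x = G x"
    using ae by eventually_elim (simp add: G_def)
  have "integrable lebesgue G"
  proof (rule integrable_cong_AE_imp[OF integrable_mult_bw[OF f K]])
    show "G \<in> borel_measurable lebesgue" by (intro measurable_completion) simp
    show "AE x in lebesgue. f x * K x * bw \<mu> x = G x" by (rule AE_completion[OF aeG])
  qed
  then have Gi: "integrable lborel G" by (subst (asm) integrable_completion) auto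
  have Gri: "integrable lborel (\<lambda>x. G (rot3 \<xi> x))"
    using Gi by (subst (asm) lborel_rot3[of \<xi>], subst (asm) integrable_distr_eq) auto
  have bint: "bint \<mu> (\<lambda>y. f y * K y) = (\<integral>w. (\<integral>t. (\<integral>s. G (rot3 \<xi> (vec3 w t s)) \<partial>lborel) \<partial>lborel)
      \<partial>lborel)"
  proof -
    have "bint \<mu> (\<lambda>y. f y * K y) = integral\<^sup>L lebesgue G"
      unfolding bint_def
    proof (rule integral_cong_AE)
      show "(\<lambda>x. f x * K x * bw \<mu> x) \<in> borel_measurable lebesgue"
        using borel_measurable_integrable[OF integrable_mult_bw[OF f K]] .
      show "G \<in> borel_measurable lebesgue" by (intro measurable_completion) simp
      show "AE x in lebesgue. f x * K x * bw \<mu> x = G x" by (rule AE_completion[OF aeG])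
    qed
    also have "\<dots> = integral\<^sup>L lborel G" by (intro integral_completion) simp
    also have "\<dots> = integral\<^sup>L lborel (\<lambda>x. G (rot3 \<xi> x))"
      by (subst lborel_rot3[of \<xi>], subst integral_distr) auto
    finally show ?thesis unfolding integral_vec3[OF Gri] .
  qed
  define H where "H w t = (\<integral>s. G (rot3 \<xi> (vec3 w t s)) \<partial>lborel)" for w t
  have Hm [measurable]: "(\<lambda>p. H (fst p) (snd p)) \<in> borel_measurable (lborel \<Otimes>\<^sub>M lborel)"
    unfolding H_def by measurable
  \<comment> \<open>The linear measure of the part of a line that lies in \<open>N\<close>; by
    Tonelli and rotation invariance it is 0 for almost all lines.\<close>
  define e where "e w t = (\<integral>\<^sup>+s. indicator N (rot3 \<xi> (vec3 w t s)) \<partial>lborel)" for w t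
  have Nm [measurable]: "N \<in> sets borel" by (rule N(3))
  have em: "e w \<in> borel_measurable borel" for w unfolding e_def[abs_def] by measurable
  have aeN: "AE w in lborel. AE t in lborel. e w t = 0"
  proof -
    have "(\<integral>\<^sup>+x. indicator N (rot3 \<xi> x) \<partial>lborel) = (\<integral>\<^sup>+x. indicator N x \<partial>(distr lborel borel (rot3 \<xi>)))"
      by (subst nn_integral_distr) auto
    also have "\<dots> = 0" using N(2) unfolding lborel_rot3[of \<xi>, symmetric] by simp
    finally have "(\<integral>\<^sup>+w. (\<integral>\<^sup>+t. e w t \<partial>lborel) \<partial>lborel) = 0"
      by (subst (asm) nn_integral_vec3) (auto simp: e_def)
    moreover have "(\<lambda>w. \<integral>\<^sup>+t. e w t \<partial>lborel) \<in> borel_measurable lborel" unfolding e_def by measurable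
    ultimately have "AE w in lborel. (\<integral>\<^sup>+t. e w t \<partial>lborel) = 0" by (simp add: nn_integral_0_iff_AE)
    then show ?thesis
    proof eventually_elim
      case (elim w)
      then show ?case using em[of w] by (subst (asm) nn_integral_0_iff_AE) auto
    qed
  qed
  have H0: "H w t = 0" if "w\<^sup>2 + t\<^sup>2 \<ge> 1" for w t
  proof -
    have "G (rot3 \<xi> (vec3 w t s)) = 0" for s
    proof -
      have "(norm (rot3 \<xi> (vec3 w t s)))\<^sup>2 \<ge> 1"
        unfolding norm_rot3 norm_vec3_sq vec3_nth using that zero_le_power2[of s] by linarith
      then have "\<not> norm (rot3 \<xi> (vec3 w t s)) < 1"
        by (metis abs_norm_cancel abs_square_less_1 linorder_not_less)
      then show ?thesis by (simp add: G_def g_def)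
    qed
    then show ?thesis by (simp add: H_def)
  qed
  have inner: "(LINT t:{-1<..<1}|lebesgue. radon \<mu> \<xi> f t w * \<Phi> t w) * sqrt (1 - w\<^sup>2) = (\<integral>t. H w t
      \<partial>lborel)"
    if w: "\<bar>w\<bar> < 1" and aew: "AE t in lborel. e w t = 0" for w
  proof -
    define \<beta> where "\<beta> = sqrt (1 - w\<^sup>2)"
    have "w\<^sup>2 < 1" using w by (simp add: abs_square_less_1)
    then have b: "\<beta> > 0" "\<beta>\<^sup>2 = 1 - w\<^sup>2" by (auto simp: \<beta>_def)
    have Hw: "H w \<in> borel_measurable borel" unfolding H_def[abs_def] by measurable
    have Hb: "(\<lambda>t. H w (0 + \<beta> * t)) \<in> borel_measurable borel"
      using measurable_compose[OF _ Hw, of "\<lambda>t. 0 + \<beta> * t" borel] by simp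
    \<comment> \<open>Scaling by the positive number \<beta> preserves null sets of t.\<close>
    have "AE t in lborel. e w (0 + \<beta> * t) = 0"
      using b em[of w] by (intro AE_borel_affine[OF _ _ aew]) auto
    then have "AE t in lborel. indicator {-1<..<1} t *\<^sub>R (radon \<mu> \<xi> f t w * \<Phi> t w) = H w (0 + \<beta> * t)"
    proof eventually_elim
      case (elim t)
      show ?case
      proof (cases "t \<in> {-1<..<1}")
        case False
        then have "t\<^sup>2 \<ge> 1" by (metis abs_square_less_1 abs_less_iff greaterThanLessThan_iff
            linorder_not_less minus_less_iff)
        then have "(1 - w\<^sup>2) * 1 \<le> (1 - w\<^sup>2) * t\<^sup>2"
          using \<open>w\<^sup>2 < 1\<close> by (intro mult_left_mono) auto
        moreover have "w\<^sup>2 + z \<ge> 1" if "(1 - w\<^sup>2) * 1 \<le> z" for z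
          using that by simp
        ultimately have "w\<^sup>2 + (0 + \<beta> * t)\<^sup>2 \<ge> 1"
          unfolding add_0 power_mult_distrib b(2) by blast
        then show ?thesis using H0 False by simp
      next
        case True
        let ?L = "\<lambda>s. rot3 \<xi> (vec3 w (0 + \<beta> * t) s)"
        have L: "radon_line \<xi> t w s = ?L s" for s by (simp add: radon_line_rot3 \<beta>_def mult.commute)
        have Lm: "?L \<in> borel_measurable borel" by measurable
        have "AE s in lborel. indicator N (?L s) = (0::ennreal)"
          using elim unfolding e_def by (subst (asm) nn_integral_0_iff_AE) auto
        then have "AE s in lborel. f (?L s) * bw \<mu> (?L s) = g (?L s)"
        proof eventually_elim
          case (elim s)
          then have "?L s \<notin> N" by (auto simp: indicator_def)
          then show ?case using N(1) by blast
        qed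
        then have "radon \<mu> \<xi> f t w = (\<integral>s. g (?L s) \<partial>lborel)"
          unfolding radon_bw L by (intro lebesgue_integral_AE_borel) (use measurable_compose[OF Lm
              gm] in simp)
        \<comment> \<open>On the segment the kernel depends on t and w only, so it leaves the
          integral over s.\<close>
        moreover have "K (?L s) = \<Phi> t w" for s
          using \<Phi>[of "?L s"] w tpar_rot3_vec3[OF w, of \<xi> t s] by (simp add: \<beta>_def mult.commute)
        ultimately have "radon \<mu> \<xi> f t w * \<Phi> t w = H w (0 + \<beta> * t)"
          by (simp add: H_def G_def)
        then show ?thesis using True by simp
      qed
    qed
    then have "(LINT t:{-1<..<1}|lebesgue. radon \<mu> \<xi> f t w * \<Phi> t w) = (\<integral>t. H w (0 + \<beta> * t) \<partial>lborel)"
      unfolding set_lebesgue_integral_def by (rule lebesgue_integral_AE_borel[OF Hb])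
    moreover have "(\<integral>t. H w t \<partial>lborel) = \<bar>\<beta>\<bar> *\<^sub>R (\<integral>t. H w (0 + \<beta> * t) \<partial>lborel)"
      by (rule lborel_integral_real_affine) (use b in simp)
    ultimately show ?thesis using b by (simp add: \<beta>_def[symmetric])
  qed
  have "(\<lambda>w. \<integral>t. H w t \<partial>lborel) \<in> borel_measurable borel"
    unfolding H_def by measurable
  moreover have "AE w in lborel. indicator {-1<..<1} w *\<^sub>R ((LINT t:{-1<..<1}|lebesgue. radon \<mu> \<xi>
      f t w * \<Phi> t w) * sqrt (1 - w\<^sup>2)) = (\<integral>t. H w t \<partial>lborel)"
    using aeN
  proof eventually_elim
    case (elim w)
    show ?case
    proof (cases "w \<in> {-1<..<1}")
      case True
      then show ?thesis using inner[OF _ elim] by (simp add: abs_less_iff)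
    next
      case False
      then have "w\<^sup>2 \<ge> 1" by (metis abs_square_less_1 abs_less_iff greaterThanLessThan_iff
          linorder_not_less minus_less_iff)
      then have "w\<^sup>2 + t\<^sup>2 \<ge> 1" for t using zero_le_power2[of t] by linarith
      then show ?thesis using H0 False by simp
    qed
  qed
  ultimately have "(LINT w:{-1<..<1}|lebesgue. (LINT t:{-1<..<1}|lebesgue. radon \<mu> \<xi> f t w * \<Phi> t
      w) * sqrt (1 - w\<^sup>2)) = (\<integral>w. (\<integral>t. H w t \<partial>lborel) \<partial>lborel)"
    unfolding set_lebesgue_integral_def[of lebesgue "{-1<..<1}" "\<lambda>w. _ w * sqrt (1 - w\<^sup>2)"] by
        (rule lebesgue_integral_AE_borel)
  then show ?thesis unfolding bint H_def .
qed

lemma partial_sum_quadrature: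
  fixes n s :: nat and f :: "real^3 \<Rightarrow> real"
  defines "N \<equiv> s * (n + 1)" and "\<xi> \<equiv> \<lambda>\<nu>. real \<nu> * pi / real (n + 1)"
  assumes mu: "\<mu> \<ge> 0" and s: "s > 0" and f: "f \<in> ball_L2 \<mu>"
  shows "(\<Sum>\<nu><N. LINT w:{-1<..<1}|lebesgue.
      (LINT t:{-1<..<1}|lebesgue. radon \<mu> (\<xi> \<nu>) f t w * kernel_Phi \<mu> n (\<xi> \<nu>) t w x) * sqrt (1 - w\<^sup>2)) =
    real N * ball_partial_sum \<mu> n f x"
proof -
  have fi: "integrable lebesgue (\<lambda>x. f x * bw \<mu> x)" by (rule ball_L2_integrable[OF mu f])
  define K where "K \<nu> y = (\<Sum>l\<le>n. kern_poly \<mu> l (\<xi> \<nu>) x y)" for \<nu> y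
  have Kc: "continuous_on UNIV (K \<nu>)" for \<nu>
    unfolding K_def[abs_def] by (intro continuous_intros continuous_kern_poly)
  have Ec: "t \<in> ball_ix l \<Longrightarrow> continuous_on UNIV (ball_E \<mu> t)" for t l
    using ball_E_continuous[OF mu ball_ix_IX[OF mu, of t l l]] by simp
  have "(\<Sum>\<nu><N. LINT w:{-1<..<1}|lebesgue.
      (LINT t:{-1<..<1}|lebesgue. radon \<mu> (\<xi> \<nu>) f t w * kernel_Phi \<mu> n (\<xi> \<nu>) t w x) * sqrt (1 - w\<^sup>2))
    = (\<Sum>\<nu><N. bint \<mu> (\<lambda>y. f y * K \<nu> y))"
    by (intro sum.cong refl radon_integral[OF fi Kc]) (simp add: kernel_Phi_def K_def
        kernel_G_tpar[OF mu])
  also have "\<dots> = bint \<mu> (\<lambda>y. \<Sum>\<nu><N. f y * K \<nu> y)"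
    by (intro bint_sum[symmetric] integrable_mult_bw[OF fi Kc])
  also have "(\<lambda>y. \<Sum>\<nu><N. f y * K \<nu> y) = (\<lambda>y. \<Sum>l\<le>n. \<Sum>t\<in>ball_ix l. (real N * ball_const \<mu> * ball_E \<mu>
      t x) * (f y * ball_E \<mu> t y))"
  proof
    fix y
    have "(\<Sum>\<nu><N. f y * K \<nu> y) = f y * (\<Sum>l\<le>n. \<Sum>\<nu><N. kern_poly \<mu> l (\<xi> \<nu>) x y)"
      unfolding K_def sum_distrib_left[symmetric] by (subst sum.swap) simp
    also have "\<dots> = f y * (\<Sum>l\<le>n. real N * (ball_const \<mu> * (\<Sum>t\<in>ball_ix l. ball_E \<mu> t y * ball_E \<mu> t x)))"
      unfolding N_def \<xi>_def by (intro arg_cong[where f = "\<lambda>z. f y * z"] sum.cong refl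
          kernel_quadrature[OF mu]) simp
    also have "\<dots> = (\<Sum>l\<le>n. \<Sum>t\<in>ball_ix l. (real N * ball_const \<mu> * ball_E \<mu> t x) * (f y * ball_E \<mu> t y))"
      unfolding sum_distrib_left by (intro sum.cong refl) (simp only: mult_ac)
    finally show "(\<Sum>\<nu><N. f y * K \<nu> y) = \<dots>" .
  qed
  also have "bint \<mu> \<dots> = (\<Sum>l\<le>n. \<Sum>t\<in>ball_ix l. (real N * ball_const \<mu> * ball_E \<mu> t x) * bint \<mu> (\<lambda>y.
      f y * ball_E \<mu> t y))"
  proof -
    have i: "integrable lebesgue (\<lambda>y. (real N * ball_const \<mu> * ball_E \<mu> t x) * (f y * ball_E \<mu> t
        y) * bw \<mu> y)" if "t \<in> ball_ix l" for t l
      using integrable_mult_right[OF integrable_mult_bw[OF fi Ec[OF that]], of "real N *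
          ball_const \<mu> * ball_E \<mu> t x"]
      by (simp only: mult.assoc)
    have i2: "integrable lebesgue (\<lambda>y. (\<Sum>t\<in>ball_ix l. (real N * ball_const \<mu> * ball_E \<mu> t x) * (f
        y * ball_E \<mu> t y)) * bw \<mu> y)" for l
      unfolding sum_distrib_right by (intro Bochner_Integration.integrable_sum i)
    have "bint \<mu> (\<lambda>y. \<Sum>l\<le>n. \<Sum>t\<in>ball_ix l. (real N * ball_const \<mu> * ball_E \<mu> t x) * (f y * ball_E \<mu> t y))
       = (\<Sum>l\<le>n. bint \<mu> (\<lambda>y. \<Sum>t\<in>ball_ix l. (real N * ball_const \<mu> * ball_E \<mu> t x) * (f y * ball_E \<mu>
           t y)))"
      by (rule bint_sum) (rule i2)
    also have "\<dots> = (\<Sum>l\<le>n. \<Sum>t\<in>ball_ix l. bint \<mu> (\<lambda>y. (real N * ball_const \<mu> * ball_E \<mu> t x) * (f y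
        * ball_E \<mu> t y)))"
      by (intro sum.cong refl bint_sum i)
    finally show ?thesis by (simp only: bint_cmult)
  qed
  also have "\<dots> = real N * ball_partial_sum \<mu> n f x"
    unfolding ball_partial_sum_def ball_proj_eq[OF mu f] ball_inner_bint sum_distrib_left
    by (intro sum.cong refl) (simp only: mult_ac)
  finally show ?thesis .
qed

theorem corollary4p5:
  fixes \<mu> :: real and n :: nat and \<xi> :: "nat \<Rightarrow> real"
    and f :: "real^3 \<Rightarrow> real" and x :: "real^3"
  assumes "\<mu> \<ge> 0"
    and "\<And>\<nu>. \<nu> \<le> 2 * n + 1 \<Longrightarrow> \<xi> \<nu> = real \<nu> * pi / real (n + 1)"
    and "f \<in> ball_L2 \<mu>"
    and "x \<in> cball 0 1"
  shows "ball_partial_sum \<mu> n f x =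
           1 / real (n + 1) *
           (\<Sum>\<nu>=0..n. LINT w:{-1<..<1}|lebesgue.
              (LINT t:{-1<..<1}|lebesgue.
                 radon \<mu> (\<xi> \<nu>) f t w * kernel_Phi \<mu> n (\<xi> \<nu>) t w x) * sqrt (1 - w\<^sup>2)) \<and>
         ball_partial_sum \<mu> n f x =
           1 / real (2 * n + 2) *
           (\<Sum>\<nu>=0..2*n+1. LINT w:{-1<..<1}|lebesgue.
              (LINT t:{-1<..<1}|lebesgue.
                 radon \<mu> (\<xi> \<nu>) f t w * kernel_Phi \<mu> n (\<xi> \<nu>) t w x) * sqrt (1 - w\<^sup>2))"
proof -
  let ?I = "\<lambda>\<theta>. LINT w:{-1<..<1}|lebesgue.
    (LINT t:{-1<..<1}|lebesgue. radon \<mu> \<theta> f t w * kernel_Phi \<mu> n \<theta> t w x) * sqrt (1 - w\<^sup>2)"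
  have sum: "(\<Sum>\<nu>=0..m. ?I (\<xi> \<nu>)) = real (Suc m) * ball_partial_sum \<mu> n f x"
    if m: "Suc m = s * (n + 1)" "s > 0" "m \<le> 2 * n + 1" for m s
  proof -
    have "(\<Sum>\<nu>=0..m. ?I (\<xi> \<nu>)) = (\<Sum>\<nu><s * (n + 1). ?I (real \<nu> * pi / real (n + 1)))"
      \<comment> \<open>The nodes are prescribed only up to the index 2 n + 1, hence the bound on
        m.\<close>
      by (rule sum.cong) (use m assms(2) in \<open>auto simp: m(1)[symmetric]\<close>)
    also have "\<dots> = real (Suc m) * ball_partial_sum \<mu> n f x"
      unfolding m(1) by (rule partial_sum_quadrature[OF assms(1) m(2) assms(3)])
    finally show ?thesis .
  qed
  have "(\<Sum>\<nu>=0..n. ?I (\<xi> \<nu>)) = real (n + 1) * ball_partial_sum \<mu> n f x"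
    using sum[of n 1] by simp
  moreover have "(\<Sum>\<nu>=0..2*n+1. ?I (\<xi> \<nu>)) = real (2 * n + 2) * ball_partial_sum \<mu> n f x"
    using sum[of "2 * n + 1" 2] by simp
  ultimately show ?thesis by simp
qed

end
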